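(* Let $\Omega\subset\mathbb{R}^3$ be a bounded domain with $C^2$ boundary, let $\epsilon_0,\mu_0>0$ be constants, $\omega>0$ a frequency such that the boundary value problems below are uniquely solvable, and $k=\omega\sqrt{\epsilon_0\mu_0}$. Let $\sigma\in L^\infty(\Omega)$ satisfy $\|\sigma\|_{(1)}(\Omega)\le M_1$ and $\sigma=0$ on $\partial\Omega$, and assume $k\ge 1$. Let $0<\alpha\le 1$ and let $\varepsilon$, the operator norm of the linearised boundary map $\Lambda'$ (defined in the context) from $\mathrm{TH}(\partial\Omega)$ to $\mathrm{TH}(\partial\Omega)$, satisfy $0<\varepsilon<1$. Put $\mathcal{E}=-\ln\varepsilon$, and let $\chi_k(\mathcal{E})=0$ if $\mathcal{E}<k$ and $\chi_k(\mathcal{E})=1$ if $k\le\mathcal{E}$. Then \[ \begin{aligned} \|\sigma\|^{2}_{(0)}(\Omega) &\leq \frac{4}{3\pi^{2}} (\mathrm{Vol}(\Omega))^{2} \Big( (1-\chi_{k}(\mathcal{E})) (1+k)^{4} k^{3\alpha} + \chi_{k}(\mathcal{E}) (1+\mathcal{E})^{4} \mathcal{E}^{3} \Big) \varepsilon^{2} \\ &\qquad + \chi_{k}(\mathcal{E}) \frac{1}{4\pi^{2}} (\mathrm{Vol}_{2}(\Omega))^{2} \frac{1}{D} \big(1+(2D)^{2}\big)^{1/2} (1+\mathcal{E})^{4} \mathcal{E} \varepsilon \\ &\qquad + M_{1}^{2} \Big( (1-\chi_{k}(\mathcal{E})) \frac{1}{1+2\mathcal{E}^{2\alpha}+2k^{2\alpha}}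 + \chi_{k}(\mathcal{E}) \frac{1}{1+\frac{\mathcal{E}^{2}}{D^{2}}+4k^{2}} \Big). \end{aligned} \]
   Context: $\|\cdot\|_{(\ell)}(\Omega)$ denotes the norm of the Sobolev space $H^\ell(\Omega)$. $H(\Omega;\mathrm{curl})=\{u\in H^0(\Omega)^3:\ \mathrm{curl}\,u\in H^0(\Omega)^3\}$. $\mathrm{TH}(\partial\Omega)$ is the space of tangential traces $u\times\nu|_{\partial\Omega}$ of $u\in H(\Omega;\mathrm{curl})$ ($\nu$ the outward unit normal), normed by $\|g\|_{\mathrm{TH}(\partial\Omega)}=\inf\big(\|u\|_{(0)}(\Omega)+\|\mathrm{curl}\,u\|_{(0)}(\Omega)\big)$ over all $u\in H(\Omega;\mathrm{curl})$ with $u\times\nu=g$ on $\partial\Omega$. The linearised map is $\Lambda': E(\,;0)\times\nu|_{\partial\Omega}\mapsto H(\,;1)\times\nu|_{\partial\Omega}$, where $(E(\,;0),H(\,;0))\in H(\Omega;\mathrm{curl})^2$ solves $\mathrm{curl}\,E(\,;0)-i\omega\mu_0H(\,;0)=0$, $\mathrm{curl}\,H(\,;0)+i\omega\epsilon_0E(\,;0)=0$ in $\Omega$ with $E(\,;0)\times\nu=g$ on $\partial\Omega$, and $(E(\,;1),H(\,;1))$ solves $\mathrm{curl}\,E(\,;1)-i\omega\mu_0H(\,;1)=0$, $\mathrm{curl}\,H(\,;1)+i\omega\epsilon_0E(\,;1)=\sigma E(\,;0)$ in $\Omega$ with $E(\,;1)\times\nu=0$ on $\partial\Omega$. $D=\sup_{x,y\in\Omega}|x-y|$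 is the diameter of $\Omega$, $\mathrm{Vol}(\Omega)$ its volume, and $\mathrm{Vol}_2(\Omega)$ the supremum of the areas of all 2-dimensional orthogonal projections of $\Omega$. *)

theory Defs
  imports "HOL-Analysis.Analysis"
begin

definition partial_deriv :: "'n::finite \<Rightarrow> (real^'n \<Rightarrow> 'b::real_normed_vector) \<Rightarrow> real^'n \<Rightarrow> 'b" where
  "partial_deriv j f x = vector_derivative (\<lambda>t. f (x + t *\<^sub>R axis j 1)) (at 0)"

fun Ck_on :: "nat \<Rightarrow> (real^'n::finite) set \<Rightarrow> (real^'n \<Rightarrow> 'b::real_normed_vector) \<Rightarrow> bool" where
  "Ck_on 0 U f = continuous_on U f"
| "Ck_on (Suc k) U f =
     (continuous_on U f \<and>
      (\<forall>j. \<forall>x\<in>U. (\<lambda>t. f (x + t *\<^sub>R axis j 1)) differentiable (at 0)) \<and>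
      (\<forall>j. Ck_on k U (partial_deriv j f)))"

definition smooth_on :: "(real^'n::finite) set \<Rightarrow> (real^'n \<Rightarrow> 'b::real_normed_vector) \<Rightarrow> bool" where
  "smooth_on U f \<longleftrightarrow> (\<forall>k. Ck_on k U f)"

definition test_fun :: "(real^3) set \<Rightarrow> (real^3 \<Rightarrow> 'b::real_normed_vector) \<Rightarrow> bool" where
  "test_fun \<Omega> \<phi> \<longleftrightarrow> smooth_on UNIV \<phi> \<and> compact (closure {x. \<phi> x \<noteq> 0})
                      \<and> closure {x. \<phi> x \<noteq> 0} \<subseteq> \<Omega>"

definition C2_boundary :: "(real^3) set \<Rightarrow> bool" where
  "C2_boundary \<Omega> \<longleftrightarrow>
     (\<forall>p\<in>frontier \<Omega>. \<exists>(Q::real^3 \<Rightarrow> real^3) (U::(real^2) set) (h::real^2 \<Rightarrow> real) r.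
        orthogonal_transformation Q \<and> r > 0 \<and> open U \<and> Ck_on 2 U h \<and>
        (\<forall>x\<in>ball p r. vector [Q (x - p) $ 1, Q (x - p) $ 2] \<in> U \<and>
            (x \<in> \<Omega> \<longleftrightarrow> Q (x - p) $ 3 < h (vector [Q (x - p) $ 1, Q (x - p) $ 2]))))"

definition L2 :: "(real^3) set \<Rightarrow> (real^3 \<Rightarrow> 'b::{real_normed_vector,second_countable_topology}) \<Rightarrow> bool" where
  "L2 \<Omega> u \<longleftrightarrow> u \<in> borel_measurable (lebesgue_on \<Omega>) \<and>
                integrable (lebesgue_on \<Omega>) (\<lambda>x. (norm (u x))\<^sup>2)"

definition L2norm :: "(real^3) set \<Rightarrow> (real^3 \<Rightarrow> 'b::real_normed_vector) \<Rightarrow> real" where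
  "L2norm \<Omega> u = sqrt (integral\<^sup>L (lebesgue_on \<Omega>) (\<lambda>x. (norm (u x))\<^sup>2))"

definition Linfty :: "(real^3) set \<Rightarrow> (real^3 \<Rightarrow> real) \<Rightarrow> bool" where
  "Linfty \<Omega> s \<longleftrightarrow> s \<in> borel_measurable (lebesgue_on \<Omega>) \<and>
                    (\<exists>B. AE x in lebesgue_on \<Omega>. \<bar>s x\<bar> \<le> B)"

definition weak_grad :: "(real^3) set \<Rightarrow> (real^3 \<Rightarrow> real) \<Rightarrow> (real^3 \<Rightarrow> real^3) \<Rightarrow> bool" where
  "weak_grad \<Omega> s g \<longleftrightarrow> L2 \<Omega> s \<and> L2 \<Omega> g \<and>
     (\<forall>\<phi>::real^3 \<Rightarrow> real. test_fun \<Omega> \<phi> \<longrightarrow> (\<forall>j.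
        integral\<^sup>L (lebesgue_on \<Omega>) (\<lambda>x. s x * partial_deriv j \<phi> x) =
        - integral\<^sup>L (lebesgue_on \<Omega>) (\<lambda>x. g x $ j * \<phi> x)))"

definition H1norm :: "(real^3) set \<Rightarrow> (real^3 \<Rightarrow> real) \<Rightarrow> (real^3 \<Rightarrow> real^3) \<Rightarrow> real" where
  "H1norm \<Omega> s g = sqrt ((L2norm \<Omega> s)\<^sup>2 + (L2norm \<Omega> g)\<^sup>2)"

text \<open>Vanishing trace on the boundary (weak Green formula: the boundary term
  int_{dOmega} s phi nu_j vanishes for every phi smooth up to the boundary).\<close>
definition zero_trace :: "(real^3) set \<Rightarrow> (real^3 \<Rightarrow> real) \<Rightarrow> (real^3 \<Rightarrow> real^3) \<Rightarrow> bool" where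
  "zero_trace \<Omega> s g \<longleftrightarrow>
     (\<forall>\<phi>::real^3 \<Rightarrow> real. smooth_on UNIV \<phi> \<longrightarrow> (\<forall>j.
        integral\<^sup>L (lebesgue_on \<Omega>) (\<lambda>x. s x * partial_deriv j \<phi> x + g x $ j * \<phi> x) = 0))"

definition cdot :: "complex^3 \<Rightarrow> complex^3 \<Rightarrow> complex" where
  "cdot a b = (\<Sum>i\<in>UNIV. a $ i * b $ i)"

definition curl :: "(real^3 \<Rightarrow> complex^3) \<Rightarrow> real^3 \<Rightarrow> complex^3" where
  "curl \<phi> x = vector
     [partial_deriv 2 (\<lambda>y. \<phi> y $ 3) x - partial_deriv 3 (\<lambda>y. \<phi> y $ 2) x,
      partial_deriv 3 (\<lambda>y. \<phi> y $ 1) x - partial_deriv 1 (\<lambda>y. \<phi> y $ 3) x,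
      partial_deriv 1 (\<lambda>y. \<phi> y $ 2) x - partial_deriv 2 (\<lambda>y. \<phi> y $ 1) x]"

text \<open>w is the weak curl of u, both in L^2; i.e. (u,w) represents an element of H(Omega;curl).\<close>
definition weak_curl :: "(real^3) set \<Rightarrow> (real^3 \<Rightarrow> complex^3) \<Rightarrow> (real^3 \<Rightarrow> complex^3) \<Rightarrow> bool" where
  "weak_curl \<Omega> u w \<longleftrightarrow> L2 \<Omega> u \<and> L2 \<Omega> w \<and>
     (\<forall>\<phi>. test_fun \<Omega> \<phi> \<longrightarrow>
        integral\<^sup>L (lebesgue_on \<Omega>) (\<lambda>x. cdot (u x) (curl \<phi> x)) =
        integral\<^sup>L (lebesgue_on \<Omega>) (\<lambda>x. cdot (w x) (\<phi> x)))"

text \<open>Tangential trace u x nu, as the functional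
  phi |-> int_Omega (curl u . phi - u . curl phi) on fields smooth up to the boundary.\<close>
definition tan_trace :: "(real^3) set \<Rightarrow> (real^3 \<Rightarrow> complex^3) \<Rightarrow> (real^3 \<Rightarrow> complex^3)
                         \<Rightarrow> (real^3 \<Rightarrow> complex^3) \<Rightarrow> complex" where
  "tan_trace \<Omega> u cu \<phi> =
     integral\<^sup>L (lebesgue_on \<Omega>) (\<lambda>x. cdot (cu x) (\<phi> x) - cdot (u x) (curl \<phi> x))"

definition same_tan_trace :: "(real^3) set \<Rightarrow> (real^3 \<Rightarrow> complex^3) \<Rightarrow> (real^3 \<Rightarrow> complex^3)
                         \<Rightarrow> (real^3 \<Rightarrow> complex^3) \<Rightarrow> (real^3 \<Rightarrow> complex^3) \<Rightarrow> bool" where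
  "same_tan_trace \<Omega> u cu v cv \<longleftrightarrow>
     (\<forall>\<phi>. smooth_on UNIV \<phi> \<longrightarrow> tan_trace \<Omega> u cu \<phi> = tan_trace \<Omega> v cv \<phi>)"

definition zero_tan_trace :: "(real^3) set \<Rightarrow> (real^3 \<Rightarrow> complex^3) \<Rightarrow> (real^3 \<Rightarrow> complex^3) \<Rightarrow> bool" where
  "zero_tan_trace \<Omega> u cu \<longleftrightarrow> (\<forall>\<phi>. smooth_on UNIV \<phi> \<longrightarrow> tan_trace \<Omega> u cu \<phi> = 0)"

text \<open>Norm in TH(dOmega) of the tangential trace of u (u with weak curl cu).\<close>
definition TH_norm :: "(real^3) set \<Rightarrow> (real^3 \<Rightarrow> complex^3) \<Rightarrow> (real^3 \<Rightarrow> complex^3) \<Rightarrow> real" where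
  "TH_norm \<Omega> u cu = Inf {L2norm \<Omega> v + L2norm \<Omega> cv | v cv.
                           weak_curl \<Omega> v cv \<and> same_tan_trace \<Omega> v cv u cu}"

definition maxwell_sol :: "real \<Rightarrow> real \<Rightarrow> real \<Rightarrow> (real^3) set \<Rightarrow> (real^3 \<Rightarrow> complex^3)
                          \<Rightarrow> (real^3 \<Rightarrow> complex^3) \<Rightarrow> (real^3 \<Rightarrow> complex^3) \<Rightarrow> bool" where
  "maxwell_sol \<omega> \<epsilon>\<^sub>0 \<mu>\<^sub>0 \<Omega> f E H \<longleftrightarrow>
     weak_curl \<Omega> E (\<lambda>x. (\<i> * \<omega> * \<mu>\<^sub>0) *s H x) \<and>
     weak_curl \<Omega> H (\<lambda>x. f x - (\<i> * \<omega> * \<epsilon>\<^sub>0) *s E x)"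

text \<open>Problem for (E(;0),H(;0)) with boundary datum g = v x nu (v in H(curl), curl v = cv).\<close>
definition problem0 :: "real \<Rightarrow> real \<Rightarrow> real \<Rightarrow> (real^3) set \<Rightarrow> (real^3 \<Rightarrow> complex^3) \<Rightarrow> (real^3 \<Rightarrow> complex^3)
                       \<Rightarrow> (real^3 \<Rightarrow> complex^3) \<Rightarrow> (real^3 \<Rightarrow> complex^3) \<Rightarrow> bool" where
  "problem0 \<omega> \<epsilon>\<^sub>0 \<mu>\<^sub>0 \<Omega> v cv E0 H0 \<longleftrightarrow>
     maxwell_sol \<omega> \<epsilon>\<^sub>0 \<mu>\<^sub>0 \<Omega> (\<lambda>x. 0) E0 H0 \<and>
     same_tan_trace \<Omega> E0 (\<lambda>x. (\<i> * \<omega> * \<mu>\<^sub>0) *s H0 x) v cv"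

definition problem1 :: "real \<Rightarrow> real \<Rightarrow> real \<Rightarrow> (real^3) set \<Rightarrow> (real^3 \<Rightarrow> real) \<Rightarrow> (real^3 \<Rightarrow> complex^3)
                       \<Rightarrow> (real^3 \<Rightarrow> complex^3) \<Rightarrow> (real^3 \<Rightarrow> complex^3) \<Rightarrow> bool" where
  "problem1 \<omega> \<epsilon>\<^sub>0 \<mu>\<^sub>0 \<Omega> \<sigma> E0 E1 H1 \<longleftrightarrow>
     maxwell_sol \<omega> \<epsilon>\<^sub>0 \<mu>\<^sub>0 \<Omega> (\<lambda>x. complex_of_real (\<sigma> x) *s E0 x) E1 H1 \<and>
     zero_tan_trace \<Omega> E1 (\<lambda>x. (\<i> * \<omega> * \<mu>\<^sub>0) *s H1 x)"

definition uniquely_solvable :: "real \<Rightarrow> real \<Rightarrow> real \<Rightarrow> (real^3) set \<Rightarrow> (real^3 \<Rightarrow> real) \<Rightarrow> bool" where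
  "uniquely_solvable \<omega> \<epsilon>\<^sub>0 \<mu>\<^sub>0 \<Omega> \<sigma> \<longleftrightarrow>
     (\<forall>v cv. weak_curl \<Omega> v cv \<longrightarrow> (\<exists>E0 H0. problem0 \<omega> \<epsilon>\<^sub>0 \<mu>\<^sub>0 \<Omega> v cv E0 H0)) \<and>
     (\<forall>v cv E0 H0. weak_curl \<Omega> v cv \<longrightarrow> problem0 \<omega> \<epsilon>\<^sub>0 \<mu>\<^sub>0 \<Omega> v cv E0 H0 \<longrightarrow>
        (\<exists>E1 H1. problem1 \<omega> \<epsilon>\<^sub>0 \<mu>\<^sub>0 \<Omega> \<sigma> E0 E1 H1)) \<and>
     (\<forall>E H. maxwell_sol \<omega> \<epsilon>\<^sub>0 \<mu>\<^sub>0 \<Omega> (\<lambda>x. 0) E H \<longrightarrow>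
        zero_tan_trace \<Omega> E (\<lambda>x. (\<i> * \<omega> * \<mu>\<^sub>0) *s H x) \<longrightarrow>
        (AE x in lebesgue_on \<Omega>. E x = 0 \<and> H x = 0))"

definition Lambda'_bound :: "real \<Rightarrow> real \<Rightarrow> real \<Rightarrow> (real^3) set \<Rightarrow> (real^3 \<Rightarrow> real) \<Rightarrow> real \<Rightarrow> bool" where
  "Lambda'_bound \<omega> \<epsilon>\<^sub>0 \<mu>\<^sub>0 \<Omega> \<sigma> C \<longleftrightarrow>
     (\<forall>v cv E0 H0 E1 H1. weak_curl \<Omega> v cv \<longrightarrow> problem0 \<omega> \<epsilon>\<^sub>0 \<mu>\<^sub>0 \<Omega> v cv E0 H0 \<longrightarrow>
        problem1 \<omega> \<epsilon>\<^sub>0 \<mu>\<^sub>0 \<Omega> \<sigma> E0 E1 H1 \<longrightarrow>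
        TH_norm \<Omega> H1 (\<lambda>x. complex_of_real (\<sigma> x) *s E0 x - (\<i> * \<omega> * \<epsilon>\<^sub>0) *s E1 x)
          \<le> C * TH_norm \<Omega> v cv)"

definition is_Lambda'_norm :: "real \<Rightarrow> real \<Rightarrow> real \<Rightarrow> (real^3) set \<Rightarrow> (real^3 \<Rightarrow> real) \<Rightarrow> real \<Rightarrow> bool" where
  "is_Lambda'_norm \<omega> \<epsilon>\<^sub>0 \<mu>\<^sub>0 \<Omega> \<sigma> e \<longleftrightarrow>
     Lambda'_bound \<omega> \<epsilon>\<^sub>0 \<mu>\<^sub>0 \<Omega> \<sigma> e \<and>
     (\<forall>C. Lambda'_bound \<omega> \<epsilon>\<^sub>0 \<mu>\<^sub>0 \<Omega> \<sigma> C \<longrightarrow> e \<le> C)"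

definition Vol :: "(real^3) set \<Rightarrow> real" where
  "Vol \<Omega> = measure lebesgue \<Omega>"

definition Vol2 :: "(real^3) set \<Rightarrow> real" where
  "Vol2 \<Omega> = Sup {measure lebesgue ((\<lambda>x. vector [x \<bullet> u, x \<bullet> w] :: real^2) ` \<Omega>) | u w.
                   norm u = 1 \<and> norm w = 1 \<and> u \<bullet> w = 0}"

end

theory Submission
  imports Defs "HOL-Probability.Probability"
begin

text \<open>
  Testing the first-order problem against a Maxwell plane wave \<open>E\<^sup>*\<close> gives
  \<open>\<integral> \<sigma> E(;0) \<cdot> E\<^sup>* = \<langle>\<Lambda>'(E(;0) \<times> \<nu>), E\<^sup>*\<rangle>\<close>, so plane waves with frequencies \<open>\<zeta> + \<zeta>\<^sup>* = \<xi>\<close>,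
  \<open>\<zeta> \<cdot> \<zeta> = \<zeta>\<^sup>* \<cdot> \<zeta>\<^sup>* = k\<^sup>2\<close>, bound the Fourier transform of \<open>\<sigma>\<close> at \<open>\<xi>\<close> by \<open>\<epsilon>\<close>. For
  \<open>|\<xi>| \<le> 2 k\<close> the frequencies are real and the bound is \<open>\<epsilon> k (1 + k) Vol \<Omega>\<close>. For \<open>|\<xi>| > 2 k\<close>
  they have imaginary parts \<open>\<plusminus> t e\<close> with \<open>t\<^sup>2 = |\<xi>|\<^sup>2 / 4 - k\<^sup>2\<close>; slicing \<open>\<Omega>\<close> orthogonally to \<open>e\<close>
  bounds the exponential weights by \<open>Vol2 \<Omega> sinh (t D) / t\<close>, which costs a factor
  \<open>e\<^sup>\<E> = 1 / \<epsilon>\<close> in the square up to \<open>t = \<E> / (2 D)\<close>. Since \<open>\<sigma>\<close> vanishes on the boundary, its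
  extension by zero lies in \<open>H\<^sup>1\<close> of the whole space, and the remaining frequencies are controlled by
  \<open>M\<^sub>1\<close> through Plancherel's formula.
\<close>

section \<open>Gaussian-weighted Plancherel formula\<close>

text \<open>The transform of \<open>\<sigma>\<close> is bounded, but its square is not known to be
  integrable beforehand. Every frequency integral therefore carries the damping factor
  \<open>gauss (s *\<^sub>R \<xi>)\<close>, which makes it absolutely convergent and reduces
  Plancherel's formula to Fubini's theorem with a Gaussian kernel of width \<open>s\<close>. Two
  one-sided facts suffice, each uniform in \<open>s\<close>: the damped energy of a function is at
  most \<open>(2 * pi) ^ 3\<close> times its squared L2 norm, and a uniform bound on damped energies
  bounds the L2 norm. So the frequencies are split pointwise under the damping, before any limit.

  Traces are functionals on smooth fields, so Green's formula is built into
  \<open>tan_trace\<close>; plane waves only have to be smooth and to have the expected weak curl.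

  A ball of radius \<open>q\<close> contributes
  \<open>(4/3 * pi * q^3) / (2 * pi)^3 = q^3 / (6 * pi\<^sup>2)\<close>, the source of the constants
  \<open>4 / (3 * pi\<^sup>2)\<close> and \<open>1 / (4 * pi\<^sup>2)\<close>. Both frequency ranges
  lose the same polarisation factor \<open>k * (1 + k)\<close>, whose square is estimated by the
  fourth powers in the statement.\<close>

lemma borel_measurable_cis_comp [measurable]:
  assumes [measurable]: "f \<in> borel_measurable M"
  shows "(\<lambda>x. cis (f x)) \<in> borel_measurable M"
proof -
  have "cis \<in> borel_measurable borel"
    by (intro borel_measurable_continuous_onI continuous_intros)
  then show ?thesis by (rule measurable_compose[OF assms])
qed

text \<open>\<open>lborel\<close> is the image of the product of one-dimensional Lebesgue measures
  over \<open>Basis\<close>, so tensor products integrate factor by factor. This reduces the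
  Gaussian's transform to dimension one.\<close>

lemma
  fixes f :: "'a::euclidean_space \<Rightarrow> real \<Rightarrow> 'b::{real_normed_field,banach,second_countable_topology}"
  assumes f: "\<And>b. b \<in> Basis \<Longrightarrow> integrable lborel (f b)"
  shows lborel_integrable_prod: "integrable lborel (\<lambda>x::'a. \<Prod>b\<in>Basis. f b (x \<bullet> b))"
    and lborel_integral_prod:
      "(LINT x|lborel. (\<Prod>b\<in>Basis. f b (x \<bullet> b))) = (\<Prod>b\<in>Basis. integral\<^sup>L lborel (f b))"
proof -
  interpret product_sigma_finite "\<lambda>_::'a. lborel :: real measure" ..
  have [measurable]: "b \<in> Basis \<Longrightarrow> f b \<in> borel_measurable borel" for b
    using borel_measurable_integrable[OF f[of b]] by simp
  have eq: "(\<Prod>b\<in>Basis. f b ((\<Sum>b\<in>Basis. x b *\<^sub>R b) \<bullet> b)) = (\<Prod>b\<in>Basis. f b (x b))" for x :: "'a \<Rightarrow> real"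
    by (intro prod.cong) (auto simp: inner_sum_left inner_Basis if_distrib cong: if_cong)
  show "integrable lborel (\<lambda>x::'a. \<Prod>b\<in>Basis. f b (x \<bullet> b))"
    using product_integrable_prod[of Basis f, OF finite_Basis f]
    by (subst lborel_eq, subst integrable_distr_eq) (auto simp: eq)
  show "(LINT x|lborel. (\<Prod>b\<in>Basis. f b (x \<bullet> b))) = (\<Prod>b\<in>Basis. integral\<^sup>L lborel (f b))"
    using product_integral_prod[of Basis f, OF finite_Basis f]
    by (subst lborel_eq, subst integral_distr) (auto simp: eq)
qed

lemma
  fixes f :: "'a::euclidean_space \<Rightarrow> 'b::{banach,second_countable_topology}"
  assumes c: "c \<noteq> 0" and f: "integrable lborel f"
  shows lborel_integrable_affine: "integrable lborel (\<lambda>x. f (t + c *\<^sub>R x))"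
    and lborel_integral_affine:
      "integral\<^sup>L lborel f = \<bar>c\<bar> ^ DIM('a) *\<^sub>R (LINT x|lborel. f (t + c *\<^sub>R x))"
proof -
  have [measurable]: "f \<in> borel_measurable borel"
    using borel_measurable_integrable[OF f] by simp
  have "integrable (density (distr lborel borel (\<lambda>x. t + c *\<^sub>R x)) (\<lambda>_. ennreal (\<bar>c\<bar> ^ DIM('a)))) f"
    using f lborel_affine[OF c, of t] by simp
  then have "integrable lborel (\<lambda>x. \<bar>c\<bar> ^ DIM('a) *\<^sub>R f (t + c *\<^sub>R x))"
    by (subst (asm) integrable_density; simp add: integrable_distr_eq)
  then show i: "integrable lborel (\<lambda>x. f (t + c *\<^sub>R x))"
    using c integrable_scaleR_right[of "inverse (\<bar>c\<bar> ^ DIM('a))" lborel "\<lambda>x. \<bar>c\<bar> ^ DIM('a) *\<^sub>R f (t + c *\<^sub>R x)"] by simp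
  have "integral\<^sup>L lborel f = integral\<^sup>L (density (distr lborel borel (\<lambda>x. t + c *\<^sub>R x)) (\<lambda>_. ennreal (\<bar>c\<bar> ^ DIM('a)))) f"
    using lborel_affine[OF c, of t] by simp
  also have "\<dots> = \<bar>c\<bar> ^ DIM('a) *\<^sub>R (LINT x|lborel. f (t + c *\<^sub>R x))"
    by (subst integral_density; simp add: integral_distr)
  finally show "integral\<^sup>L lborel f = \<bar>c\<bar> ^ DIM('a) *\<^sub>R (LINT x|lborel. f (t + c *\<^sub>R x))" .
qed

section \<open>The Gaussian and its Fourier transform\<close>

definition gauss :: "'a::euclidean_space \<Rightarrow> real" where
  "gauss x = exp (- (norm x)\<^sup>2 / 2)"

lemma borel_measurable_gauss [measurable]: "gauss \<in> borel_measurable borel"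
  unfolding gauss_def[abs_def] by simp

lemma gauss_le_1: "gauss x \<le> 1" and gauss_nonneg [simp]: "0 \<le> gauss x"
  and gauss_minus: "gauss (- x) = gauss x"
  by (simp_all add: gauss_def)

lemma gauss_prod: "gauss x = (\<Prod>b\<in>Basis. exp (- (x \<bullet> b)\<^sup>2 / 2))"
proof -
  have "(norm x)\<^sup>2 = (\<Sum>b\<in>Basis. (x \<bullet> b)\<^sup>2)"
    unfolding power2_norm_eq_inner by (subst euclidean_inner) (simp add: power2_eq_square)
  then show ?thesis
    by (simp add: gauss_def exp_sum[symmetric] sum_divide_distrib sum_negf)
qed

lemma cis_inner_prod: "cis (z \<bullet> x) = (\<Prod>b\<in>Basis. cis ((z \<bullet> b) * (x \<bullet> b)))"
  by (subst euclidean_inner) (simp add: cis_conv_exp sum_distrib_left exp_sum)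

text \<open>Up to the factor \<open>sqrt (2 * pi)\<close> this is the characteristic function of the
  standard normal distribution.\<close>

lemma gauss_fourier_1:
  "integrable lborel (\<lambda>x::real. complex_of_real (exp (- x\<^sup>2 / 2)) * cis (t * x))"
  "(LINT x|lborel. complex_of_real (exp (- x\<^sup>2 / 2)) * cis (t * x)) = sqrt (2 * pi) * exp (- t\<^sup>2 / 2)"
proof -
  have e: "exp (- x\<^sup>2 / 2) = sqrt (2 * pi) * std_normal_density x" for x
    by (simp add: std_normal_density_def)
  have "integrable lborel (\<lambda>x::real. exp (- x\<^sup>2 / 2))"
    unfolding e by (intro integrable_mult_right integrable_normal_density) simp
  then show "integrable lborel (\<lambda>x::real. complex_of_real (exp (- x\<^sup>2 / 2)) * cis (t * x))"
    by (rule Bochner_Integration.integrable_bound) (auto simp: norm_mult)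
  have "char std_normal_distribution t = (LINT x|lborel. std_normal_density x *\<^sub>R cis (t * x))"
    unfolding char_def by (subst integral_density) (auto simp: cis_conv_exp)
  then have "(LINT x|lborel. std_normal_density x *\<^sub>R cis (t * x)) = exp (- t\<^sup>2 / 2)"
    by (simp add: char_std_normal_distribution)
  moreover have "(LINT x|lborel. complex_of_real (exp (- x\<^sup>2 / 2)) * cis (t * x))
     = (LINT x|lborel. sqrt (2 * pi) *\<^sub>R (std_normal_density x *\<^sub>R cis (t * x)))"
    unfolding e by (simp add: scaleR_conv_of_real mult.assoc)
  ultimately show "(LINT x|lborel. complex_of_real (exp (- x\<^sup>2 / 2)) * cis (t * x)) = sqrt (2 * pi) * exp (- t\<^sup>2 / 2)"
    by (simp add: scaleR_conv_of_real)
qed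

lemma gauss_fourier:
  fixes z :: "'a::euclidean_space"
  shows "integrable lborel (\<lambda>x::'a. complex_of_real (gauss x) * cis (z \<bullet> x))"
    and "(LINT x|lborel. complex_of_real (gauss x) * cis (z \<bullet> x)) = sqrt (2 * pi) ^ DIM('a) * gauss z"
proof -
  define f where "f b x = complex_of_real (exp (- x\<^sup>2 / 2)) * cis ((z \<bullet> b) * x)" for b :: 'a and x :: real
  have e: "complex_of_real (gauss x) * cis (z \<bullet> x) = (\<Prod>b\<in>Basis. f b (x \<bullet> b))" for x
    by (simp add: f_def gauss_prod cis_inner_prod prod.distrib)
  have i: "integrable lborel (f b)" for b
    unfolding f_def by (rule gauss_fourier_1)
  have v: "integral\<^sup>L lborel (f b) = sqrt (2 * pi) * exp (- (z \<bullet> b)\<^sup>2 / 2)" for b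
    unfolding f_def by (rule gauss_fourier_1)
  show "integrable lborel (\<lambda>x::'a. complex_of_real (gauss x) * cis (z \<bullet> x))"
    unfolding e by (rule lborel_integrable_prod[OF i])
  show "(LINT x|lborel. complex_of_real (gauss x) * cis (z \<bullet> x)) = sqrt (2 * pi) ^ DIM('a) * gauss z"
    unfolding e lborel_integral_prod[OF i] v
    by (simp add: gauss_prod prod.distrib)
qed

lemma integrable_gauss: "integrable lborel (gauss :: 'a::euclidean_space \<Rightarrow> real)"
  and integral_gauss: "integral\<^sup>L lborel (gauss :: 'a::euclidean_space \<Rightarrow> real) = sqrt (2 * pi) ^ DIM('a)"
proof -
  have "integrable lborel (\<lambda>x::'a. complex_of_real (gauss x))"
    using gauss_fourier(1)[of "0::'a"] by simp
  then show "integrable lborel (gauss :: 'a \<Rightarrow> real)"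
    using integrable_Re by fastforce
  have "complex_of_real (integral\<^sup>L lborel (gauss :: 'a \<Rightarrow> real)) = complex_of_real (sqrt (2 * pi) ^ DIM('a))"
    using gauss_fourier(2)[of "0::'a"] gauss_def[of "0::'a"] by simp
  then show "integral\<^sup>L lborel (gauss :: 'a \<Rightarrow> real) = sqrt (2 * pi) ^ DIM('a)"
    using of_real_eq_iff by blast
qed

text \<open>Damping of width \<open>1 / s\<close> in frequency becomes a kernel of width
  \<open>s\<close> in space. Its prefactor \<open>(sqrt (2 * pi) / s) ^ DIM('a)\<close> times the
  mass in \<open>gauss_conv\<close> is \<open>(2 * pi) ^ DIM('a)\<close>, Plancherel's constant for
  \<open>fourier\<close>.\<close>

lemma gauss_fourier_scaled:
  fixes z :: "'a::euclidean_space"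
  assumes s: "s > 0"
  shows "(LINT x|lborel. complex_of_real (gauss (s *\<^sub>R x)) * cis (x \<bullet> z))
      = (sqrt (2 * pi) / s) ^ DIM('a) * gauss (z /\<^sub>R s)"
proof -
  have "(LINT x|lborel. complex_of_real (gauss x) * cis ((z /\<^sub>R s) \<bullet> x))
     = \<bar>s\<bar> ^ DIM('a) *\<^sub>R (LINT x|lborel. complex_of_real (gauss (0 + s *\<^sub>R x)) * cis ((z /\<^sub>R s) \<bullet> (0 + s *\<^sub>R x)))"
    using s by (intro lborel_integral_affine gauss_fourier(1)) auto
  also have "(\<lambda>x. complex_of_real (gauss (0 + s *\<^sub>R x)) * cis ((z /\<^sub>R s) \<bullet> (0 + s *\<^sub>R x)))
     = (\<lambda>x. complex_of_real (gauss (s *\<^sub>R x)) * cis (x \<bullet> z))"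
    using s by (auto simp: inner_commute mult.assoc[symmetric])
  finally show ?thesis
    unfolding gauss_fourier(2) using s by (simp add: scaleR_conv_of_real field_simps power_divide)
qed

lemma integrable_gauss_scaled:
  assumes s: "s \<noteq> 0"
  shows "integrable lborel (\<lambda>x::'a::euclidean_space. gauss (s *\<^sub>R x))"
  using lborel_integrable_affine[OF s integrable_gauss, of 0] by simp

lemma gauss_conv:
  fixes x :: "'a::euclidean_space"
  assumes s: "s > 0"
  shows "integrable lborel (\<lambda>y. gauss ((x - y) /\<^sub>R s))"
    and "(LINT y|lborel. gauss ((x - y) /\<^sub>R s)) = (sqrt (2 * pi) * s) ^ DIM('a)"
proof -
  have e: "(x - y) /\<^sub>R s = x /\<^sub>R s + (- 1 / s) *\<^sub>R y" for y
    by (simp add: algebra_simps divide_inverse)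
  have s': "- 1 / s \<noteq> 0" using s by simp
  show "integrable lborel (\<lambda>y. gauss ((x - y) /\<^sub>R s))"
    unfolding e by (intro lborel_integrable_affine integrable_gauss s')
  have "sqrt (2 * pi) ^ DIM('a) = \<bar>- 1 / s\<bar> ^ DIM('a) * (LINT y|lborel. gauss ((x - y) /\<^sub>R s))"
    using lborel_integral_affine[OF s' integrable_gauss, of "x /\<^sub>R s"] unfolding e integral_gauss by simp
  then show "(LINT y|lborel. gauss ((x - y) /\<^sub>R s)) = (sqrt (2 * pi) * s) ^ DIM('a)"
    using s by (simp add: field_simps power_divide abs_mult)
qed

text \<open>Positive sign and no normalising factor: this is the integral of \<open>f\<close>
  against a plane wave of real frequency \<open>\<xi>\<close>, the quantity that the boundary data
  control.\<close>

definition fourier :: "('a::euclidean_space \<Rightarrow> real) \<Rightarrow> 'a \<Rightarrow> complex" where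
  "fourier f \<xi> = (LINT x|lborel. complex_of_real (f x) * cis (\<xi> \<bullet> x))"

lemma integrable_fourier:
  assumes f: "integrable lborel f"
  shows "integrable lborel (\<lambda>x. complex_of_real (f x) * cis (\<xi> \<bullet> x))"
proof -
  have [measurable]: "f \<in> borel_measurable borel" using borel_measurable_integrable[OF f] by simp
  show ?thesis
    by (rule Bochner_Integration.integrable_bound[OF f]) (auto simp: norm_mult)
qed

lemma borel_measurable_fourier [measurable]:
  assumes f: "integrable lborel f"
  shows "fourier f \<in> borel_measurable borel"
proof -
  have [measurable]: "f \<in> borel_measurable borel" using borel_measurable_integrable[OF f] by simp
  have "(\<lambda>\<xi>. LINT x|lborel. complex_of_real (f x) * cis (\<xi> \<bullet> x)) \<in> borel_measurable lborel"
    by (rule sigma_finite_measure.borel_measurable_lebesgue_integral[OF sigma_finite_lborel]) simp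
  then show ?thesis by (simp add: fourier_def[abs_def])
qed

lemma norm_fourier_le: "integrable lborel f \<Longrightarrow> norm (fourier f \<xi>) \<le> (LINT x|lborel. \<bar>f x\<bar>)"
  unfolding fourier_def
  by (rule order_trans[OF integral_norm_bound]) (simp add: norm_mult)

lemma lborel_integrable_product:
  fixes u v :: "'a::euclidean_space \<Rightarrow> real" and F :: "'a \<times> 'a \<Rightarrow> 'b::{banach,second_countable_topology}"
  assumes u: "integrable lborel u" and v: "integrable lborel v"
    and [measurable]: "F \<in> borel_measurable (lborel \<Otimes>\<^sub>M lborel)"
    and le: "\<And>x y. norm (F (x, y)) \<le> \<bar>u x\<bar> * \<bar>v y\<bar>"
  shows "integrable (lborel \<Otimes>\<^sub>M lborel) F"
proof -
  have [measurable]: "u \<in> borel_measurable borel" "v \<in> borel_measurable borel"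
    using borel_measurable_integrable[OF u] borel_measurable_integrable[OF v] by auto
  have "integrable (lborel \<Otimes>\<^sub>M lborel) (\<lambda>(x,y). \<bar>u x\<bar> * \<bar>v y\<bar>)"
    by (rule lborel_pair.Fubini_integrable) (auto intro!: integrable_abs u v simp: split_beta')
  then show ?thesis
    by (rule Bochner_Integration.integrable_bound) (use le in auto)
qed

text \<open>Fubini's theorem, with the Gaussian supplying integrability in \<open>\<xi>\<close> and
  \<open>f\<close> in \<open>x\<close>. The bounded multiplier \<open>h\<close> is a phase in one
  use and the conjugate of another transform in the other.\<close>

lemma gauss_fourier_swap:
  fixes f :: "'a::euclidean_space \<Rightarrow> real"
  assumes f: "integrable lborel f" and s: "s > 0"
    and [measurable]: "h \<in> borel_measurable borel" and h: "\<And>\<xi>. norm (h \<xi>) \<le> C"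
  shows "(LINT \<xi>|lborel. complex_of_real (gauss (s *\<^sub>R \<xi>)) * h \<xi> * fourier f \<xi>)
       = (LINT x|lborel. complex_of_real (f x) * (LINT \<xi>|lborel. complex_of_real (gauss (s *\<^sub>R \<xi>)) * h \<xi> * cis (\<xi> \<bullet> x)))"
proof -
  have [measurable]: "f \<in> borel_measurable borel" using borel_measurable_integrable[OF f] by simp
  let ?F = "\<lambda>\<xi> x. complex_of_real (gauss (s *\<^sub>R \<xi>)) * h \<xi> * (complex_of_real (f x) * cis (\<xi> \<bullet> x))"
  have C: "0 \<le> C" using h norm_ge_zero order_trans by blast
  have int: "integrable (lborel \<Otimes>\<^sub>M lborel) (\<lambda>(\<xi>,x). ?F \<xi> x)"
  proof (rule lborel_integrable_product)
    show "integrable lborel (\<lambda>\<xi>::'a. C * gauss (s *\<^sub>R \<xi>))"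
      using s by (intro integrable_mult_right integrable_gauss_scaled) auto
    show "norm ((\<lambda>(\<xi>,x). ?F \<xi> x) (\<xi>, x)) \<le> \<bar>C * gauss (s *\<^sub>R \<xi>)\<bar> * \<bar>f x\<bar>" for \<xi> x
      using mult_right_mono[OF mult_right_mono[OF h[of \<xi>]], of "gauss (s *\<^sub>R \<xi>)" "\<bar>f x\<bar>"] C
      by (simp add: norm_mult abs_mult mult_ac)
  qed (use f in auto)
  have "(LINT \<xi>|lborel. complex_of_real (gauss (s *\<^sub>R \<xi>)) * h \<xi> * fourier f \<xi>) = (LINT \<xi>|lborel. LINT x|lborel. ?F \<xi> x)"
    unfolding fourier_def using integrable_fourier[OF f] by simp
  also have "\<dots> = (LINT x|lborel. LINT \<xi>|lborel. ?F \<xi> x)"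
    by (rule lborel_pair.Fubini_integral[OF int, symmetric])
  also have "\<dots> = (LINT x|lborel. LINT \<xi>|lborel. complex_of_real (f x) * (complex_of_real (gauss (s *\<^sub>R \<xi>)) * h \<xi> * cis (\<xi> \<bullet> x)))"
    by (simp add: mult_ac)
  finally show ?thesis by simp
qed

text \<open>Two exchanges of integrals: one computes the damped inverse transform of
  \<open>g\<close> as an average with a Gaussian kernel, the other moves \<open>f\<close> outside.
  The polarised form is kept because the cross term in the energy of \<open>f - g\<close> is needed
  later.\<close>

lemma gauss_plancherel:
  fixes f g :: "'a::euclidean_space \<Rightarrow> real"
  assumes f: "integrable lborel f" and g: "integrable lborel g" and s: "s > 0"
  shows "(LINT \<xi>|lborel. complex_of_real (gauss (s *\<^sub>R \<xi>)) * cnj (fourier g \<xi>) * fourier f \<xi>)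
    = complex_of_real ((sqrt (2 * pi) / s) ^ DIM('a) * (LINT x|lborel. f x * (LINT y|lborel. g y * gauss ((x - y) /\<^sub>R s))))"
proof -
  have [measurable]: "f \<in> borel_measurable borel" "g \<in> borel_measurable borel"
    using borel_measurable_integrable[OF f] borel_measurable_integrable[OF g] by auto
  note [measurable] = borel_measurable_fourier[OF f] borel_measurable_fourier[OF g]
  let ?c = "(sqrt (2 * pi) / s) ^ DIM('a)"
  have inner: "(LINT \<xi>|lborel. complex_of_real (gauss (s *\<^sub>R \<xi>)) * cnj (fourier g \<xi>) * cis (\<xi> \<bullet> x))
      = complex_of_real (?c * (LINT y|lborel. g y * gauss ((x - y) /\<^sub>R s)))" for x
  proof -
    have "(LINT \<xi>|lborel. complex_of_real (gauss (s *\<^sub>R \<xi>)) * cnj (fourier g \<xi>) * cis (\<xi> \<bullet> x))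
      = cnj (LINT \<xi>|lborel. complex_of_real (gauss (s *\<^sub>R \<xi>)) * cis (- (\<xi> \<bullet> x)) * fourier g \<xi>)"
      unfolding Bochner_Integration.integral_cnj[symmetric] by (simp add: cis_cnj mult_ac del: Bochner_Integration.integral_cnj)
    also have "\<dots> = cnj (LINT y|lborel. complex_of_real (g y) *
        (LINT \<xi>|lborel. complex_of_real (gauss (s *\<^sub>R \<xi>)) * cis (- (\<xi> \<bullet> x)) * cis (\<xi> \<bullet> y)))"
      by (subst gauss_fourier_swap[OF g s, where C=1]) auto
    also have "\<dots> = cnj (LINT y|lborel. complex_of_real (?c * (g y * gauss ((x - y) /\<^sub>R s))))"
    proof -
      have "(LINT \<xi>|lborel. complex_of_real (gauss (s *\<^sub>R \<xi>)) * cis (- (\<xi> \<bullet> x)) * cis (\<xi> \<bullet> y))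
        = complex_of_real (?c * gauss ((x - y) /\<^sub>R s))" for y
      proof -
        have "(x - y) /\<^sub>R s = - ((y - x) /\<^sub>R s)" by (simp add: algebra_simps)
        then show ?thesis
          using gauss_fourier_scaled[OF s, of "y - x"]
          by (simp only: gauss_minus) (simp add: mult.assoc cis_mult inner_diff_right)
      qed
      then show ?thesis by (simp add: mult_ac)
    qed
    finally show ?thesis by (simp flip: of_real_mult)
  qed
  have "(LINT \<xi>|lborel. complex_of_real (gauss (s *\<^sub>R \<xi>)) * cnj (fourier g \<xi>) * fourier f \<xi>)
     = (LINT x|lborel. complex_of_real (?c * (f x * (LINT y|lborel. g y * gauss ((x - y) /\<^sub>R s)))))"
  proof (subst gauss_fourier_swap[OF f s, where C="LINT x|lborel. \<bar>g x\<bar>"])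
    have "cnj \<in> borel_measurable borel"
      by (intro borel_measurable_continuous_onI continuous_intros)
    then show "(\<lambda>\<xi>. cnj (fourier g \<xi>)) \<in> borel_measurable borel" by measurable
  qed (simp_all add: inner norm_fourier_le[OF g] mult.left_commute[of "complex_of_real (f _)"])
  then show ?thesis by (simp flip: of_real_mult)
qed

lemma integrable_gauss_mult:
  fixes h :: "'a::euclidean_space \<Rightarrow> 'b::{real_normed_algebra_1,banach,second_countable_topology}"
  assumes s: "s > 0" and [measurable]: "h \<in> borel_measurable borel" and h: "\<And>\<xi>. norm (h \<xi>) \<le> C"
  shows "integrable lborel (\<lambda>\<xi>. of_real (gauss (s *\<^sub>R \<xi>)) * h \<xi>)"
proof -
  have [measurable]: "(\<lambda>\<xi>::'a. of_real (gauss (s *\<^sub>R \<xi>)) :: 'b) \<in> borel_measurable borel"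
    unfolding of_real_def by measurable
  have "integrable lborel (\<lambda>\<xi>::'a. C * gauss (s *\<^sub>R \<xi>))"
    using s by (intro integrable_mult_right integrable_gauss_scaled) auto
  then show ?thesis
  proof (rule Bochner_Integration.integrable_bound)
    have "norm (of_real (gauss (s *\<^sub>R \<xi>)) * h \<xi>) \<le> norm (C * gauss (s *\<^sub>R \<xi>))" for \<xi>
    proof -
      have "norm (of_real (gauss (s *\<^sub>R \<xi>)) * h \<xi>) = gauss (s *\<^sub>R \<xi>) * norm (h \<xi>)"
        by (simp flip: scaleR_conv_of_real)
      also have "\<dots> \<le> gauss (s *\<^sub>R \<xi>) * C" by (intro mult_left_mono h) simp
      finally show ?thesis using abs_ge_self[of "C * gauss (s *\<^sub>R \<xi>)"] by (simp add: mult.commute)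
    qed
    then show "AE \<xi> in lborel. norm (of_real (gauss (s *\<^sub>R \<xi>)) * h \<xi>) \<le> norm (C * gauss (s *\<^sub>R \<xi>))"
      by simp
  qed simp
qed

lemma integrable_gauss_fourier_sq:
  assumes f: "integrable lborel f" and s: "s > 0"
  shows "integrable lborel (\<lambda>\<xi>. gauss (s *\<^sub>R \<xi>) * (norm (fourier f \<xi>))\<^sup>2)"
proof -
  note [measurable] = borel_measurable_fourier[OF f]
  show ?thesis
    using integrable_gauss_mult[OF s, of "\<lambda>\<xi>. (norm (fourier f \<xi>))\<^sup>2" "(LINT x|lborel. \<bar>f x\<bar>)\<^sup>2"]
    by (simp add: power_mono norm_fourier_le[OF f])
qed

lemma gauss_plancherel_norm:
  fixes g :: "'a::euclidean_space \<Rightarrow> real"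
  assumes g: "integrable lborel g" and s: "s > 0"
  shows "(LINT \<xi>|lborel. gauss (s *\<^sub>R \<xi>) * (norm (fourier g \<xi>))\<^sup>2)
    = (sqrt (2 * pi) / s) ^ DIM('a) * (LINT x|lborel. g x * (LINT y|lborel. g y * gauss ((x - y) /\<^sub>R s)))"
proof -
  have "complex_of_real (LINT \<xi>|lborel. gauss (s *\<^sub>R \<xi>) * (norm (fourier g \<xi>))\<^sup>2)
     = (LINT \<xi>|lborel. complex_of_real (gauss (s *\<^sub>R \<xi>)) * cnj (fourier g \<xi>) * fourier g \<xi>)"
    unfolding integral_complex_of_real[symmetric]
    by (intro Bochner_Integration.integral_cong)
       (simp_all add: complex_norm_square mult_ac del: integral_complex_of_real of_real_power)
  also note gauss_plancherel[OF g g s]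
  finally show ?thesis using of_real_eq_iff by blast
qed

text \<open>A Schur test: the kernel is symmetric with mass independent of \<open>x\<close>, so
  bounding \<open>g x * g y\<close> by the mean of the squares gives an estimate that does not
  depend on \<open>s\<close>.\<close>

lemma gauss_bessel:
  fixes g :: "'a::euclidean_space \<Rightarrow> real"
  assumes g: "integrable lborel g" and g2: "integrable lborel (\<lambda>x. (g x)\<^sup>2)" and s: "s > 0"
  shows "(LINT \<xi>|lborel. gauss (s *\<^sub>R \<xi>) * (norm (fourier g \<xi>))\<^sup>2)
    \<le> (2 * pi) ^ DIM('a) * (LINT x|lborel. (g x)\<^sup>2)"
proof -
  have [measurable]: "g \<in> borel_measurable borel" using borel_measurable_integrable[OF g] by simp
  let ?K = "\<lambda>x y::'a. gauss ((x - y) /\<^sub>R s)"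
  let ?k = "(sqrt (2 * pi) * s) ^ DIM('a)"
  have Ksym: "?K y x = ?K x y" for x y
    by (metis gauss_minus minus_diff_eq scaleR_minus_right)
  have k0: "0 \<le> ?k" using s by simp
  have int1: "integrable (lborel \<Otimes>\<^sub>M lborel) (\<lambda>(x,y). (g x)\<^sup>2 * ?K x y)"
    by (rule lborel_pair.Fubini_integrable)
       (auto simp: abs_mult gauss_conv[OF s] g2)
  have val1: "(\<integral>(x,y). (g x)\<^sup>2 * ?K x y \<partial>(lborel \<Otimes>\<^sub>M lborel)) = ?k * (LINT x|lborel. (g x)\<^sup>2)"
    by (subst lborel_pair.integral_fst'[OF int1, symmetric]) (simp add: gauss_conv[OF s])
  have int2: "integrable (lborel \<Otimes>\<^sub>M lborel) (\<lambda>(x,y). (g y)\<^sup>2 * ?K x y)"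
    using lborel_pair.integrable_product_swap[OF int1] by (simp add: Ksym)
  have val2: "(\<integral>(x,y). (g y)\<^sup>2 * ?K x y \<partial>(lborel \<Otimes>\<^sub>M lborel)) = ?k * (LINT x|lborel. (g x)\<^sup>2)"
    using lborel_pair.integral_product_swap[of "\<lambda>(x,y). (g x)\<^sup>2 * ?K x y"] by (simp add: Ksym val1)
  have bd: "\<bar>g x * g y * ?K x y\<bar> \<le> ((g x)\<^sup>2 * ?K x y + (g y)\<^sup>2 * ?K x y) / 2" for x y
  proof -
    have "0 \<le> (\<bar>g x\<bar> - \<bar>g y\<bar>)\<^sup>2" by simp
    then have "\<bar>g x\<bar> * \<bar>g y\<bar> \<le> ((g x)\<^sup>2 + (g y)\<^sup>2) / 2" by (simp add: power2_diff)
    from mult_right_mono[OF this, of "?K x y"] show ?thesis by (simp add: abs_mult algebra_simps)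
  qed
  have int12: "integrable (lborel \<Otimes>\<^sub>M lborel) (\<lambda>(x,y). ((g x)\<^sup>2 * ?K x y + (g y)\<^sup>2 * ?K x y) / 2)"
    using int1 int2 by (simp add: split_beta')
  have int: "integrable (lborel \<Otimes>\<^sub>M lborel) (\<lambda>(x,y). g x * g y * ?K x y)"
  proof (rule Bochner_Integration.integrable_bound[OF int12])
    show "AE z in lborel \<Otimes>\<^sub>M lborel. norm (case z of (x,y) \<Rightarrow> g x * g y * ?K x y)
       \<le> norm (case z of (x,y) \<Rightarrow> ((g x)\<^sup>2 * ?K x y + (g y)\<^sup>2 * ?K x y) / 2)"
      using order_trans[OF bd abs_ge_self] by (intro AE_I2) (simp only: split_beta' real_norm_def)
  qed simp
  have "(LINT x|lborel. g x * (LINT y|lborel. g y * ?K x y)) = (LINT x|lborel. LINT y|lborel. g x * g y * ?K x y)"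
    by (simp add: mult.assoc)
  also have "\<dots> = (\<integral>(x,y). g x * g y * ?K x y \<partial>(lborel \<Otimes>\<^sub>M lborel))"
    using lborel_pair.integral_fst'[OF int] by simp
  also have "\<dots> \<le> (\<integral>(x,y). ((g x)\<^sup>2 * ?K x y + (g y)\<^sup>2 * ?K x y) / 2 \<partial>(lborel \<Otimes>\<^sub>M lborel))"
    by (rule Bochner_Integration.integral_mono[OF int int12]) (use order_trans[OF abs_ge_self bd] in \<open>simp only: split_beta'\<close>)
  also have "\<dots> = ?k * (LINT x|lborel. (g x)\<^sup>2)"
    using val1 val2 int1 int2 by (simp add: split_beta')
  finally have "(LINT \<xi>|lborel. gauss (s *\<^sub>R \<xi>) * (norm (fourier g \<xi>))\<^sup>2)
     \<le> (sqrt (2 * pi) / s) ^ DIM('a) * (?k * (LINT x|lborel. (g x)\<^sup>2))"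
    unfolding gauss_plancherel_norm[OF g s] using s by (intro mult_left_mono) auto
  also have "\<dots> = (2 * pi) ^ DIM('a) * (LINT x|lborel. (g x)\<^sup>2)"
    using s unfolding mult.assoc[symmetric] power_mult_distrib[symmetric] by simp
  finally show ?thesis .
qed

text \<open>Averages over shrinking Gaussian kernels converge to \<open>g\<close> at every point
  because \<open>g\<close> is continuous and bounded; integrability of \<open>f\<close> then
  supplies the majorant for the outer integral.\<close>

lemma gauss_average_tendsto:
  fixes f g :: "'a::euclidean_space \<Rightarrow> real"
  assumes f: "integrable lborel f" and g: "integrable lborel g"
    and cont: "continuous_on UNIV g" and B: "\<And>x. \<bar>g x\<bar> \<le> B"
  shows "(\<lambda>n. (sqrt (2 * pi) / (1 / Suc n)) ^ DIM('a) *
            (LINT x|lborel. f x * (LINT y|lborel. g y * gauss ((x - y) /\<^sub>R (1 / Suc n)))))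
         \<longlonglongrightarrow> (2 * pi) ^ DIM('a) * (LINT x|lborel. f x * g x)"
proof -
  have [measurable]: "f \<in> borel_measurable borel" "g \<in> borel_measurable borel"
    using borel_measurable_integrable[OF f] borel_measurable_integrable[OF g] by auto
  let ?r = "sqrt (2 * pi) ^ DIM('a)"
  define A where "A n x = (LINT z|lborel. g (x - (1 / Suc n) *\<^sub>R z) * gauss z)" for n and x :: 'a
  have [measurable]: "A n \<in> borel_measurable borel" for n
  proof -
    have "(\<lambda>x. LINT z|lborel. g (x - (1 / Suc n) *\<^sub>R z) * gauss z) \<in> borel_measurable lborel"
      by (rule sigma_finite_measure.borel_measurable_lebesgue_integral[OF sigma_finite_lborel]) simp
    then show ?thesis by (simp add: A_def[abs_def])
  qed
  have B0: "0 \<le> B" using B[of 0] by linarith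
  have bdd: "\<bar>g u * gauss z\<bar> \<le> B * gauss z" for u z :: 'a
    using B by (simp add: abs_mult mult_right_mono)
  have iB: "integrable lborel (\<lambda>z::'a. B * gauss z)"
    by (intro integrable_mult_right integrable_gauss)
  have iA: "integrable lborel (\<lambda>z. g (x - (1 / Suc n) *\<^sub>R z) * gauss z)" for n x
    by (rule Bochner_Integration.integrable_bound[OF iB]) (use bdd B0 in \<open>auto simp: abs_mult\<close>)
  have A_bd: "\<bar>A n x\<bar> \<le> B * ?r" for n x
  proof -
    have "\<bar>A n x\<bar> \<le> (LINT z|lborel. \<bar>g (x - (1 / Suc n) *\<^sub>R z) * gauss z\<bar>)"
      unfolding A_def using integral_norm_bound[of lborel "\<lambda>z. g (x - (1 / Suc n) *\<^sub>R z) * gauss z"] by simp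
    also have "\<dots> \<le> (LINT z|lborel. B * gauss (z::'a))"
      by (intro Bochner_Integration.integral_mono integrable_abs iA iB bdd)
    also have "\<dots> = B * ?r" by (simp add: integral_gauss)
    finally show ?thesis .
  qed
  have A_lim: "(\<lambda>n. A n x) \<longlonglongrightarrow> g x * ?r" for x
  proof -
    have "(\<lambda>n. A n x) \<longlonglongrightarrow> (LINT z|lborel. g x * gauss (z::'a))"
      unfolding A_def
    proof (rule integral_dominated_convergence[OF _ _ iB])
      have "(\<lambda>n. g (x - (1 / Suc n) *\<^sub>R z) * gauss z) \<longlonglongrightarrow> g x * gauss z" for z
      proof -
        have "(\<lambda>n. x - (1 / Suc n) *\<^sub>R z) \<longlonglongrightarrow> x - 0 *\<^sub>R z"
          by (intro tendsto_intros) (rule LIMSEQ_Suc[OF lim_1_over_n])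
        then have "(\<lambda>n. g (x - (1 / Suc n) *\<^sub>R z)) \<longlonglongrightarrow> g x"
          using continuous_on_tendsto_compose[OF cont, of "\<lambda>n. x - (1 / Suc n) *\<^sub>R z" x] by simp
        then show ?thesis by (intro tendsto_intros)
      qed
      then show "AE z in lborel. (\<lambda>n. g (x - (1 / Suc n) *\<^sub>R z) * gauss z) \<longlonglongrightarrow> g x * gauss z" by simp
    qed (use bdd in auto)
    then show ?thesis by (simp add: integral_gauss)
  qed
  have "(\<lambda>n. (LINT x|lborel. f x * A n x)) \<longlonglongrightarrow> (LINT x|lborel. f x * (g x * ?r))"
  proof (rule integral_dominated_convergence)
    show "integrable lborel (\<lambda>x. \<bar>f x\<bar> * (B * ?r))" using f by simp
    show "AE x in lborel. (\<lambda>n. f x * A n x) \<longlonglongrightarrow> f x * (g x * ?r)"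
      using A_lim by (intro AE_I2 tendsto_mult_left)
    show "AE x in lborel. norm (f x * A n x) \<le> \<bar>f x\<bar> * (B * ?r)" for n
      using A_bd by (intro AE_I2) (simp add: abs_mult mult_left_mono)
  qed simp_all
  then have "(\<lambda>n. ?r * (LINT x|lborel. f x * A n x)) \<longlonglongrightarrow> ?r * (LINT x|lborel. f x * (g x * ?r))"
    by (rule tendsto_mult_left)
  moreover have "?r * (LINT x|lborel. f x * (g x * ?r)) = (2 * pi) ^ DIM('a) * (LINT x|lborel. f x * g x)"
  proof -
    have "?r * ?r = (2 * pi) ^ DIM('a)" unfolding power_mult_distrib[symmetric] by simp
    moreover have "(LINT x|lborel. f x * (g x * ?r)) = ?r * (LINT x|lborel. f x * g x)"
      unfolding mult.assoc[symmetric] by simp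
    ultimately show ?thesis by (simp only: mult.assoc[symmetric])
  qed
  \<comment> \<open>Substituting \<open>y = x - s *\<^sub>R z\<close> produces the factor
    \<open>s ^ DIM('a)\<close> that cancels the one in the prefactor.\<close>
  moreover have "(sqrt (2 * pi) / (1 / Suc n)) ^ DIM('a) *
            (LINT x|lborel. f x * (LINT y|lborel. g y * gauss ((x - y) /\<^sub>R (1 / Suc n))))
      = ?r * (LINT x|lborel. f x * A n x)" for n
  proof -
    define s :: real where "s = 1 / Suc n"
    have s: "s > 0" by (simp add: s_def)
    have "(LINT y|lborel. g y * gauss ((x - y) /\<^sub>R s)) = s ^ DIM('a) * A n x" for x
    proof -
      have "integrable lborel (\<lambda>y. g y * gauss ((x - y) /\<^sub>R s))"
      proof (rule Bochner_Integration.integrable_bound[OF integrable_mult_right[OF gauss_conv(1)[OF s, of x]]])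
        show "AE y in lborel. norm (g y * gauss ((x - y) /\<^sub>R s)) \<le> norm (B * gauss ((x - y) /\<^sub>R s))"
          using B B0 by (intro AE_I2) (simp add: abs_mult mult_right_mono)
      qed simp
      from lborel_integral_affine[OF _ this, of "- s" x] s show ?thesis
        unfolding A_def s_def[symmetric] by simp
    qed
    then have "(LINT x|lborel. f x * (LINT y|lborel. g y * gauss ((x - y) /\<^sub>R s)))
      = s ^ DIM('a) * (LINT x|lborel. f x * A n x)"
      by (simp add: mult.left_commute[of "f _"])
    then show ?thesis using s unfolding s_def[symmetric]
      by (simp add: power_divide)
  qed
  ultimately show ?thesis by simp
qed

text \<open>Convergence off a null set comes from \<open>measurable_on\<close>. Clipping at
  \<open>B\<close> and cutting off between the radii \<open>R\<close> and \<open>R + 1\<close> give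
  the whole sequence one integrable majorant and do not change the limit.\<close>

lemma continuous_approximation:
  fixes f :: "'a::euclidean_space \<Rightarrow> real"
  assumes [measurable]: "f \<in> borel_measurable borel"
    and B: "\<And>x. \<bar>f x\<bar> \<le> B" and R: "\<And>x. R < norm x \<Longrightarrow> f x = 0"
  obtains g where "\<And>n. continuous_on UNIV (g n :: 'a \<Rightarrow> real)" "\<And>n x. \<bar>g n x\<bar> \<le> B"
    "\<And>n x. R + 1 < norm x \<Longrightarrow> g n x = 0" "AE x in lborel. (\<lambda>n. g n x) \<longlonglongrightarrow> f x"
proof -
  have B0: "0 \<le> B" using B[of 0] by linarith
  have "f \<in> borel_measurable lebesgue" by (intro measurable_completion) simp
  then have "f measurable_on UNIV" by (rule lebesgue_measurable_imp_measurable_on) simp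
  then obtain N h where N: "negligible N" and h: "\<And>n. continuous_on UNIV (h n)"
    and lim: "\<And>x. x \<notin> N \<Longrightarrow> (\<lambda>n. h n x) \<longlonglongrightarrow> f x"
    unfolding measurable_on_def by auto
  define c where "c x = max 0 (min 1 (R + 1 - norm x))" for x :: 'a
  have c: "0 \<le> c x" "c x \<le> 1" for x by (auto simp: c_def)
  define g where "g n x = max (- B) (min B (h n x)) * c x" for n x
  have lim': "(\<lambda>n. g n x) \<longlonglongrightarrow> f x" if "x \<notin> N" for x
  proof -
    have "(\<lambda>n. g n x) \<longlonglongrightarrow> max (- B) (min B (f x)) * c x"
      unfolding g_def by (intro tendsto_intros lim that)
    also have "max (- B) (min B (f x)) * c x = f x"
      using B[of x] R[of x] by (cases "R < norm x") (auto simp: c_def)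
    finally show ?thesis .
  qed
  show thesis
  proof
    show "continuous_on UNIV (g n)" for n
      unfolding g_def c_def by (intro continuous_intros h)
    show "\<bar>g n x\<bar> \<le> B" for n x
      using mult_mono[of "\<bar>max (- B) (min B (h n x))\<bar>" B "c x" 1] B0 c[of x]
      by (auto simp: g_def abs_mult)
    show "R + 1 < norm x \<Longrightarrow> g n x = 0" for n x
      by (simp add: g_def c_def)
    have "N \<in> null_sets lebesgue" using N by (simp add: negligible_iff_null_sets)
    then have "AE x in lebesgue. x \<notin> N" by (rule AE_not_in)
    then have "AE x in lborel. x \<notin> N" by (simp add: AE_completion_iff)
    then show "AE x in lborel. (\<lambda>n. g n x) \<longlonglongrightarrow> f x"
      by eventually_elim (rule lim')
  qed
qed

lemma integrable_bounded_ball: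
  fixes f :: "'a::euclidean_space \<Rightarrow> real"
  assumes [measurable]: "f \<in> borel_measurable borel"
    and B: "\<And>x. \<bar>f x\<bar> \<le> B" and R: "\<And>x. R < norm x \<Longrightarrow> f x = 0"
  shows "integrable lborel f"
proof (rule Bochner_Integration.integrable_bound)
  show "integrable lborel (\<lambda>x::'a. B * indicator (cball 0 R) x)"
    by (intro integrable_mult_right integrable_real_indicator emeasure_lborel_cball_finite) simp
  show "AE x in lborel. norm (f x) \<le> norm (B * indicator (cball 0 R) x)"
    using order_trans[OF B abs_ge_self] R by (intro AE_I2) (auto simp: indicator_def not_le)
qed simp

text \<open>Positivity of the weighted energy of \<open>f - g\<close>, with \<open>g\<close> continuous, gives
  \<open>2 \<integral> f g - \<integral> g\<^sup>2 \<le> (2 \<pi>)\<^sup>-\<^sup>n C\<close>; then let \<open>g\<close> tend to \<open>f\<close>.\<close>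

lemma gauss_energy_bound_imp_L2_bound:
  fixes f :: "'a::euclidean_space \<Rightarrow> real"
  assumes [measurable]: "f \<in> borel_measurable borel"
    and B: "\<And>x. \<bar>f x\<bar> \<le> B" and R: "\<And>x. R < norm x \<Longrightarrow> f x = 0"
    and C: "\<And>s. s > 0 \<Longrightarrow> (LINT \<xi>|lborel. gauss (s *\<^sub>R \<xi>) * (norm (fourier f \<xi>))\<^sup>2) \<le> C"
  shows "(2 * pi) ^ DIM('a) * (LINT x|lborel. (f x)\<^sup>2) \<le> C"
proof -
  have B0: "0 \<le> B" using B[of 0] by linarith
  have f: "integrable lborel f" by (rule integrable_bounded_ball[OF _ B R]) simp
  let ?p = "(2 * pi) ^ DIM('a)"
  have key: "?p * (2 * (LINT x|lborel. f x * g x) - (LINT x|lborel. (g x)\<^sup>2)) \<le> C"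
    if cont: "continuous_on UNIV g" and Bg: "\<And>x. \<bar>g x\<bar> \<le> B" and Rg: "\<And>x. R + 1 < norm x \<Longrightarrow> g x = 0"
    for g :: "'a \<Rightarrow> real"
  proof -
    have [measurable]: "g \<in> borel_measurable borel"
      using cont by (rule borel_measurable_continuous_onI)
    have g: "integrable lborel g" by (rule integrable_bounded_ball[OF _ Bg Rg]) simp
    have g2: "integrable lborel (\<lambda>x. (g x)\<^sup>2)"
    proof (rule integrable_bounded_ball)
      show "\<bar>(g x)\<^sup>2\<bar> \<le> B\<^sup>2" for x using power_mono[OF Bg[of x], of 2] by simp
    qed (use Rg in auto)
    note [measurable] = borel_measurable_fourier[OF f] borel_measurable_fourier[OF g]
    have weighted: "2 * ((sqrt (2 * pi) / s) ^ DIM('a) * (LINT x|lborel. f x * (LINT y|lborel. g y * gauss ((x - y) /\<^sub>R s))))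
        \<le> C + ?p * (LINT x|lborel. (g x)\<^sup>2)" if s: "s > 0" for s
    proof -
      let ?w = "\<lambda>\<xi>::'a. gauss (s *\<^sub>R \<xi>)"
      let ?F = "fourier f" and ?G = "fourier g"
      have iFG: "integrable lborel (\<lambda>\<xi>. complex_of_real (?w \<xi>) * (cnj (?G \<xi>) * ?F \<xi>))"
      proof (rule integrable_gauss_mult[OF s])
        have "cnj \<in> borel_measurable borel"
          by (intro borel_measurable_continuous_onI continuous_intros)
        then show "(\<lambda>\<xi>. cnj (?G \<xi>) * ?F \<xi>) \<in> borel_measurable borel" by measurable
        show "norm (cnj (?G \<xi>) * ?F \<xi>) \<le> (LINT x|lborel. \<bar>g x\<bar>) * (LINT x|lborel. \<bar>f x\<bar>)" for \<xi>
          by (auto simp: norm_mult intro!: mult_mono norm_fourier_le f g)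
      qed
      have Re: "(LINT \<xi>|lborel. ?w \<xi> * Re (cnj (?G \<xi>) * ?F \<xi>))
         = (sqrt (2 * pi) / s) ^ DIM('a) * (LINT x|lborel. f x * (LINT y|lborel. g y * gauss ((x - y) /\<^sub>R s)))"
      proof -
        have "(LINT \<xi>|lborel. ?w \<xi> * Re (cnj (?G \<xi>) * ?F \<xi>)) = (LINT \<xi>|lborel. Re (complex_of_real (?w \<xi>) * (cnj (?G \<xi>) * ?F \<xi>)))"
          by simp
        also have "\<dots> = Re (LINT \<xi>|lborel. complex_of_real (?w \<xi>) * cnj (?G \<xi>) * ?F \<xi>)"
          using iFG by (subst integral_Re) (simp_all only: mult.assoc)
        also note gauss_plancherel[OF f g s]
        finally show ?thesis by (simp only: Re_complex_of_real)
      qed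
      have iRe: "integrable lborel (\<lambda>\<xi>. ?w \<xi> * Re (cnj (?G \<xi>) * ?F \<xi>))"
        using integrable_Re[OF iFG] by simp
      have "0 \<le> (LINT \<xi>|lborel. ?w \<xi> * (norm (?F \<xi> - ?G \<xi>))\<^sup>2)" by simp
      also have "\<dots> = (LINT \<xi>|lborel. ?w \<xi> * (norm (?F \<xi>))\<^sup>2 + ?w \<xi> * (norm (?G \<xi>))\<^sup>2
           - 2 * (?w \<xi> * Re (cnj (?G \<xi>) * ?F \<xi>)))"
      proof (rule Bochner_Integration.integral_cong[OF refl])
        fix \<xi>
        have "(norm (?F \<xi> - ?G \<xi>))\<^sup>2 = (norm (?F \<xi>))\<^sup>2 + (norm (?G \<xi>))\<^sup>2 - 2 * Re (cnj (?G \<xi>) * ?F \<xi>)"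
          by (simp add: cmod_power2 power2_diff)
        then show "?w \<xi> * (norm (?F \<xi> - ?G \<xi>))\<^sup>2 = ?w \<xi> * (norm (?F \<xi>))\<^sup>2 + ?w \<xi> * (norm (?G \<xi>))\<^sup>2
           - 2 * (?w \<xi> * Re (cnj (?G \<xi>) * ?F \<xi>))"
          by (simp only: right_diff_distrib distrib_left mult.left_commute)
      qed
      also have "\<dots> = (LINT \<xi>|lborel. ?w \<xi> * (norm (?F \<xi>))\<^sup>2) + (LINT \<xi>|lborel. ?w \<xi> * (norm (?G \<xi>))\<^sup>2)
           - 2 * (LINT \<xi>|lborel. ?w \<xi> * Re (cnj (?G \<xi>) * ?F \<xi>))"
        using integrable_gauss_fourier_sq[OF f s] integrable_gauss_fourier_sq[OF g s] iRe
        by (simp del: complex_mult_cnj)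
      finally show ?thesis
        using C[OF s] gauss_bessel[OF g g2 s] unfolding Re by linarith
    qed
    \<comment> \<open>Only the cross term in \<open>weighted\<close> still depends on
      \<open>s\<close>; since \<open>g\<close> is continuous it converges as
      \<open>s = 1 / Suc n\<close> tends to 0.\<close>
    have "2 * ((sqrt (2 * pi) / (1 / Suc n)) ^ DIM('a) *
            (LINT x|lborel. f x * (LINT y|lborel. g y * gauss ((x - y) /\<^sub>R (1 / Suc n)))))
        \<le> C + ?p * (LINT x|lborel. (g x)\<^sup>2)" for n by (rule weighted) simp
    then have "2 * (?p * (LINT x|lborel. f x * g x)) \<le> C + ?p * (LINT x|lborel. (g x)\<^sup>2)"
      by (intro LIMSEQ_le_const2[OF tendsto_mult_left[OF gauss_average_tendsto[OF f g cont Bg]]]) auto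
    then show ?thesis by (simp add: right_diff_distrib mult.left_commute)
  qed
  obtain g where cont: "\<And>n. continuous_on UNIV (g n :: 'a \<Rightarrow> real)" and Bg: "\<And>n x. \<bar>g n x\<bar> \<le> B"
    and Rg: "\<And>n x. R + 1 < norm x \<Longrightarrow> g n x = 0" and lim: "AE x in lborel. (\<lambda>n. g n x) \<longlonglongrightarrow> f x"
    using continuous_approximation[of f B R] B R by auto
  have [measurable]: "g n \<in> borel_measurable borel" for n
    using cont by (rule borel_measurable_continuous_onI)
  define D where "D x = B * B * indicator (cball 0 (R + 1)) x" for x :: 'a
  have D: "integrable lborel D"
    unfolding D_def by (intro integrable_mult_right integrable_real_indicator emeasure_lborel_cball_finite) simp
  have le: "\<bar>u * g n x\<bar> \<le> D x" if "\<bar>u\<bar> \<le> B" for u n x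
    using mult_mono[OF that Bg[of n x]] B0 Rg[of x n] by (auto simp: D_def indicator_def abs_mult)
  have "(\<lambda>n. LINT x|lborel. f x * g n x) \<longlonglongrightarrow> (LINT x|lborel. f x * f x)"
  proof (rule integral_dominated_convergence[OF _ _ D])
    show "AE x in lborel. (\<lambda>n. f x * g n x) \<longlonglongrightarrow> f x * f x"
      using lim by eventually_elim (rule tendsto_mult_left)
  qed (use le[OF B] in auto)
  moreover have "(\<lambda>n. LINT x|lborel. g n x * g n x) \<longlonglongrightarrow> (LINT x|lborel. f x * f x)"
  proof (rule integral_dominated_convergence[OF _ _ D])
    show "AE x in lborel. (\<lambda>n. g n x * g n x) \<longlonglongrightarrow> f x * f x"
      using lim by eventually_elim (rule tendsto_mult)
  qed (use order_trans[OF abs_ge_self le[OF Bg]] in auto)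
  ultimately have "(\<lambda>n. ?p * (2 * (LINT x|lborel. f x * g n x) - (LINT x|lborel. g n x * g n x)))
      \<longlonglongrightarrow> ?p * (2 * (LINT x|lborel. f x * f x) - (LINT x|lborel. f x * f x))"
    by (intro tendsto_mult_left tendsto_diff)
  moreover have "?p * (2 * (LINT x|lborel. f x * g n x) - (LINT x|lborel. g n x * g n x)) \<le> C" for n
    using key[OF cont Bg Rg, of n] by (simp only: power2_eq_square)
  ultimately have "?p * (2 * (LINT x|lborel. f x * f x) - (LINT x|lborel. f x * f x)) \<le> C"
    by (rule LIMSEQ_le_const2[OF _ exI[of _ 0], OF _ allI[OF impI]])
  then show ?thesis by (simp add: power2_eq_square)
qed

section \<open>Slices and exponential weights\<close>

lemma lborel_distr_orthogonal:
  fixes Q :: "real^'n::{finite,wellorder} \<Rightarrow> real^'n::_"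
  assumes Q: "orthogonal_transformation Q"
  shows "distr lborel borel Q = lborel"
proof (rule lborel_eqI[symmetric])
  obtain P where P: "orthogonal_transformation P" "\<And>x. P (Q x) = x" "\<And>x. Q (P x) = x"
    using orthogonal_transformation_inv[OF Q] orthogonal_transformation_bij[OF Q]
    by (metis bij_inv_eq_iff)
  have "linear Q" using Q by (simp add: orthogonal_transformation_linear)
  then have [measurable]: "Q \<in> borel_measurable borel"
    by (intro borel_measurable_continuous_onI linear_continuous_on linear_conv_bounded_linear[THEN iffD1])
  fix l u :: "real^'n::_" assume le: "\<And>b. b \<in> Basis \<Longrightarrow> l \<bullet> b \<le> u \<bullet> b"
  \<comment> \<open>The preimage is rewritten as an image under the inverse rotation, because
    invariance of Lebesgue measure is available for images.\<close>
  have "Q -` box l u = P ` box l u" by (auto simp: P(3)) (metis P(2) imageI)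
  moreover have "measure lebesgue (P ` box l u) = measure lebesgue (box l u)"
    by (rule measure_orthogonal_image[OF P(1)]) simp
  moreover have "P ` box l u \<in> lmeasurable"
    by (rule measurable_orthogonal_image[OF P(1)]) simp
  ultimately have "emeasure lebesgue (Q -` box l u) = emeasure lebesgue (box l u)"
    by (metis emeasure_eq_ennreal_measure fmeasurableD2 lmeasurable_box infinity_ennreal_def)
  moreover have "Q -` box l u \<in> sets borel"
    using measurable_sets[OF \<open>Q \<in> borel_measurable borel\<close>, of "box l u"] by simp
  ultimately have "emeasure lborel (Q -` box l u) = emeasure lborel (box l u)" by simp
  then show "emeasure (distr lborel borel Q) (box l u) = ennreal (\<Prod>b\<in>Basis. (u - l) \<bullet> b)"
    using le by (simp add: emeasure_distr)
qed simp

lemma prod_Basis_cart: "(\<Prod>b\<in>(Basis :: (real^'n) set). f b) = (\<Prod>i\<in>UNIV. f (axis i 1))"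
proof -
  have B: "(Basis :: (real^'n) set) = range (\<lambda>i. axis i 1)" by (auto simp: Basis_vec_def)
  have inj: "inj (\<lambda>i::'n. axis i (1::real))" by (auto simp: inj_def axis_eq_axis)
  show ?thesis unfolding B by (subst prod.reindex[OF inj]) simp
qed

lemma prod_2: "(\<Prod>i\<in>(UNIV::2 set). f i) = f 1 * f 2"
  for f :: "2 \<Rightarrow> 'a::comm_monoid_mult"
  unfolding UNIV_2 by simp

lemma prod_3: "(\<Prod>i\<in>(UNIV::3 set). f i) = f 1 * f 2 * f 3"
  for f :: "3 \<Rightarrow> 'a::comm_monoid_mult"
  unfolding UNIV_3 by (simp add: mult.assoc)

text \<open>The height comes second so that \<open>lborel_pair.nn_integral_snd\<close> integrates
  over the horizontal slices first.\<close>

definition join3 :: "(real^2) \<times> real \<Rightarrow> real^3" where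
  "join3 z = vector [fst z $ 1, fst z $ 2, snd z]"

lemma join3_nth [simp]: "join3 z $ 1 = fst z $ 1" "join3 z $ 2 = fst z $ 2" "join3 z $ 3 = snd z"
  by (simp_all add: join3_def)

lemma borel_measurable_join3 [measurable]: "join3 \<in> borel_measurable borel"
proof -
  have "continuous_on UNIV (\<lambda>z. join3 z $ i)" for i
    using exhaust_3[of i] by (elim disjE; simp; intro continuous_intros)
  then have "continuous_on UNIV (\<lambda>z. \<chi> i. join3 z $ i)"
    by (intro continuous_on_vec_lambda)
  then show ?thesis by (intro borel_measurable_continuous_onI) simp
qed

lemma distr_join3: "distr lborel borel join3 = (lborel :: (real^3) measure)"
proof (rule lborel_eqI[symmetric])
  fix l u :: "real^3" assume le: "\<And>b. b \<in> Basis \<Longrightarrow> l \<bullet> b \<le> u \<bullet> b"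
  have le': "l $ i \<le> u $ i" for i
    using le[of "axis i 1"] by (simp add: inner_axis)
  let ?l = "vector [l$1, l$2] :: real^2" and ?u = "vector [u$1, u$2] :: real^2"
  have Basis3: "(\<Prod>b\<in>Basis. (u - l) \<bullet> b) = (u$1 - l$1) * (u$2 - l$2) * (u$3 - l$3)"
    by (simp add: prod_Basis_cart prod_3 inner_axis)
  have "join3 -` box l u = box ?l ?u \<times> {l$3<..<u$3}"
    by (auto simp: mem_box_cart forall_3 forall_2)
  then have "emeasure lborel (join3 -` box l u) = emeasure (lborel \<Otimes>\<^sub>M lborel) (box ?l ?u \<times> {l$3<..<u$3})"
    by (simp only: lborel_prod)
  also have "\<dots> = emeasure lborel (box ?l ?u) * emeasure lborel {l$3<..<u$3}"
    by (rule lborel.emeasure_pair_measure_Times) auto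
  also have "emeasure lborel (box ?l ?u) = ennreal ((u$1 - l$1) * (u$2 - l$2))"
  proof -
    have "?l $ i \<le> ?u $ i" for i using le' exhaust_2[of i] by auto
    then have "?l \<bullet> b \<le> ?u \<bullet> b" if "b \<in> Basis" for b
      using that by (auto simp: Basis_vec_def inner_axis)
    then show ?thesis by (simp add: prod_Basis_cart prod_2 inner_axis)
  qed
  finally show "emeasure (distr lborel borel join3) (box l u) = ennreal (\<Prod>b\<in>Basis. (u - l) \<bullet> b)"
    using le' by (simp add: emeasure_distr Basis3 ennreal_mult[symmetric])
qed simp

text \<open>\<open>Vol2\<close> is a supremum of reals, so it bounds its members only once these are
  bounded: all projections lie in one disc. Their measurability follows from openness, a linear
  surjection being an open map.\<close>

lemma Vol2_upper:
  fixes \<Omega> :: "(real^3) set"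
  assumes \<Omega>: "open \<Omega>" "bounded \<Omega>" and uw: "norm u = 1" "norm w = 1" "u \<bullet> w = 0"
  shows "(\<lambda>x. vector [x \<bullet> u, x \<bullet> w] :: real^2) ` \<Omega> \<in> lmeasurable"
    and "measure lebesgue ((\<lambda>x. vector [x \<bullet> u, x \<bullet> w] :: real^2) ` \<Omega>) \<le> Vol2 \<Omega>"
proof -
  let ?p = "\<lambda>u w x. vector [x \<bullet> u, x \<bullet> w] :: real^2"
  obtain R where R: "\<And>x. x \<in> \<Omega> \<Longrightarrow> norm x \<le> R" "0 < R" using \<Omega>(2) bounded_pos by blast
  have sub: "?p u w ` \<Omega> \<subseteq> cball 0 (2 * R)" if "norm u = 1" "norm w = 1" for u w :: "real^3"
  proof clarsimp
    fix x assume x: "x \<in> \<Omega>"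
    have "norm (?p u w x) \<le> (\<Sum>i\<in>UNIV. \<bar>?p u w x $ i\<bar>)" by (rule norm_le_l1_cart)
    also have "\<dots> = \<bar>x \<bullet> u\<bar> + \<bar>x \<bullet> w\<bar>" by (simp add: sum_2)
    also have "\<dots> \<le> norm x * norm u + norm x * norm w"
      by (intro add_mono Cauchy_Schwarz_ineq2)
    finally show "norm (?p u w x) \<le> 2 * R" using R(1)[OF x] that by simp
  qed
  have meas: "?p u w ` \<Omega> \<in> lmeasurable" if "norm u = 1" "norm w = 1" "u \<bullet> w = 0" for u w :: "real^3"
  proof -
    have "linear (?p u w)"
      by (rule linearI) (simp_all add: vec_eq_iff forall_2 inner_add_left)
    moreover have "surj (?p u w)"
    proof (rule surjI)
      fix y :: "real^2"
      show "?p u w (y$1 *\<^sub>R u + y$2 *\<^sub>R w) = y"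
        using that by (simp add: vec_eq_iff forall_2 inner_add_left inner_commute[of w u] norm_eq_1)
    qed
    ultimately have "open (?p u w ` \<Omega>)" by (rule open_surjective_linear_image[OF \<Omega>(1)])
    then show ?thesis
      using bounded_subset[OF bounded_cball sub[OF that(1,2)]]
      by (rule lmeasurable_open[rotated])
  qed
  show "?p u w ` \<Omega> \<in> lmeasurable" by (rule meas[OF uw])
  show "measure lebesgue (?p u w ` \<Omega>) \<le> Vol2 \<Omega>"
    unfolding Vol2_def
  proof (rule cSup_upper)
    show "bdd_above {measure lebesgue (?p u w ` \<Omega>) |u w. norm u = 1 \<and> norm w = 1 \<and> u \<bullet> w = 0}"
    proof (rule bdd_aboveI)
      fix y assume "y \<in> {measure lebesgue (?p u w ` \<Omega>) |u w. norm u = 1 \<and> norm w = 1 \<and> u \<bullet> w = 0}"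
      then obtain u w where y: "y = measure lebesgue (?p u w ` \<Omega>)" and uw: "norm u = 1" "norm w = 1" "u \<bullet> w = 0"
        by blast
      show "y \<le> measure lebesgue (cball (0::real^2) (2 * R))"
        unfolding y by (rule measure_mono_fmeasurable[OF sub[OF uw(1,2)] fmeasurableD[OF meas[OF uw]] lmeasurable_cball])
    qed
  qed (use uw in blast)
qed

text \<open>Tonelli's theorem in coordinates with third axis \<open>e\<close>: a slice orthogonal to
  \<open>e\<close> is contained in the projection of \<open>\<Omega>\<close> along \<open>e\<close>,
  whose area is at most \<open>Vol2 \<Omega>\<close>, and the heights range over the slab.\<close>

lemma nn_integral_slices_le:
  fixes \<Omega> :: "(real^3) set" and e :: "real^3"
  assumes \<Omega>: "open \<Omega>" "bounded \<Omega>" and e: "norm e = 1"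
    and slab: "\<And>x. x \<in> \<Omega> \<Longrightarrow> a \<le> e \<bullet> x \<and> e \<bullet> x \<le> b"
    and [measurable]: "F \<in> borel_measurable borel"
  shows "(\<integral>\<^sup>+x. F (e \<bullet> x) * indicator \<Omega> x \<partial>lborel) \<le> (\<integral>\<^sup>+t. F t * indicator {a..b} t \<partial>lborel) * ennreal (Vol2 \<Omega>)"
proof -
  have [measurable]: "\<Omega> \<in> sets borel" using \<Omega>(1) by simp
  obtain Q :: "real^3 \<Rightarrow> real^3" where Q: "orthogonal_transformation Q" "Q (axis 3 1) = e"
    using orthogonal_transformation_exists[of "axis 3 1 :: real^3" e] e by auto
  have linQ: "linear Q" using Q by (simp add: orthogonal_transformation_linear)
  then have [measurable]: "Q \<in> borel_measurable borel"
    by (intro borel_measurable_continuous_onI linear_continuous_on linear_conv_bounded_linear[THEN iffD1])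
  have inn: "Q v \<bullet> Q w = v \<bullet> w" for v w using Q(1) by (simp add: orthogonal_transformation_def)
  \<comment> \<open>The other two axes of the rotated frame span the plane onto which
    \<open>\<Omega>\<close> is projected.\<close>
  define u w where "u = Q (axis 1 1)" and "w = Q (axis 2 1)"
  have uw: "norm u = 1" "norm w = 1" "u \<bullet> w = 0"
    by (simp_all add: u_def w_def norm_eq_1 inn inner_axis_axis)
  let ?p = "\<lambda>x. vector [x \<bullet> u, x \<bullet> w] :: real^2"
  have meas: "?p ` \<Omega> \<in> lmeasurable" "measure lebesgue (?p ` \<Omega>) \<le> Vol2 \<Omega>"
    using Vol2_upper[OF \<Omega> uw] by auto
  have inner_e: "e \<bullet> Q (join3 (y, t)) = t" for y t
    unfolding Q(2)[symmetric] inn by (simp add: inner_axis')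
  have proj: "?p (Q (join3 (y, t))) = y" for y t
    unfolding u_def w_def inn by (simp add: vec_eq_iff forall_2 inner_axis)
  have slice: "(\<integral>\<^sup>+y. F t * indicator \<Omega> (Q (join3 (y, t))) \<partial>lborel)
      \<le> F t * indicator {a..b} t * ennreal (Vol2 \<Omega>)" for t
  proof (cases "a \<le> t \<and> t \<le> b")
    case False
    then have "Q (join3 (y, t)) \<notin> \<Omega>" for y using slab[of "Q (join3 (y, t))"] inner_e[of y t] by auto
    then show ?thesis by simp
  next
    case True
    have "(\<integral>\<^sup>+y. F t * indicator \<Omega> (Q (join3 (y, t))) \<partial>lborel) \<le> (\<integral>\<^sup>+y. F t * indicator (?p ` \<Omega>) y \<partial>lebesgue)"
      unfolding nn_integral_completion
    proof (rule nn_integral_mono)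
      fix y show "F t * indicator \<Omega> (Q (join3 (y, t))) \<le> F t * indicator (?p ` \<Omega>) y"
      proof (cases "Q (join3 (y, t)) \<in> \<Omega>")
        case True
        then have "y \<in> ?p ` \<Omega>" using proj[of y t] by (intro image_eqI[where x="Q (join3 (y, t))"]) auto
        then show ?thesis using True by simp
      qed simp
    qed
    also have "\<dots> = F t * emeasure lebesgue (?p ` \<Omega>)"
      using meas(1) by (simp add: nn_integral_cmult fmeasurableD)
    also have "emeasure lebesgue (?p ` \<Omega>) = ennreal (measure lebesgue (?p ` \<Omega>))"
      using fmeasurableD2[OF meas(1)] by (intro emeasure_eq_ennreal_measure) auto
    also have "F t * \<dots> \<le> F t * ennreal (Vol2 \<Omega>)"
      using meas(2) by (intro mult_left_mono ennreal_leI) auto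
    finally show ?thesis using True by simp
  qed
  have "(\<integral>\<^sup>+x. F (e \<bullet> x) * indicator \<Omega> x \<partial>lborel)
      = (\<integral>\<^sup>+x. F (e \<bullet> x) * indicator \<Omega> x \<partial>distr (distr lborel borel join3) borel Q)"
    by (simp add: distr_join3 lborel_distr_orthogonal[OF Q(1)])
  also have "\<dots> = (\<integral>\<^sup>+z. F (e \<bullet> Q (join3 z)) * indicator \<Omega> (Q (join3 z)) \<partial>(lborel \<Otimes>\<^sub>M lborel))"
    unfolding lborel_prod by (simp add: nn_integral_distr)
  also have "\<dots> = (\<integral>\<^sup>+t. \<integral>\<^sup>+y. F (e \<bullet> Q (join3 (y, t))) * indicator \<Omega> (Q (join3 (y, t))) \<partial>lborel \<partial>lborel)"
    by (rule lborel_pair.nn_integral_snd[symmetric]) (unfold lborel_prod, measurable)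
  also have "\<dots> \<le> (\<integral>\<^sup>+t. F t * indicator {a..b} t * ennreal (Vol2 \<Omega>) \<partial>lborel)"
    unfolding inner_e by (intro nn_integral_mono slice)
  also have "\<dots> = (\<integral>\<^sup>+t. F t * indicator {a..b} t \<partial>lborel) * ennreal (Vol2 \<Omega>)"
    by (rule nn_integral_multc) simp
  finally show ?thesis .
qed

lemma Vol2_nonneg:
  assumes "open \<Omega>" "bounded \<Omega>"
  shows "0 \<le> Vol2 \<Omega>"
proof -
  have "norm (axis 1 1 :: real^3) = 1" "norm (axis 2 1 :: real^3) = 1"
    "(axis 1 1 :: real^3) \<bullet> axis 2 1 = 0" by (simp_all add: inner_axis_axis)
  from Vol2_upper(2)[OF assms this] show ?thesis by (rule order_trans[OF measure_nonneg])
qed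

section \<open>Exponential weights on a slab\<close>

lemma lebesgue_on_borel_measurable:
  assumes "f \<in> borel_measurable borel"
  shows "f \<in> borel_measurable (lebesgue_on \<Omega>)"
  using assms by (intro measurable_restrict_space1 measurable_completion) simp

lemma integral_exp_slab_le:
  fixes \<Omega> :: "(real^3) set" and e :: "real^3"
  assumes \<Omega>: "open \<Omega>" "bounded \<Omega>" and e: "norm e = 1" and c: "c > 0" and D: "D \<ge> 0"
    and slab: "\<And>x. x \<in> \<Omega> \<Longrightarrow> a \<le> e \<bullet> x \<and> e \<bullet> x \<le> a + D"
  shows "(LINT x|lebesgue_on \<Omega>. exp (- c * (e \<bullet> x))) \<le> Vol2 \<Omega> * (exp (- c * a) * (1 - exp (- c * D)) / c)"
proof -
  have V: "0 \<le> Vol2 \<Omega>" by (rule Vol2_nonneg[OF \<Omega>])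
  have S: "\<Omega> \<in> sets lebesgue" using \<Omega>(1) by simp
  let ?I = "exp (- c * a) * (1 - exp (- c * D)) / c"
  have I0: "0 \<le> ?I" using c D by simp
  have "(\<integral>\<^sup>+x. ennreal (exp (- c * (e \<bullet> x))) \<partial>lebesgue_on \<Omega>)
     = (\<integral>\<^sup>+x. ennreal (exp (- c * (e \<bullet> x))) * indicator \<Omega> x \<partial>lborel)"
    using S by (simp add: nn_integral_restrict_space nn_integral_completion)
  also have "\<dots> \<le> (\<integral>\<^sup>+t. ennreal (exp (- c * t)) * indicator {a..a + D} t \<partial>lborel) * ennreal (Vol2 \<Omega>)"
    by (rule nn_integral_slices_le[OF \<Omega> e slab, where F="\<lambda>t. ennreal (exp (- c * t))"]) auto
  also have "(\<integral>\<^sup>+t. ennreal (exp (- c * t)) * indicator {a..a + D} t \<partial>lborel)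
      = ennreal (- exp (- c * (a + D)) / c - (- exp (- c * a) / c))"
  proof (rule nn_integral_FTC_Icc[where F="\<lambda>t. - exp (- c * t) / c"])
    fix x
    show "((\<lambda>t. - exp (- c * t) / c) has_real_derivative exp (- c * x)) (at x)"
      using c by (auto intro!: derivative_eq_intros)
  qed (use D in auto)
  also have "- exp (- c * (a + D)) / c - (- exp (- c * a) / c) = ?I"
    using c by (simp add: field_simps exp_add[symmetric])
  finally have "(\<integral>\<^sup>+x. ennreal (exp (- c * (e \<bullet> x))) \<partial>lebesgue_on \<Omega>) \<le> ennreal (Vol2 \<Omega> * ?I)"
    by (simp only: ennreal_mult'[OF V] mult.commute)
  moreover have "(LINT x|lebesgue_on \<Omega>. exp (- c * (e \<bullet> x)))
      = enn2real (\<integral>\<^sup>+x. ennreal (exp (- c * (e \<bullet> x))) \<partial>lebesgue_on \<Omega>)"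
    by (rule integral_eq_nn_integral) (auto intro!: lebesgue_on_borel_measurable)
  ultimately show ?thesis
    using mult_nonneg_nonneg[OF V I0] by (simp only: enn2real_leI)
qed

text \<open>Each factor depends on where the origin lies, but only through
  \<open>exp (- (2 * t) * a)\<close> or \<open>exp (2 * t * b)\<close>; in the product only the
  width \<open>b - a \<le> diameter \<Omega>\<close> survives. This is why the two waves are
  estimated together.\<close>

lemma exp_weights_product_le:
  fixes \<Omega> :: "(real^3) set" and e :: "real^3"
  assumes \<Omega>: "open \<Omega>" "bounded \<Omega>" "\<Omega> \<noteq> {}" and e: "norm e = 1" and t: "t > 0"
  shows "(LINT x|lebesgue_on \<Omega>. exp (- 2 * t * (e \<bullet> x))) * (LINT x|lebesgue_on \<Omega>. exp (2 * t * (e \<bullet> x)))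
    \<le> (Vol2 \<Omega> * (sinh (t * diameter \<Omega>) / t))\<^sup>2"
proof -
  let ?D = "diameter \<Omega>" and ?S = "(\<lambda>x. e \<bullet> x) ` \<Omega>"
  define a b where "a = Inf ?S" and "b = Sup ?S"
  obtain R where R: "\<And>x. x \<in> \<Omega> \<Longrightarrow> norm x \<le> R" using \<Omega>(2) bounded_iff by blast
  have "\<bar>e \<bullet> x\<bar> \<le> R" if "x \<in> \<Omega>" for x
    using Cauchy_Schwarz_ineq2[of e x] R[OF that] e by simp
  then have bdd: "bdd_below ?S" "bdd_above ?S"
    by (auto intro!: bdd_belowI[where m="-R"] bdd_aboveI[where M=R] simp: abs_le_iff minus_le_iff)
  have ab: "a \<le> e \<bullet> x" "e \<bullet> x \<le> b" if "x \<in> \<Omega>" for x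
    using that bdd by (auto simp: a_def b_def intro: cInf_lower cSup_upper)
  have diff: "e \<bullet> x - e \<bullet> y \<le> ?D" if "x \<in> \<Omega>" "y \<in> \<Omega>" for x y
    using Cauchy_Schwarz_ineq2[of e "x - y"] diameter_bounded_bound[OF \<Omega>(2) that] e
    by (simp add: inner_diff_right dist_norm)
  have D0: "0 \<le> ?D" by (rule diameter_ge_0[OF \<Omega>(2)])
  have top: "e \<bullet> x \<le> a + ?D" if "x \<in> \<Omega>" for x
  proof -
    have "e \<bullet> x - ?D \<le> a" unfolding a_def
      using \<Omega>(3) diff[OF that] by (intro cInf_greatest) (auto simp: algebra_simps)
    then show ?thesis by simp
  qed
  have ba: "b \<le> a + ?D" unfolding b_def
    using \<Omega>(3) top by (intro cSup_least) auto
  let ?q = "(1 - exp (- (2 * t) * ?D)) / (2 * t)"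
  have q0: "0 \<le> ?q" using t D0 by simp
  have V: "0 \<le> Vol2 \<Omega>" by (rule Vol2_nonneg[OF \<Omega>(1,2)])
  have 1: "(LINT x|lebesgue_on \<Omega>. exp (- 2 * t * (e \<bullet> x))) \<le> Vol2 \<Omega> * (exp (- (2 * t) * a) * ?q)"
    using integral_exp_slab_le[OF \<Omega>(1,2) e, of "2 * t" ?D a] ab top t D0 by simp
  \<comment> \<open>The second weight is the first one in direction \<open>- e\<close>, where the
    slab starts at \<open>- b\<close>.\<close>
  have "(LINT x|lebesgue_on \<Omega>. exp (- (2 * t) * (- e \<bullet> x)))
      \<le> Vol2 \<Omega> * (exp (- (2 * t) * (- b)) * (1 - exp (- (2 * t) * ?D)) / (2 * t))"
  proof (rule integral_exp_slab_le[OF \<Omega>(1,2)])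
    show "- b \<le> - e \<bullet> x \<and> - e \<bullet> x \<le> - b + ?D" if "x \<in> \<Omega>" for x
      using ab[OF that] ba by simp
  qed (use e t D0 in auto)
  then have 2: "(LINT x|lebesgue_on \<Omega>. exp (2 * t * (e \<bullet> x))) \<le> Vol2 \<Omega> * (exp (2 * t * b) * ?q)"
    by simp
  have "(LINT x|lebesgue_on \<Omega>. exp (- 2 * t * (e \<bullet> x))) * (LINT x|lebesgue_on \<Omega>. exp (2 * t * (e \<bullet> x)))
     \<le> (Vol2 \<Omega> * (exp (- (2 * t) * a) * ?q)) * (Vol2 \<Omega> * (exp (2 * t * b) * ?q))"
    using V q0 by (intro mult_mono 1 2 integral_nonneg mult_nonneg_nonneg) auto
  also have "\<dots> = (Vol2 \<Omega> * ?q)\<^sup>2 * exp (2 * t * (b - a))"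
    by (simp add: power2_eq_square exp_add[symmetric] algebra_simps)
  also have "\<dots> \<le> (Vol2 \<Omega> * ?q)\<^sup>2 * exp (2 * t * ?D)"
    using t ba by (intro mult_left_mono) auto
  also have "\<dots> = (Vol2 \<Omega> * (?q * exp (t * ?D)))\<^sup>2"
    by (simp only: power_mult_distrib exp_double[symmetric] mult.assoc)
  \<comment> \<open>Sharing the exponential evenly between the two equal factors makes the bound
    symmetric, hence \<open>sinh\<close>.\<close>
  also have "?q * exp (t * ?D) = sinh (t * ?D) / t"
  proof -
    have "exp (- (2 * t) * ?D) * exp (t * ?D) = exp (- (t * ?D))" by (simp flip: exp_add)
    then show ?thesis using t by (simp add: sinh_def field_simps)
  qed
  finally show ?thesis .
qed

section \<open>Plane waves\<close>

text \<open>Difference quotients along an axis have integral 0 by translation invariance. They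
  converge to the derivative, dominated through the mean value inequality by a constant on a fixed
  ball.\<close>

lemma integral_partial_deriv_eq_0:
  fixes \<psi> :: "real^3 \<Rightarrow> complex"
  assumes diff: "\<And>x. (\<lambda>t. \<psi> (x + t *\<^sub>R axis j 1)) differentiable (at 0)"
    and cont: "continuous_on UNIV \<psi>" and cont': "continuous_on UNIV (partial_deriv j \<psi>)"
    and K: "compact K" and supp: "\<And>x. x \<notin> K \<Longrightarrow> \<psi> x = 0"
  shows "integrable lborel (partial_deriv j \<psi>)" and "integral\<^sup>L lborel (partial_deriv j \<psi>) = 0"
proof -
  let ?e = "axis j 1 :: real^3" and ?d = "partial_deriv j \<psi>"
  \<comment> \<open>\<open>partial_deriv\<close> records derivatives at parameter 0; moving the base
    point gives the derivative at every \<open>t\<close>, as the mean value inequality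
    requires.\<close>
  have vd: "((\<lambda>t. \<psi> (x + t *\<^sub>R ?e)) has_vector_derivative ?d (x + t *\<^sub>R ?e)) (at t)" for x t
  proof -
    have "((\<lambda>h. \<psi> ((x + t *\<^sub>R ?e) + h *\<^sub>R ?e)) has_vector_derivative ?d (x + t *\<^sub>R ?e)) (at 0)"
      unfolding partial_deriv_def using diff by (rule vector_derivative_works[THEN iffD1])
    then have "((\<lambda>h. \<psi> ((x + t *\<^sub>R ?e) + (h - t) *\<^sub>R ?e)) has_vector_derivative ?d (x + t *\<^sub>R ?e)) (at t)"
      using vector_diff_chain_at[of "\<lambda>h. h - t" 1 t "\<lambda>h. \<psi> ((x + t *\<^sub>R ?e) + h *\<^sub>R ?e)"]
      by (auto simp: o_def has_vector_derivative_diff_const)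
    then show ?thesis by (simp add: algebra_simps)
  qed
  have d0: "?d x = 0" if "x \<notin> K" for x
  proof -
    have "open (- K)" using K by (simp add: compact_imp_closed open_Compl)
    then obtain r where r: "r > 0" "ball x r \<subseteq> - K" using \<open>x \<notin> K\<close> open_contains_ball by blast
    have "((\<lambda>t. \<psi> (x + t *\<^sub>R ?e)) has_vector_derivative 0) (at 0)"
    proof (rule has_vector_derivative_transform_within_open[where f="\<lambda>_. 0" and S="ball 0 r"])
      fix t :: real assume "t \<in> ball 0 r"
      then have "x + t *\<^sub>R ?e \<in> ball x r" by (simp add: dist_norm)
      then show "0 = \<psi> (x + t *\<^sub>R ?e)" using r supp by fastforce
    qed (use r in auto)
    then show ?thesis unfolding partial_deriv_def by (rule vector_derivative_at)
  qed
  have "compact (?d ` K)" using K cont' by (intro compact_continuous_image) (auto intro: continuous_on_subset)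
  then obtain B where B: "B > 0" "\<And>x. x \<in> K \<Longrightarrow> norm (?d x) \<le> B"
    using bounded_pos[of "?d ` K"] by (auto simp: compact_imp_bounded)
  then have B': "norm (?d x) \<le> B" for x using d0[of x] by (cases "x \<in> K") auto
  obtain R where R: "\<And>x. x \<in> K \<Longrightarrow> norm x \<le> R" using compact_imp_bounded[OF K] unfolding bounded_iff by blast
  define F where "F n x = (real (Suc n)) *\<^sub>R (\<psi> (x + (1 / Suc n) *\<^sub>R ?e) - \<psi> x)" for n x
  have [measurable]: "\<psi> \<in> borel_measurable borel" "?d \<in> borel_measurable borel"
    using cont cont' by (auto intro: borel_measurable_continuous_onI)
  have [measurable]: "F n \<in> borel_measurable borel" for n unfolding F_def by simp
  \<comment> \<open>Shifts have length at most 1, so the ball of radius \<open>R + 1\<close>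
    contains the support of every \<open>F n\<close>.\<close>
  define G where "G x = B * indicator (cball 0 (R + 1)) x" for x :: "real^3"
  have G: "integrable lborel G"
    unfolding G_def by (intro integrable_mult_right integrable_real_indicator emeasure_lborel_cball_finite) simp
  have F_le: "norm (F n x) \<le> G x" for n x
  proof (cases "x \<in> cball 0 (R + 1)")
    case True
    have "norm (\<psi> (x + (1 / Suc n) *\<^sub>R ?e) - \<psi> (x + 0 *\<^sub>R ?e)) \<le> B * norm (1 / real (Suc n) - 0)"
    proof (rule differentiable_bound[of UNIV "\<lambda>t. \<psi> (x + t *\<^sub>R ?e)" "\<lambda>t h. h *\<^sub>R ?d (x + t *\<^sub>R ?e)"])
      show "((\<lambda>t. \<psi> (x + t *\<^sub>R ?e)) has_derivative (\<lambda>h. h *\<^sub>R ?d (x + t *\<^sub>R ?e))) (at t within UNIV)" for t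
        using vd[of x t] by (simp add: has_vector_derivative_def)
      show "onorm (\<lambda>h. h *\<^sub>R ?d (x + t *\<^sub>R ?e)) \<le> B" for t
        using B' by (intro onorm_le) (simp add: mult.commute[of B] mult_left_mono)
    qed auto
    then have "real (Suc n) * norm (\<psi> (x + (1 / Suc n) *\<^sub>R ?e) - \<psi> x) \<le> B"
      by (simp add: field_simps)
    then show ?thesis using True by (simp only: F_def G_def norm_scaleR) simp
  next
    case False
    have "norm x \<le> norm (x + (1 / Suc n) *\<^sub>R ?e) + norm ((1 / Suc n) *\<^sub>R ?e)"
      using norm_triangle_ineq4[of "x + (1 / Suc n) *\<^sub>R ?e" "(1 / Suc n) *\<^sub>R ?e"] by simp
    moreover have "norm ((1 / Suc n) *\<^sub>R ?e) \<le> 1" by simp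
    moreover have "R + 1 < norm x" using False by simp
    ultimately have "R < norm (x + (1 / Suc n) *\<^sub>R ?e)" "R < norm x" by linarith+
    then have "x + (1 / Suc n) *\<^sub>R ?e \<notin> K" "x \<notin> K"
      using R[of x] R[of "x + (1 / Suc n) *\<^sub>R ?e"] by linarith+
    then show ?thesis using supp B(1) by (simp add: F_def G_def)
  qed
  have lim: "(\<lambda>n. F n x) \<longlonglongrightarrow> ?d x" for x
  proof -
    have "((\<lambda>h. (1 / norm h) *\<^sub>R (\<psi> (x + h *\<^sub>R ?e) - (\<psi> x + h *\<^sub>R ?d x))) \<longlongrightarrow> 0) (at 0)"
      using vd[of x 0] by (simp add: has_vector_derivative_def has_derivative_at2)
    moreover have "filterlim (\<lambda>n. 1 / real (Suc n)) (at 0) sequentially"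
      using LIMSEQ_Suc[OF lim_1_over_n] by (simp add: filterlim_at)
    ultimately have "(\<lambda>n. (1 / norm (1 / real (Suc n))) *\<^sub>R (\<psi> (x + (1 / Suc n) *\<^sub>R ?e) - (\<psi> x + (1 / Suc n) *\<^sub>R ?d x))) \<longlonglongrightarrow> 0"
      by (rule filterlim_compose)
    also have "(\<lambda>n. (1 / norm (1 / real (Suc n))) *\<^sub>R (\<psi> (x + (1 / Suc n) *\<^sub>R ?e) - (\<psi> x + (1 / Suc n) *\<^sub>R ?d x)))
        = (\<lambda>n. F n x - ?d x)"
      by (auto simp: F_def scaleR_diff_right scaleR_add_right)
    finally show ?thesis by (rule LIM_zero_cancel)
  qed
  have AE: "AE x in lborel. (\<lambda>n. F n x) \<longlonglongrightarrow> ?d x" "AE x in lborel. norm (F n x) \<le> G x" for n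
    using lim F_le by auto
  show "integrable lborel ?d"
    by (rule integrable_dominated_convergence[OF _ _ G AE]) auto
  have "(\<lambda>n. integral\<^sup>L lborel (F n)) \<longlonglongrightarrow> integral\<^sup>L lborel ?d"
    by (rule integral_dominated_convergence[OF _ _ G AE]) auto
  moreover have "integral\<^sup>L lborel (F n) = 0" for n
  proof -
    obtain C where C: "\<And>x. x \<in> K \<Longrightarrow> norm (\<psi> x) \<le> C"
      using compact_imp_bounded[OF compact_continuous_image[OF continuous_on_subset[OF cont] K]]
      by (auto simp: bounded_iff)
    have i: "integrable lborel \<psi>"
    proof (rule Bochner_Integration.integrable_bound)
      show "integrable lborel (\<lambda>x. C * indicator K x)"
        using K by (intro integrable_mult_right integrable_real_indicator emeasure_compact_finite)
          (auto simp: compact_imp_closed)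
      show "AE x in lborel. norm (\<psi> x) \<le> norm (C * indicator K x)"
        using order_trans[OF C abs_ge_self] supp by (auto simp: indicator_def)
    qed simp
    have i': "integrable lborel (\<lambda>x. \<psi> (x + (1 / Suc n) *\<^sub>R ?e))"
      using lborel_integrable_affine[OF _ i, of 1 "(1 / Suc n) *\<^sub>R ?e"]
      by (simp add: add.commute)
    have "(LINT x|lborel. \<psi> (x + (1 / Suc n) *\<^sub>R ?e)) = integral\<^sup>L lborel \<psi>"
      using lborel_integral_affine[OF _ i, of 1 "(1 / Suc n) *\<^sub>R ?e"]
      by (simp add: add.commute)
    then show ?thesis unfolding F_def using i i' by simp
  qed
  ultimately show "integral\<^sup>L lborel ?d = 0" by (simp add: LIMSEQ_const_iff)
qed


section \<open>Complex plane waves\<close>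

definition cvec :: "real^3 \<Rightarrow> complex^3" where
  "cvec x = (\<chi> i. complex_of_real (x $ i))"

definition ccross :: "complex^3 \<Rightarrow> complex^3 \<Rightarrow> complex^3" where
  "ccross a b = vector [a$2 * b$3 - a$3 * b$2, a$3 * b$1 - a$1 * b$3, a$1 * b$2 - a$2 * b$1]"

text \<open>\<open>cdot\<close> is bilinear, not Hermitian, so
  \<open>cdot \<zeta> \<zeta> = k\<^sup>2\<close> has complex solutions of arbitrarily large norm;
  the wave then grows or decays exponentially along the imaginary part of
  \<open>\<zeta>\<close>.\<close>

definition cwave :: "complex^3 \<Rightarrow> real^3 \<Rightarrow> complex" where
  "cwave \<zeta> x = exp (\<i> * cdot \<zeta> (cvec x))"

definition pwave :: "complex^3 \<Rightarrow> complex^3 \<Rightarrow> real^3 \<Rightarrow> complex^3" where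
  "pwave \<zeta> \<eta> x = cwave \<zeta> x *s \<eta>"

lemma cvec_nth [simp]: "cvec x $ i = complex_of_real (x $ i)"
  by (simp add: cvec_def)

lemma ccross_nth [simp]:
  "ccross a b $ 1 = a$2 * b$3 - a$3 * b$2"
  "ccross a b $ 2 = a$3 * b$1 - a$1 * b$3"
  "ccross a b $ 3 = a$1 * b$2 - a$2 * b$1"
  by (simp_all add: ccross_def)

lemma pwave_nth: "pwave \<zeta> \<eta> x $ i = cwave \<zeta> x * \<eta> $ i"
  by (simp add: pwave_def)

lemma cdot_3: "cdot a b = a$1 * b$1 + a$2 * b$2 + a$3 * b$3"
  by (simp add: cdot_def sum_3)

lemma norm_cdot_le: "norm (cdot a b) \<le> norm a * norm b"
proof -
  have "norm (cdot a b) \<le> (\<Sum>i\<in>UNIV. \<bar>norm (a $ i)\<bar> * \<bar>norm (b $ i)\<bar>)"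
    unfolding cdot_def by (rule sum_norm_le[THEN order_trans]) (auto simp: norm_mult)
  also have "\<dots> \<le> norm a * norm b"
    unfolding norm_vec_def by (rule L2_set_mult_ineq)
  finally show ?thesis .
qed

text \<open>For a transverse polarisation, \<open>cdot \<zeta> \<eta> = 0\<close>, this says that
  \<open>curl\<close> applied twice to the plane wave multiplies it by
  \<open>cdot \<zeta> \<zeta>\<close>: the Helmholtz relation behind Maxwell's equations.\<close>

lemma ccross_ccross: "ccross \<zeta> (ccross \<zeta> \<eta>) = cdot \<zeta> \<eta> *s \<zeta> - cdot \<zeta> \<zeta> *s \<eta>"
  by (simp add: vec_eq_iff forall_3 cdot_3 algebra_simps)

lemma ccross_scale: "ccross \<zeta> (c *s \<eta>) = c *s ccross \<zeta> \<eta>"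
  by (simp add: vec_eq_iff forall_3 algebra_simps)

lemma cwave_mult: "cwave \<zeta> x * cwave \<zeta>' x = cwave (\<zeta> + \<zeta>') x"
  by (simp add: cwave_def exp_add[symmetric] cdot_3 algebra_simps)

lemma continuous_on_cwave [continuous_intros]: "continuous_on S (cwave \<zeta>)"
  unfolding cwave_def cdot_3 cvec_nth by (intro continuous_intros)

lemma continuous_on_pwave: "continuous_on S (pwave \<zeta> \<eta>)"
proof -
  have "continuous_on S (\<lambda>x. \<chi> i. cwave \<zeta> x * \<eta> $ i)"
    by (intro continuous_intros)
  also have "(\<lambda>x. \<chi> i. cwave \<zeta> x * \<eta> $ i) = pwave \<zeta> \<eta>"
    by (auto simp: vec_eq_iff pwave_nth)
  finally show ?thesis .
qed

lemma cwave_shift: "cwave \<zeta> (x + t *\<^sub>R axis j 1) = exp (\<i> * \<zeta> $ j * of_real t) * cwave \<zeta> x"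
proof -
  have "cdot \<zeta> (cvec (x + t *\<^sub>R axis j 1)) = cdot \<zeta> (cvec x) + \<zeta> $ j * of_real t"
    using exhaust_3[of j] by (auto simp: cdot_3 axis_def algebra_simps)
  then show ?thesis by (simp add: cwave_def exp_add algebra_simps)
qed

lemma cwave_vector_derivative:
  "((\<lambda>t. cwave \<zeta> (x + t *\<^sub>R axis j 1)) has_vector_derivative \<i> * \<zeta> $ j * cwave \<zeta> x) (at 0)"
proof -
  have "((\<lambda>z. exp (\<i> * \<zeta> $ j * z) * cwave \<zeta> x) has_field_derivative \<i> * \<zeta> $ j * cwave \<zeta> x) (at (of_real 0))"
    by (auto intro!: derivative_eq_intros)
  from has_vector_derivative_real_field[OF this] show ?thesis
    by (simp add: cwave_shift)
qed

lemma pwave_vector_derivative: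
  "((\<lambda>t. pwave \<zeta> \<eta> (x + t *\<^sub>R axis j 1)) has_vector_derivative pwave \<zeta> ((\<i> * \<zeta> $ j) *s \<eta>) x) (at 0)"
proof -
  have bl: "bounded_linear (\<lambda>c. c *s \<eta>)"
    by (rule bounded_linear_intro[where K="norm \<eta>"])
       (auto simp: vec_eq_iff algebra_simps norm_vec_def norm_mult L2_set_right_distrib)
  from bounded_linear.has_vector_derivative[OF bl cwave_vector_derivative] show ?thesis
    by (simp add: pwave_def vec_eq_iff algebra_simps)
qed

lemma partial_deriv_pwave: "partial_deriv j (pwave \<zeta> \<eta>) = pwave \<zeta> ((\<i> * \<zeta> $ j) *s \<eta>)"
  by (auto simp: partial_deriv_def intro!: vector_derivative_at pwave_vector_derivative)

text \<open>A partial derivative of a plane wave is a plane wave with rescaled polarisation, so the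
  induction runs over all \<open>\<eta>\<close> at once.\<close>

lemma smooth_on_pwave: "smooth_on UNIV (pwave \<zeta> \<eta>)"
proof -
  have "Ck_on k UNIV (pwave \<zeta> \<eta>)" for k
    by (induction k arbitrary: \<eta>)
       (auto simp: partial_deriv_pwave continuous_on_pwave intro: differentiableI_vector pwave_vector_derivative)
  then show ?thesis by (simp add: smooth_on_def)
qed

lemma partial_deriv_cwave: "partial_deriv j (\<lambda>x. cwave \<zeta> x * c) x = \<i> * \<zeta> $ j * cwave \<zeta> x * c"
  unfolding partial_deriv_def
  by (intro vector_derivative_at bounded_linear.has_vector_derivative[OF bounded_linear_mult_left] cwave_vector_derivative)

lemma curl_pwave: "curl (pwave \<zeta> \<eta>) = pwave \<zeta> (\<i> *s ccross \<zeta> \<eta>)"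
  by (rule ext, simp add: curl_def pwave_nth partial_deriv_cwave vec_eq_iff forall_3)
     (simp add: algebra_simps)


section \<open>Weak curl of plane waves on a bounded domain\<close>

lemma integrable_continuous_lebesgue_on:
  fixes f :: "real^3 \<Rightarrow> 'b::{banach,second_countable_topology}"
  assumes \<Omega>: "open \<Omega>" "bounded \<Omega>" and f: "continuous_on UNIV f"
  shows "integrable (lebesgue_on \<Omega>) f"
proof -
  interpret finite_measure "lebesgue_on \<Omega>"
    using \<Omega> by (intro finite_measure_lebesgue_on lmeasurable_open)
  have "compact (f ` closure \<Omega>)"
    using \<Omega>(2) by (intro compact_continuous_image continuous_on_subset[OF f]) auto
  then have "bounded (f ` closure \<Omega>)" by (rule compact_imp_bounded)
  then have "bounded (f ` \<Omega>)" by (rule bounded_subset) (intro image_mono closure_subset)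
  then obtain B where B: "\<And>x. x \<in> \<Omega> \<Longrightarrow> norm (f x) \<le> B"
    by (auto simp: bounded_iff)
  show ?thesis
  proof (rule integrable_const_bound)
    show "f \<in> borel_measurable (lebesgue_on \<Omega>)"
      using f by (intro measurable_restrict_space1 measurable_completion) (simp add: borel_measurable_continuous_onI)
    show "AE x in lebesgue_on \<Omega>. norm (f x) \<le> B"
      using B by (intro AE_I2) simp
  qed
qed

lemma
  fixes h :: "real^3 \<Rightarrow> 'b::{banach,second_countable_topology}"
  assumes \<Omega>: "open \<Omega>" and h: "integrable lborel h" and supp: "\<And>x. x \<notin> \<Omega> \<Longrightarrow> h x = 0"
  shows integrable_lebesgue_on_supported: "integrable (lebesgue_on \<Omega>) h"
    and integral_lebesgue_on_supported: "integral\<^sup>L (lebesgue_on \<Omega>) h = integral\<^sup>L lborel h"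
proof -
  have S: "\<Omega> \<in> sets lebesgue" using \<Omega> by simp
  have e: "(\<lambda>x. indicator \<Omega> x *\<^sub>R h x) = h" using supp by (auto simp: indicator_def)
  have [measurable]: "h \<in> borel_measurable lborel" by (rule borel_measurable_integrable[OF h])
  show "integrable (lebesgue_on \<Omega>) h"
    using S h by (simp add: integrable_restrict_space e integrable_completion)
  show "integral\<^sup>L (lebesgue_on \<Omega>) h = integral\<^sup>L lborel h"
    using S by (simp add: integral_restrict_space e integral_completion)
qed

text \<open>Integration by parts for one component: \<open>A\<close> is the partial derivative of
  \<open>cwave \<zeta> x * \<phi> x $ m\<close>, which has compact support inside
  \<open>\<Omega>\<close>. Integrability is recorded so that a sum of six such terms can be
  integrated term by term.\<close>

lemma cwave_test_fun_integral:
  fixes \<phi> :: "real^3 \<Rightarrow> complex^3" and \<zeta> :: "complex^3" and j m :: 3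
  assumes \<Omega>: "open \<Omega>" and \<phi>: "test_fun \<Omega> \<phi>"
  defines "A \<equiv> \<lambda>x. \<i> * \<zeta> $ j * cwave \<zeta> x * \<phi> x $ m + cwave \<zeta> x * partial_deriv j (\<lambda>y. \<phi> y $ m) x"
  shows "integrable (lebesgue_on \<Omega>) A" and "integral\<^sup>L (lebesgue_on \<Omega>) A = 0"
proof -
  let ?K = "closure {x. \<phi> x \<noteq> 0}"
  let ?\<psi> = "\<lambda>x. cwave \<zeta> x * \<phi> x $ m"
  have K: "compact ?K" "?K \<subseteq> \<Omega>" using \<phi> by (auto simp: test_fun_def)
  have "Ck_on (Suc 0) UNIV \<phi>" using \<phi> by (simp add: test_fun_def smooth_on_def del: Ck_on.simps)
  then have c: "continuous_on UNIV \<phi>" and d: "\<And>x. (\<lambda>t. \<phi> (x + t *\<^sub>R axis j 1)) differentiable (at 0)"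
    and c': "continuous_on UNIV (partial_deriv j \<phi>)" by auto
  have supp: "\<phi> x = 0" if "x \<notin> ?K" for x using that closure_subset[of "{x. \<phi> x \<noteq> 0}"] by blast
  have vd: "((\<lambda>t. \<phi> (x + t *\<^sub>R axis j 1) $ m) has_vector_derivative partial_deriv j \<phi> x $ m) (at 0)" for x
    using bounded_linear.has_vector_derivative[OF bounded_linear_vec_nth d[THEN vector_derivative_works[THEN iffD1]]]
    by (simp add: partial_deriv_def)
  have comp: "partial_deriv j (\<lambda>y. \<phi> y $ m) x = partial_deriv j \<phi> x $ m" for x
    unfolding partial_deriv_def[of j "\<lambda>y. \<phi> y $ m"] by (rule vector_derivative_at[OF vd])
  have vd\<psi>: "((\<lambda>t. ?\<psi> (x + t *\<^sub>R axis j 1)) has_vector_derivative A x) (at 0)" for x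
    using has_vector_derivative_mult[OF cwave_vector_derivative[of \<zeta> x j] vd[of x]]
    by (simp add: A_def comp add.commute)
  have A: "partial_deriv j ?\<psi> = A"
    unfolding partial_deriv_def by (rule ext) (rule vector_derivative_at[OF vd\<psi>])
  have "continuous_on UNIV A"
    unfolding A_def comp by (intro continuous_intros c c')
  then have cA: "continuous_on UNIV (partial_deriv j ?\<psi>)" by (simp add: A)
  have c\<psi>: "continuous_on UNIV ?\<psi>" by (intro continuous_intros c)
  have s\<psi>: "?\<psi> x = 0" if "x \<notin> ?K" for x using supp[OF that] by simp
  have z: "A x = 0" if "x \<notin> \<Omega>" for x
  proof -
    have "x \<in> - ?K" "open (- ?K)" using that K by auto
    then obtain r where r: "r > 0" "ball x r \<subseteq> - ?K" using open_contains_ball by blast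
    have "((\<lambda>t. ?\<psi> (x + t *\<^sub>R axis j 1)) has_vector_derivative 0) (at 0)"
    proof (rule has_vector_derivative_transform_within_open[where f="\<lambda>_. 0" and S="ball 0 r"])
      fix t :: real assume "t \<in> ball 0 r"
      then have "x + t *\<^sub>R axis j 1 \<in> ball x r" by (simp add: dist_norm)
      then show "0 = ?\<psi> (x + t *\<^sub>R axis j 1)" using r s\<psi> by fastforce
    qed (use r in auto)
    then show ?thesis using vd\<psi> vector_derivative_unique_at by blast
  qed
  note I = integral_partial_deriv_eq_0[OF differentiableI_vector[OF vd\<psi>] c\<psi> cA K(1) s\<psi>, unfolded A]
  show "integrable (lebesgue_on \<Omega>) A"
    by (rule integrable_lebesgue_on_supported[OF \<Omega> I(1) z])
  show "integral\<^sup>L (lebesgue_on \<Omega>) A = 0"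
    using integral_lebesgue_on_supported[OF \<Omega> I(1) z] I(2) by simp
qed

lemma norm_vector_smult: "norm (c *s (v :: complex^3)) = norm c * norm v"
  by (simp add: norm_vec_def norm_mult L2_set_right_distrib)

lemma L2_pwave:
  assumes \<Omega>: "open \<Omega>" "bounded \<Omega>"
  shows "L2 \<Omega> (pwave \<zeta> \<eta>)"
  unfolding L2_def
  using integrable_continuous_lebesgue_on[OF \<Omega> continuous_on_pwave, of \<zeta> \<eta>]
    integrable_continuous_lebesgue_on[OF \<Omega>
      continuous_on_power[OF continuous_on_norm[OF continuous_on_pwave]], of \<zeta> \<eta> 2]
  by auto

lemma L2norm_pwave: "L2norm \<Omega> (pwave \<zeta> \<eta>) = norm \<eta> * L2norm \<Omega> (cwave \<zeta>)"
  by (simp add: L2norm_def pwave_def norm_vector_smult power_mult_distrib real_sqrt_mult)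

lemma weak_curl_pwave:
  assumes \<Omega>: "open \<Omega>" "bounded \<Omega>"
  shows "weak_curl \<Omega> (pwave \<zeta> \<eta>) (pwave \<zeta> (\<i> *s ccross \<zeta> \<eta>))"
  unfolding weak_curl_def
proof (intro conjI allI impI L2_pwave \<Omega>)
  fix \<phi> :: "real^3 \<Rightarrow> complex^3" assume \<phi>: "test_fun \<Omega> \<phi>"
  define A where "A j m x = \<i> * \<zeta> $ j * cwave \<zeta> x * \<phi> x $ m + cwave \<zeta> x * partial_deriv j (\<lambda>y. \<phi> y $ m) x"
    for j m x
  have A: "integrable (lebesgue_on \<Omega>) (A j m)" "integral\<^sup>L (lebesgue_on \<Omega>) (A j m) = 0" for j m
    unfolding A_def using cwave_test_fun_integral[OF \<Omega>(1) \<phi>] by auto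
  have "Ck_on 0 UNIV \<phi>" using \<phi> by (simp only: test_fun_def smooth_on_def)
  then have c: "continuous_on UNIV \<phi>" by simp
  have g: "integrable (lebesgue_on \<Omega>) (\<lambda>x. cdot (pwave \<zeta> (\<i> *s ccross \<zeta> \<eta>) x) (\<phi> x))"
    unfolding cdot_3 by (intro integrable_continuous_lebesgue_on \<Omega> continuous_intros continuous_on_pwave c)
  \<comment> \<open>The two sides of the weak curl identity differ by antisymmetric pairs
    \<open>A j m x - A m j x\<close>, and each term of these integrates to 0.\<close>
  have e: "cdot (pwave \<zeta> \<eta> x) (curl \<phi> x) = cdot (pwave \<zeta> (\<i> *s ccross \<zeta> \<eta>) x) (\<phi> x)
      + (\<eta> $ 1 * (A 2 3 x - A 3 2 x) + \<eta> $ 2 * (A 3 1 x - A 1 3 x) + \<eta> $ 3 * (A 1 2 x - A 2 1 x))" for x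
    by (simp add: cdot_3 curl_def pwave_nth A_def algebra_simps)
  show "(LINT x|lebesgue_on \<Omega>. cdot (pwave \<zeta> \<eta> x) (curl \<phi> x))
      = (LINT x|lebesgue_on \<Omega>. cdot (pwave \<zeta> (\<i> *s ccross \<zeta> \<eta>) x) (\<phi> x))"
    unfolding e using A g by simp
qed

section \<open>The boundary map tested against plane waves\<close>

lemma integral_mult_sq_le:
  fixes f g :: "'a \<Rightarrow> real"
  assumes [measurable]: "f \<in> borel_measurable M" "g \<in> borel_measurable M"
    and f: "integrable M (\<lambda>x. (f x)\<^sup>2)" and g: "integrable M (\<lambda>x. (g x)\<^sup>2)"
    and nn: "\<And>x. 0 \<le> f x" "\<And>x. 0 \<le> g x"
  shows "integrable M (\<lambda>x. f x * g x)"
    and "(LINT x|M. f x * g x) \<le> sqrt (LINT x|M. (f x)\<^sup>2) * sqrt (LINT x|M. (g x)\<^sup>2)"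
proof -
  show i: "integrable M (\<lambda>x. f x * g x)"
  proof (rule Bochner_Integration.integrable_bound)
    show "integrable M (\<lambda>x. (f x)\<^sup>2 + (g x)\<^sup>2)" using f g by simp
    show "AE x in M. norm (f x * g x) \<le> norm ((f x)\<^sup>2 + (g x)\<^sup>2)"
    proof (rule AE_I2)
      fix x
      have "2 * (f x * g x) \<le> (f x)\<^sup>2 + (g x)\<^sup>2"
        using sum_squares_bound[of "f x" "g x"] by simp
      moreover have "0 \<le> f x * g x" using nn[of x] by simp
      ultimately have "f x * g x \<le> (f x)\<^sup>2 + (g x)\<^sup>2" by linarith
      then show "norm (f x * g x) \<le> norm ((f x)\<^sup>2 + (g x)\<^sup>2)" using nn[of x] by simp
    qed
  qed simp
  have "ennreal ((LINT x|M. f x * g x)\<^sup>2) = (\<integral>\<^sup>+x. ennreal (f x) * ennreal (g x) \<partial>M)\<^sup>2"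
    using i nn by (simp add: nn_integral_eq_integral[symmetric] ennreal_mult ennreal_power[symmetric] integral_nonneg)
  also have "\<dots> \<le> (\<integral>\<^sup>+x. (ennreal (f x))\<^sup>2 \<partial>M) * (\<integral>\<^sup>+x. (ennreal (g x))\<^sup>2 \<partial>M)"
    by (rule Cauchy_Schwarz_nn_integral) auto
  also have "\<dots> = ennreal ((LINT x|M. (f x)\<^sup>2) * (LINT x|M. (g x)\<^sup>2))"
    using f g nn by (simp add: nn_integral_eq_integral[symmetric] ennreal_mult ennreal_power)
  finally have "(LINT x|M. f x * g x)\<^sup>2 \<le> (LINT x|M. (f x)\<^sup>2) * (LINT x|M. (g x)\<^sup>2)"
    by (subst (asm) ennreal_le_iff) (auto intro!: mult_nonneg_nonneg integral_nonneg)
  then show "(LINT x|M. f x * g x) \<le> sqrt (LINT x|M. (f x)\<^sup>2) * sqrt (LINT x|M. (g x)\<^sup>2)"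
    unfolding real_sqrt_mult[symmetric] by (rule real_le_rsqrt)
qed

lemma
  fixes u v :: "real^3 \<Rightarrow> complex^3"
  assumes u: "L2 \<Omega> u" and v: "L2 \<Omega> v"
  shows integrable_cdot: "integrable (lebesgue_on \<Omega>) (\<lambda>x. cdot (u x) (v x))"
    and norm_integral_cdot_le: "norm (LINT x|lebesgue_on \<Omega>. cdot (u x) (v x)) \<le> L2norm \<Omega> u * L2norm \<Omega> v"
proof -
  have [measurable]: "u \<in> borel_measurable (lebesgue_on \<Omega>)" "v \<in> borel_measurable (lebesgue_on \<Omega>)"
    using u v by (auto simp: L2_def)
  have nth: "(\<lambda>x. w x $ i) \<in> borel_measurable (lebesgue_on \<Omega>)"
    if "w \<in> borel_measurable (lebesgue_on \<Omega>)" for w :: "real^3 \<Rightarrow> complex^3" and i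
    by (rule measurable_compose[OF that borel_measurable_continuous_onI]) (intro continuous_intros)
  have [measurable]: "(\<lambda>x. cdot (u x) (v x)) \<in> borel_measurable (lebesgue_on \<Omega>)"
    unfolding cdot_3 by (intro borel_measurable_add borel_measurable_times nth) auto
  note CS = integral_mult_sq_le[of "\<lambda>x. norm (u x)" "lebesgue_on \<Omega>" "\<lambda>x. norm (v x)"]
  have i: "integrable (lebesgue_on \<Omega>) (\<lambda>x. norm (u x) * norm (v x))"
    using u v by (intro CS(1)) (auto simp: L2_def)
  show i': "integrable (lebesgue_on \<Omega>) (\<lambda>x. cdot (u x) (v x))"
    by (rule Bochner_Integration.integrable_bound[OF i]) (auto simp: norm_cdot_le)
  have "norm (LINT x|lebesgue_on \<Omega>. cdot (u x) (v x)) \<le> (LINT x|lebesgue_on \<Omega>. norm (u x) * norm (v x))"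
    by (intro order_trans[OF integral_norm_bound] Bochner_Integration.integral_mono integrable_norm i i' norm_cdot_le)
  also have "\<dots> \<le> L2norm \<Omega> u * L2norm \<Omega> v"
    unfolding L2norm_def using u v by (intro CS(2)) (auto simp: L2_def)
  finally show "norm (LINT x|lebesgue_on \<Omega>. cdot (u x) (v x)) \<le> L2norm \<Omega> u * L2norm \<Omega> v" .
qed

lemma L2norm_nonneg: "0 \<le> L2norm \<Omega> u"
  by (simp add: L2norm_def integral_nonneg)

lemma TH_norm_le:
  assumes "weak_curl \<Omega> u cu"
  shows "TH_norm \<Omega> u cu \<le> L2norm \<Omega> u + L2norm \<Omega> cu"
  unfolding TH_norm_def
  by (rule cInf_lower)
     (use assms in \<open>auto simp: same_tan_trace_def intro!: bdd_belowI[where m=0] add_nonneg_nonneg L2norm_nonneg\<close>)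

text \<open>The pairing depends only on the trace, so Cauchy-Schwarz may be applied to every
  competitor in the infimum \<open>TH_norm\<close>. The maximum is dual to the sum of norms in that
  infimum.\<close>

lemma norm_tan_trace_le:
  assumes u: "weak_curl \<Omega> u cu" and \<phi>: "smooth_on UNIV \<phi>" "L2 \<Omega> \<phi>" "L2 \<Omega> (curl \<phi>)"
  shows "norm (tan_trace \<Omega> u cu \<phi>) \<le> max (L2norm \<Omega> \<phi>) (L2norm \<Omega> (curl \<phi>)) * TH_norm \<Omega> u cu"
proof -
  let ?m = "max (L2norm \<Omega> \<phi>) (L2norm \<Omega> (curl \<phi>))"
  let ?S = "{L2norm \<Omega> v + L2norm \<Omega> cv | v cv. weak_curl \<Omega> v cv \<and> same_tan_trace \<Omega> v cv u cu}"
  have m0: "0 \<le> ?m" using L2norm_nonneg[of \<Omega> \<phi>] by simp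
  have bound: "norm (tan_trace \<Omega> u cu \<phi>) \<le> ?m * s" if s_in: "s \<in> ?S" for s
  proof -
    obtain v cv where s: "s = L2norm \<Omega> v + L2norm \<Omega> cv" and v: "weak_curl \<Omega> v cv"
      and tr: "same_tan_trace \<Omega> v cv u cu" using s_in by blast
    have L: "L2 \<Omega> v" "L2 \<Omega> cv" using v by (auto simp: weak_curl_def)
    have "tan_trace \<Omega> u cu \<phi> = tan_trace \<Omega> v cv \<phi>" using tr \<phi>(1) by (simp add: same_tan_trace_def)
    also have "\<dots> = (LINT x|lebesgue_on \<Omega>. cdot (cv x) (\<phi> x)) - (LINT x|lebesgue_on \<Omega>. cdot (v x) (curl \<phi> x))"
      unfolding tan_trace_def by (intro Bochner_Integration.integral_diff integrable_cdot L \<phi>)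
    also have "norm \<dots> \<le> L2norm \<Omega> cv * L2norm \<Omega> \<phi> + L2norm \<Omega> v * L2norm \<Omega> (curl \<phi>)"
      by (intro order_trans[OF norm_triangle_ineq4] add_mono norm_integral_cdot_le L \<phi>)
    also have "\<dots> \<le> L2norm \<Omega> cv * ?m + L2norm \<Omega> v * ?m"
      by (intro add_mono mult_left_mono L2norm_nonneg) auto
    finally show ?thesis by (simp add: s algebra_simps)
  qed
  have ne: "?S \<noteq> {}" using u by (auto simp: same_tan_trace_def)
  show ?thesis
  \<comment> \<open>With \<open>?m = 0\<close> one cannot divide to reach the infimum, but then
    \<open>bound\<close> already makes the pairing vanish.\<close>
  proof (cases "?m = 0")
    case True
    then show ?thesis using bound ne by auto
  next
    case False
    then have m: "0 < ?m" using m0 by simp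
    have "norm (tan_trace \<Omega> u cu \<phi>) / ?m \<le> TH_norm \<Omega> u cu"
      unfolding TH_norm_def
    proof (rule cInf_greatest[OF ne])
      fix s assume "s \<in> ?S"
      then show "norm (tan_trace \<Omega> u cu \<phi>) / ?m \<le> s"
        using bound m by (simp add: divide_le_eq mult.commute)
    qed
    then show ?thesis using m by (simp add: divide_le_eq mult.commute)
  qed
qed

section \<open>Plane waves as Maxwell fields\<close>

lemma cdot_smult_left: "cdot (c *s a) b = c * cdot a b"
  and cdot_smult_right: "cdot a (c *s b) = c * cdot a b"
  and cdot_diff_left: "cdot (a - a') b = cdot a b - cdot a' b"
  by (simp_all add: cdot_3 algebra_simps)

text \<open>The first Maxwell equation dictates \<open>H\<close>; the second is the Helmholtz
  relation with \<open>k\<^sup>2 / (\<omega> * \<mu>\<^sub>0) = \<omega> *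
  \<epsilon>\<^sub>0\<close>. The equalities with \<open>curl\<close> are separate conclusions so
  that they can rewrite the trace pairing.\<close>

lemma maxwell_sol_pwave:
  assumes \<Omega>: "open \<Omega>" "bounded \<Omega>" and pos: "\<epsilon>\<^sub>0 > 0" "\<mu>\<^sub>0 > 0" "\<omega> > 0"
    and k: "k = \<omega> * sqrt (\<epsilon>\<^sub>0 * \<mu>\<^sub>0)"
    and \<zeta>: "cdot \<zeta> \<zeta> = complex_of_real (k\<^sup>2)" "cdot \<zeta> \<eta> = 0"
  defines "H \<equiv> pwave \<zeta> (complex_of_real (1 / (\<omega> * \<mu>\<^sub>0)) *s ccross \<zeta> \<eta>)"
  shows "(\<lambda>x. (\<i> * \<omega> * \<mu>\<^sub>0) *s H x) = curl (pwave \<zeta> \<eta>)"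
    and "(\<lambda>x. 0 - (\<i> * \<omega> * \<epsilon>\<^sub>0) *s pwave \<zeta> \<eta> x) = curl H"
    and "maxwell_sol \<omega> \<epsilon>\<^sub>0 \<mu>\<^sub>0 \<Omega> (\<lambda>x. 0) (pwave \<zeta> \<eta>) H"
proof -
  show E: "(\<lambda>x. (\<i> * \<omega> * \<mu>\<^sub>0) *s H x) = curl (pwave \<zeta> \<eta>)"
    using pos by (auto simp: curl_pwave H_def pwave_def vec_eq_iff)
  have "k\<^sup>2 = \<omega>\<^sup>2 * (\<epsilon>\<^sub>0 * \<mu>\<^sub>0)" using pos by (simp add: k power_mult_distrib)
  then have k2: "k\<^sup>2 / (\<omega> * \<mu>\<^sub>0) = \<omega> * \<epsilon>\<^sub>0" using pos by (simp add: power2_eq_square)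
  have cc: "\<i> *s ccross \<zeta> (complex_of_real (1 / (\<omega> * \<mu>\<^sub>0)) *s ccross \<zeta> \<eta>)
      = (- \<i> * complex_of_real (k\<^sup>2 / (\<omega> * \<mu>\<^sub>0))) *s \<eta>"
    unfolding ccross_scale ccross_ccross \<zeta> by (simp add: vec_eq_iff)
  have "curl H = pwave \<zeta> ((- \<i> * complex_of_real (\<omega> * \<epsilon>\<^sub>0)) *s \<eta>)"
    unfolding H_def curl_pwave cc k2 ..
  then show H: "(\<lambda>x. 0 - (\<i> * \<omega> * \<epsilon>\<^sub>0) *s pwave \<zeta> \<eta> x) = curl H"
    by (auto simp: pwave_def vec_eq_iff)
  show "maxwell_sol \<omega> \<epsilon>\<^sub>0 \<mu>\<^sub>0 \<Omega> (\<lambda>x. 0) (pwave \<zeta> \<eta>) H"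
    unfolding maxwell_sol_def E H unfolding H_def curl_pwave by (intro conjI weak_curl_pwave \<Omega>)
qed

lemma Linfty_integrable_mult:
  fixes h :: "real^3 \<Rightarrow> complex"
  assumes \<Omega>: "open \<Omega>" "bounded \<Omega>" and \<sigma>: "Linfty \<Omega> \<sigma>" and h: "continuous_on UNIV h"
  shows "integrable (lebesgue_on \<Omega>) (\<lambda>x. complex_of_real (\<sigma> x) * h x)"
proof -
  have [measurable]: "\<sigma> \<in> borel_measurable (lebesgue_on \<Omega>)" using \<sigma> by (simp add: Linfty_def)
  have ih: "integrable (lebesgue_on \<Omega>) h" by (rule integrable_continuous_lebesgue_on[OF \<Omega> h])
  have [measurable]: "h \<in> borel_measurable (lebesgue_on \<Omega>)" using ih by auto
  obtain B where B: "AE x in lebesgue_on \<Omega>. \<bar>\<sigma> x\<bar> \<le> B" using \<sigma> by (auto simp: Linfty_def)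
  have "integrable (lebesgue_on \<Omega>) (\<lambda>x. B * norm (h x))" using ih by simp
  then show ?thesis
  proof (rule Bochner_Integration.integrable_bound)
    show "AE x in lebesgue_on \<Omega>. norm (complex_of_real (\<sigma> x) * h x) \<le> norm (B * norm (h x))"
      using B by eventually_elim (simp add: norm_mult abs_mult mult_right_mono)
  qed simp
qed

text \<open>The sum of polarisation norms measures the boundary datum in \<open>TH_norm\<close>, the
  maximum measures the test wave in the dual sense. Polarisations stay free because real and complex
  frequencies call for different ones: \<open>cdot \<eta> \<eta>'\<close> must not be small compared
  with these factors.\<close>

lemma plane_wave_estimate:
  assumes \<Omega>: "open \<Omega>" "bounded \<Omega>" and pos: "\<epsilon>\<^sub>0 > 0" "\<mu>\<^sub>0 > 0" "\<omega> > 0"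
    and solv: "uniquely_solvable \<omega> \<epsilon>\<^sub>0 \<mu>\<^sub>0 \<Omega> \<sigma>"
    and k: "k = \<omega> * sqrt (\<epsilon>\<^sub>0 * \<mu>\<^sub>0)" and \<sigma>: "Linfty \<Omega> \<sigma>"
    and bound: "Lambda'_bound \<omega> \<epsilon>\<^sub>0 \<mu>\<^sub>0 \<Omega> \<sigma> \<epsilon>" and \<epsilon>: "0 \<le> \<epsilon>"
    and \<zeta>: "cdot \<zeta> \<zeta> = complex_of_real (k\<^sup>2)" "cdot \<zeta> \<eta> = 0"
    and \<zeta>': "cdot \<zeta>' \<zeta>' = complex_of_real (k\<^sup>2)" "cdot \<zeta>' \<eta>' = 0"
  shows "norm (LINT x|lebesgue_on \<Omega>. complex_of_real (\<sigma> x) * cwave (\<zeta> + \<zeta>') x) * norm (cdot \<eta> \<eta>')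
    \<le> \<epsilon> * ((norm \<eta> + norm (ccross \<zeta> \<eta>)) * max (norm \<eta>') (norm (ccross \<zeta>' \<eta>')))
        * (L2norm \<Omega> (cwave \<zeta>) * L2norm \<Omega> (cwave \<zeta>'))"
proof -
  let ?E0 = "pwave \<zeta> \<eta>" and ?F = "pwave \<zeta>' \<eta>'"
  define H0 where "H0 = pwave \<zeta> (complex_of_real (1 / (\<omega> * \<mu>\<^sub>0)) *s ccross \<zeta> \<eta>)"
  define H where "H = pwave \<zeta>' (complex_of_real (1 / (\<omega> * \<mu>\<^sub>0)) *s ccross \<zeta>' \<eta>')"
  note sol0 = maxwell_sol_pwave[OF \<Omega> pos k \<zeta>, folded H0_def]
  note sol = maxwell_sol_pwave[OF \<Omega> pos k \<zeta>', folded H_def]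
  have wc0: "weak_curl \<Omega> ?E0 (\<lambda>x. (\<i> * \<omega> * \<mu>\<^sub>0) *s H0 x)"
    using sol0(3) by (simp add: maxwell_sol_def)
  \<comment> \<open>The datum is the trace of the wave itself, so the wave solves the zeroth-order
    problem and is also a competitor for the norm of its own trace.\<close>
  have p0: "problem0 \<omega> \<epsilon>\<^sub>0 \<mu>\<^sub>0 \<Omega> ?E0 (\<lambda>x. (\<i> * \<omega> * \<mu>\<^sub>0) *s H0 x) ?E0 H0"
    using sol0(3) by (simp add: problem0_def same_tan_trace_def)
  obtain E1 H1 where p1: "problem1 \<omega> \<epsilon>\<^sub>0 \<mu>\<^sub>0 \<Omega> \<sigma> ?E0 E1 H1"
    using solv wc0 p0 unfolding uniquely_solvable_def by blast
  let ?cH1 = "\<lambda>x. complex_of_real (\<sigma> x) *s ?E0 x - (\<i> * \<omega> * \<epsilon>\<^sub>0) *s E1 x"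
  have wcE1: "weak_curl \<Omega> E1 (\<lambda>x. (\<i> * \<omega> * \<mu>\<^sub>0) *s H1 x)" and wcH1: "weak_curl \<Omega> H1 ?cH1"
    and zt: "zero_tan_trace \<Omega> E1 (\<lambda>x. (\<i> * \<omega> * \<mu>\<^sub>0) *s H1 x)"
    using p1 by (auto simp: problem1_def maxwell_sol_def)
  let ?T = "LINT x|lebesgue_on \<Omega>. complex_of_real (\<sigma> x) * cwave (\<zeta> + \<zeta>') x"
  \<comment> \<open>\<open>?b\<close> is the integrand of the trace of \<open>E1\<close> tested with
    \<open>H\<close>. Maxwell's equations for the pair \<open>?F\<close>, \<open>H\<close> turn the
    trace of \<open>H1\<close> tested with \<open>?F\<close> into the integral of
    \<open>\<sigma>\<close> times the product of the waves minus that of \<open>?b\<close>, and the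
    latter vanishes with the tangential trace of \<open>E1\<close>.\<close>
  let ?b = "\<lambda>x. cdot ((\<i> * \<omega> * \<mu>\<^sub>0) *s H1 x) (H x) - cdot (E1 x) (curl H x)"
  have LH: "L2 \<Omega> H" "L2 \<Omega> (curl H)" "L2 \<Omega> ?F" "L2 \<Omega> (curl ?F)"
    by (auto simp: H_def curl_pwave intro!: L2_pwave \<Omega>)
  have ib: "integrable (lebesgue_on \<Omega>) ?b"
    using wcE1 by (intro Bochner_Integration.integrable_diff integrable_cdot LH) (auto simp: weak_curl_def)
  have "integral\<^sup>L (lebesgue_on \<Omega>) ?b = 0"
    using zt smooth_on_pwave unfolding zero_tan_trace_def tan_trace_def H_def by blast
  moreover have "tan_trace \<Omega> H1 ?cH1 ?F = (LINT x|lebesgue_on \<Omega>.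
      complex_of_real (\<sigma> x) * cwave (\<zeta> + \<zeta>') x * cdot \<eta> \<eta>' - ?b x)"
    unfolding tan_trace_def sol(1,2)[symmetric]
    by (simp add: cdot_smult_left cdot_smult_right cdot_diff_left)
       (simp add: pwave_def cdot_smult_left cdot_smult_right cwave_mult[symmetric] cdot_3 algebra_simps)
  ultimately have trace: "tan_trace \<Omega> H1 ?cH1 ?F = ?T * cdot \<eta> \<eta>'"
    using ib Linfty_integrable_mult[OF \<Omega> \<sigma> continuous_on_cwave, of "\<zeta> + \<zeta>'"] by simp
  let ?W = "L2norm \<Omega> (cwave \<zeta>)" and ?W' = "L2norm \<Omega> (cwave \<zeta>')"
  have "TH_norm \<Omega> ?E0 (\<lambda>x. (\<i> * \<omega> * \<mu>\<^sub>0) *s H0 x) \<le> (norm \<eta> + norm (ccross \<zeta> \<eta>)) * ?W"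
    using TH_norm_le[OF wc0] unfolding sol0(1) curl_pwave
    by (simp add: L2norm_pwave norm_vector_smult algebra_simps)
  then have TH: "TH_norm \<Omega> H1 ?cH1 \<le> \<epsilon> * ((norm \<eta> + norm (ccross \<zeta> \<eta>)) * ?W)"
    using bound wc0 p0 p1 \<epsilon> unfolding Lambda'_bound_def by (meson mult_left_mono order_trans)
  have m: "max (L2norm \<Omega> ?F) (L2norm \<Omega> (curl ?F)) = max (norm \<eta>') (norm (ccross \<zeta>' \<eta>')) * ?W'"
    unfolding curl_pwave L2norm_pwave
    by (simp add: norm_vector_smult max_mult_distrib_right L2norm_nonneg)
  have "norm ?T * norm (cdot \<eta> \<eta>') = norm (tan_trace \<Omega> H1 ?cH1 ?F)"
    unfolding trace by (simp add: norm_mult)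
  also have "\<dots> \<le> max (L2norm \<Omega> ?F) (L2norm \<Omega> (curl ?F)) * TH_norm \<Omega> H1 ?cH1"
    by (rule norm_tan_trace_le[OF wcH1 smooth_on_pwave LH(3,4)])
  also have "\<dots> \<le> max (L2norm \<Omega> ?F) (L2norm \<Omega> (curl ?F)) * (\<epsilon> * ((norm \<eta> + norm (ccross \<zeta> \<eta>)) * ?W))"
    by (intro mult_left_mono TH) (simp add: L2norm_nonneg le_max_iff_disj)
  finally show ?thesis unfolding m by (simp add: mult_ac)
qed

section \<open>Bounds on the Fourier transform\<close>

unbundle cross3_syntax

text \<open>A dimension count rather than normalised cross products with \<open>p\<close>, because
  \<open>p = 0\<close> occurs at the frequency \<open>\<xi> = 0\<close>.\<close>

lemma orthonormal_complement:
  fixes p :: "real^3"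
  obtains e f where "norm e = 1" "norm f = 1" "e \<bullet> f = 0" "p \<bullet> e = 0" "p \<bullet> f = 0"
proof -
  have unit: "\<exists>u. norm u = 1 \<and> p \<bullet> u = 0 \<and> q \<bullet> u = 0" for q :: "real^3"
  proof -
    have "dim {p, q} \<le> card {p, q}" by (rule dim_le_card[OF span_superset]) simp
    also have "\<dots> \<le> 2" by (simp add: card_insert_if)
    finally have "dim {p, q} < DIM(real^3)" by simp
    then obtain x where "x \<noteq> 0" and x: "\<And>y. y \<in> span {p, q} \<Longrightarrow> orthogonal x y"
      using orthogonal_to_subspace_exists[of "{p, q}"] by auto
    then have "norm (x /\<^sub>R norm x) = 1" by simp
    moreover have "p \<bullet> x = 0" "q \<bullet> x = 0"
      using x[of p] x[of q] by (auto simp: orthogonal_def span_base inner_commute)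
    ultimately show ?thesis by (intro exI[of _ "x /\<^sub>R norm x"]) simp
  qed
  obtain e where e: "norm e = 1" "p \<bullet> e = 0" using unit[of 0] by blast
  obtain f where "norm f = 1" "p \<bullet> f = 0" "e \<bullet> f = 0" using unit[of e] by blast
  with e that show thesis by blast
qed

section \<open>Frequencies by real and imaginary part\<close>

definition cplx :: "real^3 \<Rightarrow> real^3 \<Rightarrow> complex^3" where
  "cplx a b = cvec a + \<i> *s cvec b"

lemma cplx_nth [simp]: "cplx a b $ i = Complex (a $ i) (b $ i)"
  by (simp add: cplx_def complex_eq_iff)

lemma cplx_add: "cplx a b + cplx c d = cplx (a + c) (b + d)"
  by (simp add: vec_eq_iff complex_eq_iff)

lemma cdot_cplx: "cdot (cplx a b) (cplx c d) = Complex (a \<bullet> c - b \<bullet> d) (a \<bullet> d + b \<bullet> c)"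
  by (simp add: cdot_3 complex_eq_iff inner_vec_def sum_3)

lemma ccross_cplx: "ccross (cplx a b) (cplx c 0) = cplx (a \<times> c) (b \<times> c)"
  by (simp add: vec_eq_iff forall_3 cross3_def complex_eq_iff)

lemma norm_cplx: "norm (cplx a b) = sqrt ((norm a)\<^sup>2 + (norm b)\<^sup>2)"
proof -
  have "(\<Sum>i\<in>UNIV. (norm (cplx a b $ i))\<^sup>2) = (norm a)\<^sup>2 + (norm b)\<^sup>2"
    unfolding power2_norm_eq_inner[of a] power2_norm_eq_inner[of b]
    unfolding cmod_power2 by (simp add: sum_3 inner_vec_def power2_eq_square)
  then show ?thesis by (simp add: norm_vec_def L2_set_def)
qed

lemma norm_cwave_cplx: "norm (cwave (cplx a b) x) = exp (- (b \<bullet> x))"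
  by (simp add: cwave_def cdot_3 inner_vec_def sum_3)

lemma cwave_cplx_0: "cwave (cplx \<xi> 0) x = cis (\<xi> \<bullet> x)"
  by (simp add: cwave_def cdot_3 inner_vec_def sum_3 cis_conv_exp complex_eq_iff Complex_eq)

lemma norm_cross_orthogonal: "a \<bullet> b = 0 \<Longrightarrow> norm (a \<times> b) = norm a * norm b" for a b :: "real^3"
  using norm_cross_dot[of a b] by (simp add: power2_eq_iff_nonneg)

text \<open>\<open>\<xi>\<close> is the sum of two real vectors of length \<open>k\<close>, placed
  symmetrically about its half. Both waves have modulus 1 and share the polarisation
  \<open>f\<close>, whose self-pairing is 1; since \<open>k \<ge> 1\<close>, the factor
  \<open>(1 + k) * max 1 k\<close> is \<open>k * (1 + k)\<close>.\<close>

lemma fourier_bound_low: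
  fixes \<xi> :: "real^3"
  assumes \<Omega>: "open \<Omega>" "bounded \<Omega>" and pos: "\<epsilon>\<^sub>0 > 0" "\<mu>\<^sub>0 > 0" "\<omega> > 0"
    and solv: "uniquely_solvable \<omega> \<epsilon>\<^sub>0 \<mu>\<^sub>0 \<Omega> \<sigma>"
    and k: "k = \<omega> * sqrt (\<epsilon>\<^sub>0 * \<mu>\<^sub>0)" "k \<ge> 1" and \<sigma>: "Linfty \<Omega> \<sigma>"
    and bound: "Lambda'_bound \<omega> \<epsilon>\<^sub>0 \<mu>\<^sub>0 \<Omega> \<sigma> \<epsilon>" and \<epsilon>: "0 \<le> \<epsilon>"
    and \<xi>: "norm \<xi> \<le> 2 * k"
  shows "norm (LINT x|lebesgue_on \<Omega>. complex_of_real (\<sigma> x) * cis (\<xi> \<bullet> x)) \<le> \<epsilon> * (k * (1 + k)) * Vol \<Omega>"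
proof -
  define p where "p = \<xi> /\<^sub>R 2"
  obtain e f where ef: "norm e = 1" "norm f = 1" "e \<bullet> f = 0" "p \<bullet> e = 0" "p \<bullet> f = 0"
    by (rule orthonormal_complement)
  \<comment> \<open>The length that completes \<open>p\<close> to a vector of norm \<open>k\<close>;
    the radicand is nonnegative because \<open>norm p \<le> k\<close>.\<close>
  define s where "s = sqrt (k\<^sup>2 - (norm p)\<^sup>2)"
  have "norm p \<le> k" using \<xi> by (simp add: p_def)
  then have s2: "s\<^sup>2 = k\<^sup>2 - (norm p)\<^sup>2" by (simp add: s_def power_mono)
  define a a' where "a = p + s *\<^sub>R e" and "a' = p - s *\<^sub>R e"
  have aa: "a \<bullet> a = k\<^sup>2" "a' \<bullet> a' = k\<^sup>2"
    using s2 ef by (simp_all add: a_def a'_def inner_add_left inner_add_right inner_diff_left inner_diff_right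
      inner_commute[of e p] power2_norm_eq_inner power2_eq_square[of s] norm_eq_1)
  have na: "norm a = k" "norm a' = k" using aa k(2) by (simp_all add: norm_eq_sqrt_inner)
  have af: "a \<bullet> f = 0" "a' \<bullet> f = 0" using ef by (simp_all add: a_def a'_def inner_add_left inner_diff_left)
  have W: "L2norm \<Omega> (cwave (cplx b 0)) = sqrt (Vol \<Omega>)" for b
    using \<Omega>(1) by (simp add: L2norm_def norm_cwave_cplx Vol_def measure_restrict_space)
  have V: "0 \<le> Vol \<Omega>" by (simp add: Vol_def)
  have "norm (LINT x|lebesgue_on \<Omega>. complex_of_real (\<sigma> x) * cwave (cplx a 0 + cplx a' 0) x) * norm (cdot (cplx f 0) (cplx f 0))
    \<le> \<epsilon> * ((norm (cplx f 0) + norm (ccross (cplx a 0) (cplx f 0))) * max (norm (cplx f 0)) (norm (ccross (cplx a' 0) (cplx f 0))))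
        * (L2norm \<Omega> (cwave (cplx a 0)) * L2norm \<Omega> (cwave (cplx a' 0)))"
    by (rule plane_wave_estimate[OF \<Omega> pos solv k(1) \<sigma> bound \<epsilon>])
       (simp_all add: cdot_cplx aa af complex_eq_iff)
  also have "cplx a 0 + cplx a' 0 = cplx \<xi> 0"
    by (simp add: cplx_add a_def a'_def p_def scaleR_2[symmetric])
  finally show ?thesis
    using ef k(2) V unfolding W
    by (simp add: cwave_cplx_0 cdot_cplx norm_eq_1 ccross_cplx norm_cplx norm_cross_orthogonal af na Complex_eq max_def mult_ac)
qed

text \<open>Here \<open>N\<close> is the norm of the polarisations in the complex range and
  \<open>N\<^sup>2\<close> is their pairing: dividing by it leaves the same factor as for real
  frequencies.\<close>

lemma polarisation_factor_le:
  fixes N k :: real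
  assumes "k \<ge> 1" "N \<ge> k"
  shows "(N + k\<^sup>2) * max N (k\<^sup>2) \<le> k * (1 + k) * N\<^sup>2"
proof (cases "N \<ge> k\<^sup>2")
  case True
  have "(N + k\<^sup>2) * N \<le> 2 * N\<^sup>2" using True assms by (simp add: power2_eq_square mult_right_mono distrib_right)
  also have "\<dots> \<le> k * (1 + k) * N\<^sup>2"
    using assms(1) mult_mono[of 1 k 2 "1 + k"] by (intro mult_right_mono) auto
  finally show ?thesis using True by (simp add: max_def)
next
  case False
  have "N * k\<^sup>2 \<le> k * N\<^sup>2" using assms by (simp add: power2_eq_square mult_mono mult_left_mono)
  moreover have "k\<^sup>2 * k\<^sup>2 \<le> k\<^sup>2 * N\<^sup>2" using assms by (intro mult_left_mono power_mono) auto
  ultimately show ?thesis using False by (simp add: max_def algebra_simps power2_eq_square)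
qed

text \<open>For \<open>|\<xi>| > 2 k\<close> the frequencies are complex, and the polarisation \<open>\<zeta> \<times> f\<close> is used because
  \<open>\<zeta> \<times> (\<zeta> \<times> f) = - k\<^sup>2 f\<close> does not grow with \<open>|\<zeta>|\<close>, whereas the polarisation \<open>f\<close> would lose
  a factor \<open>|\<zeta>|\<^sup>2\<close>.\<close>

lemma fourier_bound_high:
  fixes \<xi> :: "real^3"
  assumes \<Omega>: "open \<Omega>" "bounded \<Omega>" "\<Omega> \<noteq> {}" and pos: "\<epsilon>\<^sub>0 > 0" "\<mu>\<^sub>0 > 0" "\<omega> > 0"
    and solv: "uniquely_solvable \<omega> \<epsilon>\<^sub>0 \<mu>\<^sub>0 \<Omega> \<sigma>"
    and k: "k = \<omega> * sqrt (\<epsilon>\<^sub>0 * \<mu>\<^sub>0)" "k \<ge> 1" and \<sigma>: "Linfty \<Omega> \<sigma>"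
    and bound: "Lambda'_bound \<omega> \<epsilon>\<^sub>0 \<mu>\<^sub>0 \<Omega> \<sigma> \<epsilon>" and \<epsilon>: "0 \<le> \<epsilon>"
    and \<xi>: "2 * k < norm \<xi>" and t: "t = sqrt ((norm \<xi>)\<^sup>2 / 4 - k\<^sup>2)"
  shows "norm (LINT x|lebesgue_on \<Omega>. complex_of_real (\<sigma> x) * cis (\<xi> \<bullet> x))
    \<le> \<epsilon> * (k * (1 + k)) * (Vol2 \<Omega> * (sinh (t * diameter \<Omega>) / t))"
proof -
  define p where "p = \<xi> /\<^sub>R 2"
  obtain e f where ef: "norm e = 1" "norm f = 1" "e \<bullet> f = 0" "p \<bullet> e = 0" "p \<bullet> f = 0"
    by (rule orthonormal_complement)
  have np: "(norm p)\<^sup>2 = (norm \<xi>)\<^sup>2 / 4" by (simp add: p_def power_divide)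
  have "(2 * k)\<^sup>2 < (norm \<xi>)\<^sup>2" using \<xi> k(2) by (intro power_strict_mono) auto
  then have t0: "t > 0" and t2: "t\<^sup>2 = (norm p)\<^sup>2 - k\<^sup>2" by (simp_all add: t np power_mult_distrib)
  have pp: "p \<bullet> p = k\<^sup>2 + t\<^sup>2" using t2 by (simp add: power2_norm_eq_inner)
  \<comment> \<open>Opposite imaginary parts cancel in the sum, leaving \<open>\<xi>\<close>;
    orthogonality of \<open>p\<close> and \<open>e\<close> makes \<open>cdot ?z ?z\<close> real, and
    the choice of \<open>t\<close> makes it \<open>k\<^sup>2\<close>.\<close>
  let ?z = "cplx p (t *\<^sub>R e)" and ?z' = "cplx p (- t *\<^sub>R e)" and ?f = "cplx f 0"
  define N where "N = sqrt (k\<^sup>2 + 2 * t\<^sup>2)"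
  have N2: "N\<^sup>2 = k\<^sup>2 + 2 * t\<^sup>2" by (simp add: N_def)
  have Nk: "k \<le> N" unfolding N_def by (rule real_le_rsqrt) simp
  have cr: "norm (p \<times> f) = norm p" "norm (e \<times> f) = 1"
    using ef by (simp_all add: norm_cross_orthogonal)
  have eta: "ccross ?z ?f = cplx (p \<times> f) (t *\<^sub>R (e \<times> f))" "ccross ?z' ?f = cplx (p \<times> f) (- (t *\<^sub>R (e \<times> f)))"
    by (simp_all add: ccross_cplx cross_mult_left)
  have neta: "norm (ccross ?z ?f) = N" "norm (ccross ?z' ?f) = N"
    unfolding eta norm_cplx using cr t2 by (simp_all add: N_def power_mult_distrib)
  have zz: "cdot ?z ?z = complex_of_real (k\<^sup>2)" "cdot ?z' ?z' = complex_of_real (k\<^sup>2)"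
    using ef pp by (simp_all add: cdot_cplx complex_eq_iff norm_eq_1 power2_eq_square inner_commute[of e p])
  have zf: "cdot ?z ?f = 0" "cdot ?z' ?f = 0"
    using ef by (simp_all add: cdot_cplx complex_eq_iff)
  have theta: "norm (ccross ?z (ccross ?z ?f)) = k\<^sup>2" "norm (ccross ?z' (ccross ?z' ?f)) = k\<^sup>2"
    unfolding ccross_ccross zz zf using ef by (simp_all add: norm_vector_smult norm_cplx norm_power)
  \<comment> \<open>The two polarisations are complex conjugates of each other, so their bilinear
    product is the full squared norm and nothing is lost in the division.\<close>
  have dot: "cdot (ccross ?z ?f) (ccross ?z' ?f) = complex_of_real (N\<^sup>2)"
    using cr t2 unfolding eta cdot_cplx
    by (simp add: complex_eq_iff N2 inner_commute power2_norm_eq_inner[symmetric] power2_eq_square[symmetric])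
  have orth: "cdot z (ccross z w) = 0" for z w by (simp add: cdot_3 algebra_simps)
  let ?D = "diameter \<Omega>"
  have W: "L2norm \<Omega> (cwave ?z) * L2norm \<Omega> (cwave ?z') \<le> Vol2 \<Omega> * (sinh (t * ?D) / t)"
  proof -
    have sq: "exp (- (c * u)) ^ 2 = exp (- 2 * c * u)" for c u :: real
      by (simp add: exp_double[symmetric])
    have "L2norm \<Omega> (cwave ?z) * L2norm \<Omega> (cwave ?z')
      = sqrt ((LINT x|lebesgue_on \<Omega>. exp (- 2 * t * (e \<bullet> x))) * (LINT x|lebesgue_on \<Omega>. exp (2 * t * (e \<bullet> x))))"
      unfolding L2norm_def norm_cwave_cplx real_sqrt_mult inner_scaleR_left sq by simp
    also have "\<dots> \<le> \<bar>Vol2 \<Omega> * (sinh (t * ?D) / t)\<bar>"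
      using exp_weights_product_le[OF \<Omega> ef(1) t0] by (metis real_sqrt_abs real_sqrt_le_iff)
    also have "\<dots> = Vol2 \<Omega> * (sinh (t * ?D) / t)"
      using Vol2_nonneg[OF \<Omega>(1,2)] t0 diameter_ge_0[OF \<Omega>(2)] by (intro abs_of_nonneg mult_nonneg_nonneg) auto
    finally show ?thesis .
  qed
  let ?T = "norm (LINT x|lebesgue_on \<Omega>. complex_of_real (\<sigma> x) * cwave (?z + ?z') x)"
  have "?T * norm (cdot (ccross ?z ?f) (ccross ?z' ?f))
    \<le> \<epsilon> * ((norm (ccross ?z ?f) + norm (ccross ?z (ccross ?z ?f))) *
            max (norm (ccross ?z' ?f)) (norm (ccross ?z' (ccross ?z' ?f))))
        * (L2norm \<Omega> (cwave ?z) * L2norm \<Omega> (cwave ?z'))"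
    by (rule plane_wave_estimate[OF \<Omega>(1,2) pos solv k(1) \<sigma> bound \<epsilon> zz(1) orth zz(2) orth])
  then have "?T * N\<^sup>2 \<le> \<epsilon> * ((N + k\<^sup>2) * max N (k\<^sup>2)) * (L2norm \<Omega> (cwave ?z) * L2norm \<Omega> (cwave ?z'))"
    unfolding neta theta dot by (simp add: norm_power)
  also have "\<dots> \<le> \<epsilon> * (k * (1 + k) * N\<^sup>2) * (Vol2 \<Omega> * (sinh (t * ?D) / t))"
    using polarisation_factor_le[OF k(2) Nk] W \<epsilon> k(2)
    by (intro mult_mono[OF mult_left_mono] mult_nonneg_nonneg L2norm_nonneg) auto
  finally have "?T * N\<^sup>2 \<le> (\<epsilon> * (k * (1 + k)) * (Vol2 \<Omega> * (sinh (t * ?D) / t))) * N\<^sup>2"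
    by (simp add: mult_ac)
  moreover have "0 < N\<^sup>2" using Nk k(2) by simp
  ultimately have "?T \<le> \<epsilon> * (k * (1 + k)) * (Vol2 \<Omega> * (sinh (t * ?D) / t))"
    using mult_le_cancel_right_pos by blast
  moreover have "?z + ?z' = cplx \<xi> 0"
    by (simp add: cplx_add p_def scaleR_2[symmetric])
  ultimately show ?thesis by (simp add: cwave_cplx_0)
qed

section \<open>Splitting the frequencies\<close>

text \<open>Chord slopes from the origin increase: the mean value theorem on \<open>[0, x]\<close>
  and on \<open>[x, y]\<close> compares two values of the increasing function \<open>cosh\<close>.
  This lets the largest admissible \<open>t\<close> stand for all complex frequencies.\<close>

lemma sinh_over_self_mono:
  fixes x y :: real
  assumes "0 < x" "x \<le> y"
  shows "sinh x / x \<le> sinh y / y"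
proof (cases "x = y")
  case False
  then have xy: "x < y" using assms by simp
  have D: "(sinh has_real_derivative cosh u) (at u)" for u :: real
    by (auto intro!: derivative_eq_intros)
  obtain c where c: "0 < c" "c < x" "sinh x - sinh 0 = (x - 0) * cosh c"
    using MVT2[OF assms(1), of sinh cosh] D by blast
  obtain d where d: "x < d" "d < y" "sinh y - sinh x = (y - x) * cosh d"
    using MVT2[OF xy, of sinh cosh] D by blast
  have "cosh c \<le> cosh d" using c d by (intro cosh_real_nonneg_le_iff[THEN iffD2]) auto
  then have "(y - x) * cosh c \<le> sinh y - sinh x" using xy d by simp
  moreover have "sinh x = x * cosh c" using c by simp
  ultimately have "y * cosh c \<le> sinh y" by (simp add: algebra_simps)
  then show ?thesis using \<open>sinh x = x * cosh c\<close> assms by (simp add: field_simps)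
qed simp

text \<open>Functions given on \<open>\<Omega>\<close> are replaced, up to null sets, by Borel
  functions on the whole space that extend them by zero: the setting of the Fourier
  estimates.\<close>

lemma borel_representative:
  fixes s :: "real^3 \<Rightarrow> real"
  assumes \<Omega>: "open \<Omega>" and s: "s \<in> borel_measurable (lebesgue_on \<Omega>)"
  obtains f where "f \<in> borel_measurable borel" "AE x in lborel. f x = indicator \<Omega> x * s x"
proof -
  have "(\<lambda>x. indicator \<Omega> x *\<^sub>R s x) \<in> borel_measurable lebesgue"
    using s \<Omega> by (subst borel_measurable_restrict_space_iff[symmetric]) auto
  then obtain f where f: "f \<in> borel_measurable lborel" "AE x in lborel. indicator \<Omega> x *\<^sub>R s x = f x"
    using completion_ex_borel_measurable_real by blast
  from f(2) have "AE x in lborel. f x = indicator \<Omega> x * s x"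
    by eventually_elim simp
  then show thesis using f(1) that by simp
qed

text \<open>The general \<open>\<Phi>\<close> covers transforms, squares and plain integrability at
  once; \<open>\<Phi> 0 x = 0\<close> makes it compatible with extension by zero.\<close>

lemma
  fixes s f :: "real^3 \<Rightarrow> real" and \<Phi> :: "real \<Rightarrow> real^3 \<Rightarrow> 'b::{banach,second_countable_topology}"
  assumes \<Omega>: "open \<Omega>" and ae: "AE x in lborel. f x = indicator \<Omega> x * s x"
    and \<Phi>: "\<And>x. \<Phi> 0 x = 0"
    and s: "(\<lambda>x. \<Phi> (s x) x) \<in> borel_measurable (lebesgue_on \<Omega>)"
    and f: "(\<lambda>x. \<Phi> (f x) x) \<in> borel_measurable borel"
  shows integral_representative: "(LINT x|lebesgue_on \<Omega>. \<Phi> (s x) x) = (LINT x|lborel. \<Phi> (f x) x)"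
    and integrable_representative:
      "integrable (lebesgue_on \<Omega>) (\<lambda>x. \<Phi> (s x) x) \<longleftrightarrow> integrable lborel (\<lambda>x. \<Phi> (f x) x)"
proof -
  have S: "\<Omega> \<in> sets lebesgue" using \<Omega> by simp
  have m: "(\<lambda>x. indicator \<Omega> x *\<^sub>R \<Phi> (s x) x) \<in> borel_measurable lebesgue"
    using s S by (subst borel_measurable_restrict_space_iff[symmetric]) auto
  have m': "(\<lambda>x. \<Phi> (f x) x) \<in> borel_measurable lebesgue"
    using f by (intro measurable_completion) simp
  have "AE x in lborel. indicator \<Omega> x *\<^sub>R \<Phi> (s x) x = \<Phi> (f x) x"
    using ae by eventually_elim (auto simp: indicator_def \<Phi>)
  then have ae': "AE x in lebesgue. indicator \<Omega> x *\<^sub>R \<Phi> (s x) x = \<Phi> (f x) x"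
    by (rule AE_completion)
  show "(LINT x|lebesgue_on \<Omega>. \<Phi> (s x) x) = (LINT x|lborel. \<Phi> (f x) x)"
    using S f integral_cong_AE[OF m m' ae'] by (simp add: integral_restrict_space integral_completion)
  show "integrable (lebesgue_on \<Omega>) (\<lambda>x. \<Phi> (s x) x) \<longleftrightarrow> integrable lborel (\<lambda>x. \<Phi> (f x) x)"
    using S f integrable_cong_AE[OF m m' ae'] by (simp add: integrable_restrict_space integrable_completion)
qed

section \<open>Vanishing trace on the Fourier side\<close>

lemma trig_vector_derivative:
  fixes \<xi> :: "real^3"
  shows "((\<lambda>t. a * cos (\<xi> \<bullet> (x + t *\<^sub>R axis j 1)) + b * sin (\<xi> \<bullet> (x + t *\<^sub>R axis j 1)))
    has_vector_derivative (b * \<xi> $ j) * cos (\<xi> \<bullet> x) + (- a * \<xi> $ j) * sin (\<xi> \<bullet> x)) (at 0)"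
  unfolding has_real_derivative_iff_has_vector_derivative[symmetric]
  by (auto simp: inner_add_right inner_axis intro!: derivative_eq_intros)

lemma partial_deriv_trig:
  fixes \<xi> :: "real^3"
  shows "partial_deriv j (\<lambda>x. a * cos (\<xi> \<bullet> x) + b * sin (\<xi> \<bullet> x))
    = (\<lambda>x. (b * \<xi> $ j) * cos (\<xi> \<bullet> x) + (- a * \<xi> $ j) * sin (\<xi> \<bullet> x))"
  unfolding partial_deriv_def by (intro ext vector_derivative_at trig_vector_derivative)

lemma smooth_on_trig:
  fixes \<xi> :: "real^3"
  shows "smooth_on UNIV (\<lambda>x. a * cos (\<xi> \<bullet> x) + b * sin (\<xi> \<bullet> x))"
proof -
  have "Ck_on k UNIV (\<lambda>x. a * cos (\<xi> \<bullet> x) + b * sin (\<xi> \<bullet> x))" for k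
  proof (induction k arbitrary: a b)
    case 0
    show ?case by (auto intro!: continuous_intros)
  next
    case (Suc k)
    show ?case
      unfolding Ck_on.simps partial_deriv_trig
      by (intro conjI allI ballI Suc.IH continuous_intros differentiableI_vector[OF trig_vector_derivative])
  qed
  then show ?thesis by (simp add: smooth_on_def)
qed

text \<open>\<open>zero_trace\<close> removes the boundary term of an integration by parts against
  \<open>cis (\<xi> \<bullet> x)\<close>; its test functions are real, so cosine and sine are
  inserted separately. In effect the extension of \<open>\<sigma>\<close> by zero has no jump, and
  its gradient is the extension of \<open>g\<close>.\<close>

lemma zero_trace_fourier:
  assumes \<Omega>: "open \<Omega>" "bounded \<Omega>" and zt: "zero_trace \<Omega> \<sigma> g"
    and \<sigma>: "integrable (lebesgue_on \<Omega>) \<sigma>" and g: "integrable (lebesgue_on \<Omega>) (\<lambda>x. g x $ j)"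
  shows "(LINT x|lebesgue_on \<Omega>. complex_of_real (g x $ j) * cis (\<xi> \<bullet> x))
    = - \<i> * \<xi> $ j * (LINT x|lebesgue_on \<Omega>. complex_of_real (\<sigma> x) * cis (\<xi> \<bullet> x))"
proof -
  let ?M = "lebesgue_on \<Omega>"
  have int: "integrable ?M (\<lambda>x. h x * cos (\<xi> \<bullet> x))" "integrable ?M (\<lambda>x. h x * sin (\<xi> \<bullet> x))"
    if h: "integrable ?M h" for h
  proof -
    have [measurable]: "h \<in> borel_measurable ?M" "(\<lambda>x. \<xi> \<bullet> x) \<in> borel_measurable ?M"
      using h by (auto intro!: lebesgue_on_borel_measurable)
    show "integrable ?M (\<lambda>x. h x * cos (\<xi> \<bullet> x))" "integrable ?M (\<lambda>x. h x * sin (\<xi> \<bullet> x))"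
      by (rule Bochner_Integration.integrable_bound[OF h];
          auto simp: abs_mult mult_left_le)+
  qed
  have split: "(LINT x|?M. complex_of_real (h x) * cis (\<xi> \<bullet> x))
      = Complex (LINT x|?M. h x * cos (\<xi> \<bullet> x)) (LINT x|?M. h x * sin (\<xi> \<bullet> x))"
    if h: "integrable ?M h" for h
  proof -
    have e: "(\<lambda>x. complex_of_real (h x) * cis (\<xi> \<bullet> x))
        = (\<lambda>x. complex_of_real (h x * cos (\<xi> \<bullet> x)) + \<i> * complex_of_real (h x * sin (\<xi> \<bullet> x)))"
      by (auto simp: complex_eq_iff)
    show ?thesis unfolding e using int[OF h] by (simp add: Complex_eq del: of_real_mult)
  qed
  have zt': "(LINT x|?M. \<sigma> x * partial_deriv j \<phi> x + g x $ j * \<phi> x) = 0" if "smooth_on UNIV \<phi>" for \<phi> :: "real^3 \<Rightarrow> real"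
    using zt that by (simp add: zero_trace_def)
  have 1: "(LINT x|?M. (- \<xi> $ j) * (\<sigma> x * sin (\<xi> \<bullet> x)) + g x $ j * cos (\<xi> \<bullet> x)) = 0"
    using zt'[OF smooth_on_trig[of 1 \<xi> 0]] unfolding partial_deriv_trig by (simp add: mult_ac)
  have 2: "(LINT x|?M. \<xi> $ j * (\<sigma> x * cos (\<xi> \<bullet> x)) + g x $ j * sin (\<xi> \<bullet> x)) = 0"
    using zt'[OF smooth_on_trig[of 0 \<xi> 1]] unfolding partial_deriv_trig by (simp add: mult_ac)
  show ?thesis
    unfolding split[OF \<sigma>] split[OF g]
    using 1 2 int[OF \<sigma>] int[OF g] by (simp add: complex_eq_iff)
qed

text \<open>The integrand is dominated pointwise by one constant on the ball, another on the shell,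
  and beyond \<open>\<rho>\<close> by a multiple of the H1 energy density, because there
  \<open>1 + (norm \<xi>)\<^sup>2\<close> exceeds \<open>1 + \<rho>\<^sup>2\<close>. By
  \<open>grad\<close> that density is the sum of the energies of \<open>f\<close> and of the
  \<open>g j\<close>.\<close>

lemma spectral_split:
  fixes f :: "real^3 \<Rightarrow> real" and g :: "3 \<Rightarrow> real^3 \<Rightarrow> real"
  assumes fm: "f \<in> borel_measurable borel"
    and B: "\<And>x. \<bar>f x\<bar> \<le> B" and R: "\<And>x. R < norm x \<Longrightarrow> f x = 0"
    and g: "\<And>j. integrable lborel (g j)" and g2: "\<And>j. integrable lborel (\<lambda>x. (g j x)\<^sup>2)"
    and grad: "\<And>j \<xi>. norm (fourier (g j) \<xi>) = \<bar>\<xi> $ j\<bar> * norm (fourier f \<xi>)"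
    and M: "(LINT x|lborel. (f x)\<^sup>2) + (\<Sum>j\<in>UNIV. LINT x|lborel. (g j x)\<^sup>2) \<le> M"
    and A1: "\<And>\<xi>. norm \<xi> \<le> r \<Longrightarrow> norm (fourier f \<xi>) \<le> A\<^sub>1"
    and A2: "\<And>\<xi>. r < norm \<xi> \<Longrightarrow> norm \<xi> \<le> \<rho> \<Longrightarrow> norm (fourier f \<xi>) \<le> A\<^sub>2"
    and r: "0 \<le> r" "r \<le> \<rho>"
  shows "(LINT x|lborel. (f x)\<^sup>2) \<le> (A\<^sub>1\<^sup>2 * r ^ 3 + A\<^sub>2\<^sup>2 * (\<rho> ^ 3 - r ^ 3)) / (6 * pi\<^sup>2) + M / (1 + \<rho>\<^sup>2)"
proof -
  let ?F = "fourier f"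
  have f: "integrable lborel f" by (rule integrable_bounded_ball[OF fm B R])
  have f2: "integrable lborel (\<lambda>x. (f x)\<^sup>2)"
  proof (rule integrable_bounded_ball)
    show "\<bar>(f x)\<^sup>2\<bar> \<le> B\<^sup>2" for x using power_mono[OF B[of x], of 2] by simp
  qed (use fm R in auto)
  have vol: "integrable lborel (indicator (cball (0::real^3) q) :: _ \<Rightarrow> real)"
    "(LINT \<xi>|lborel. indicator (cball (0::real^3) q) \<xi>) = 4 / 3 * pi * q ^ 3" if "0 \<le> q" for q :: real
  proof -
    have "emeasure lborel (cball (0::real^3) q) = ennreal (4 / 3 * pi * q ^ 3)"
      using that by (simp add: emeasure_cball unit_ball_vol_3)
    then show "integrable lborel (indicator (cball (0::real^3) q) :: _ \<Rightarrow> real)"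
      "(LINT \<xi>|lborel. indicator (cball (0::real^3) q) \<xi>) = 4 / 3 * pi * q ^ 3"
      using that by (auto simp: measure_def)
  qed
  let ?I = "\<lambda>q \<xi>. indicator (cball (0::real^3) q) \<xi> :: real"
  let ?C = "A\<^sub>1\<^sup>2 * (4 / 3 * pi * r ^ 3) + A\<^sub>2\<^sup>2 * (4 / 3 * pi * \<rho> ^ 3 - 4 / 3 * pi * r ^ 3)
     + (1 / (1 + \<rho>\<^sup>2)) * ((2 * pi) ^ 3 * M)"
  have "(2 * pi) ^ DIM(real^3) * (LINT x|lborel. (f x)\<^sup>2) \<le> ?C"
  proof (rule gauss_energy_bound_imp_L2_bound[OF fm B R])
    fix s :: real assume s: "s > 0"
    let ?w = "\<lambda>\<xi>::real^3. gauss (s *\<^sub>R \<xi>)"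
    \<comment> \<open>The energy term is nonnegative and is kept at all frequencies, so that its
      integral is bounded by \<open>gauss_bessel\<close> and \<open>M\<close> without restriction to
      a region.\<close>
    let ?h = "\<lambda>\<xi>. A\<^sub>1\<^sup>2 * ?I r \<xi> + A\<^sub>2\<^sup>2 * (?I \<rho> \<xi> - ?I r \<xi>)
      + (1 / (1 + \<rho>\<^sup>2)) * (?w \<xi> * (norm (?F \<xi>))\<^sup>2 + (\<Sum>j\<in>UNIV. ?w \<xi> * (norm (fourier (g j) \<xi>))\<^sup>2))"
    have iw: "integrable lborel (\<lambda>\<xi>. ?w \<xi> * (norm (?F \<xi>))\<^sup>2)"
      "\<And>j. integrable lborel (\<lambda>\<xi>. ?w \<xi> * (norm (fourier (g j) \<xi>))\<^sup>2)"
      by (intro integrable_gauss_fourier_sq f g s)+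
    have pt: "?w \<xi> * (norm (?F \<xi>))\<^sup>2 \<le> ?h \<xi>" for \<xi>
    proof -
      let ?q = "?w \<xi> * (norm (?F \<xi>))\<^sup>2"
      have q: "0 \<le> ?q" "?q \<le> (norm (?F \<xi>))\<^sup>2"
        using gauss_le_1[of "s *\<^sub>R \<xi>"] by (auto intro: mult_left_le_one_le)
      have "(\<Sum>j\<in>UNIV. ?w \<xi> * (norm (fourier (g j) \<xi>))\<^sup>2) = (norm \<xi>)\<^sup>2 * ?q"
        unfolding grad power_mult_distrib power2_abs power2_norm_eq_inner[of \<xi>]
        by (simp add: sum_3 inner_vec_def power2_eq_square algebra_simps)
      then have e: "?h \<xi> = A\<^sub>1\<^sup>2 * ?I r \<xi> + A\<^sub>2\<^sup>2 * (?I \<rho> \<xi> - ?I r \<xi>) + (1 + (norm \<xi>)\<^sup>2) / (1 + \<rho>\<^sup>2) * ?q"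
        by (simp add: algebra_simps add_divide_distrib)
      have p: "0 < 1 + \<rho>\<^sup>2" by (simp add: add_pos_nonneg)
      have nn: "0 \<le> (1 + (norm \<xi>)\<^sup>2) / (1 + \<rho>\<^sup>2) * ?q" using q p by simp
      consider "norm \<xi> \<le> r" | "r < norm \<xi>" "norm \<xi> \<le> \<rho>" | "\<rho> < norm \<xi>" by linarith
      then show ?thesis
      proof cases
        case 1
        then have "(norm (?F \<xi>))\<^sup>2 \<le> A\<^sub>1\<^sup>2" by (intro power_mono A1) auto
        moreover have "?h \<xi> = A\<^sub>1\<^sup>2 + (1 + (norm \<xi>)\<^sup>2) / (1 + \<rho>\<^sup>2) * ?q" unfolding e using 1 r by simp
        ultimately show ?thesis using q nn by linarith
      next
        case 2
        then have "(norm (?F \<xi>))\<^sup>2 \<le> A\<^sub>2\<^sup>2" by (intro power_mono A2) auto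
        moreover have "?h \<xi> = A\<^sub>2\<^sup>2 + (1 + (norm \<xi>)\<^sup>2) / (1 + \<rho>\<^sup>2) * ?q" unfolding e using 2 r by simp
        ultimately show ?thesis using q nn by linarith
      next
        case 3
        then have "\<rho>\<^sup>2 \<le> (norm \<xi>)\<^sup>2" using r by (intro power_mono) auto
        then have "1 \<le> (1 + (norm \<xi>)\<^sup>2) / (1 + \<rho>\<^sup>2)" using p by simp
        then have "1 * ?q \<le> (1 + (norm \<xi>)\<^sup>2) / (1 + \<rho>\<^sup>2) * ?q" by (intro mult_right_mono q)
        then show ?thesis unfolding e using 3 r by simp
      qed
    qed
    have I: "integrable lborel (?I r)" "integrable lborel (?I \<rho>)" using vol r by auto
    have "(LINT \<xi>|lborel. ?w \<xi> * (norm (?F \<xi>))\<^sup>2) \<le> (LINT \<xi>|lborel. ?h \<xi>)"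
      by (intro Bochner_Integration.integral_mono pt iw Bochner_Integration.integrable_add
          integrable_mult_right Bochner_Integration.integrable_diff Bochner_Integration.integrable_sum I)
    also have "\<dots> = A\<^sub>1\<^sup>2 * (4 / 3 * pi * r ^ 3) + A\<^sub>2\<^sup>2 * (4 / 3 * pi * \<rho> ^ 3 - 4 / 3 * pi * r ^ 3)
      + (1 / (1 + \<rho>\<^sup>2)) * ((LINT \<xi>|lborel. ?w \<xi> * (norm (?F \<xi>))\<^sup>2)
        + (\<Sum>j\<in>UNIV. LINT \<xi>|lborel. ?w \<xi> * (norm (fourier (g j) \<xi>))\<^sup>2))"
      unfolding vol(2)[OF r(1), symmetric] vol(2)[OF order_trans[OF r], symmetric] using I iw by simp
    also have "\<dots> \<le> ?C"
    proof -
      have "(LINT \<xi>|lborel. ?w \<xi> * (norm (?F \<xi>))\<^sup>2)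
        + (\<Sum>j\<in>UNIV. LINT \<xi>|lborel. ?w \<xi> * (norm (fourier (g j) \<xi>))\<^sup>2)
        \<le> (2 * pi) ^ DIM(real^3) * (LINT x|lborel. (f x)\<^sup>2)
          + (\<Sum>j\<in>UNIV. (2 * pi) ^ DIM(real^3) * (LINT x|lborel. (g j x)\<^sup>2))"
        by (intro add_mono sum_mono gauss_bessel f f2 g g2 s)
      also have "\<dots> = (2 * pi) ^ 3 * ((LINT x|lborel. (f x)\<^sup>2) + (\<Sum>j\<in>UNIV. LINT x|lborel. (g j x)\<^sup>2))"
        by (simp add: sum_distrib_left distrib_left)
      also have "\<dots> \<le> (2 * pi) ^ 3 * M" by (intro mult_left_mono M) simp
      finally show ?thesis by (intro add_left_mono mult_left_mono) auto
    qed
    finally show "(LINT \<xi>|lborel. ?w \<xi> * (norm (?F \<xi>))\<^sup>2) \<le> ?C" .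
  qed
  then have "(LINT x|lborel. (f x)\<^sup>2) \<le> ?C / (2 * pi) ^ 3"
    by (simp add: pos_le_divide_eq mult.commute)
  also have "\<dots> = (A\<^sub>1\<^sup>2 * r ^ 3 + A\<^sub>2\<^sup>2 * (\<rho> ^ 3 - r ^ 3)) / (6 * pi\<^sup>2) + M / (1 + \<rho>\<^sup>2)"
  proof -
    have "?C = (2 * pi) ^ 3 * ((A\<^sub>1\<^sup>2 * r ^ 3 + A\<^sub>2\<^sup>2 * (\<rho> ^ 3 - r ^ 3)) / (6 * pi\<^sup>2) + M / (1 + \<rho>\<^sup>2))"
      by (simp add: distrib_left power3_eq_cube power2_eq_square field_simps)
    then show ?thesis by simp
  qed
  finally show ?thesis .
qed


lemma L2norm_split:
  assumes \<Omega>: "open \<Omega>" "bounded \<Omega>" and \<sigma>: "Linfty \<Omega> \<sigma>"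
    and wg: "weak_grad \<Omega> \<sigma> g" and H1: "H1norm \<Omega> \<sigma> g \<le> M" and zt: "zero_trace \<Omega> \<sigma> g"
    and A1: "\<And>\<xi>. norm \<xi> \<le> r \<Longrightarrow> norm (LINT x|lebesgue_on \<Omega>. complex_of_real (\<sigma> x) * cis (\<xi> \<bullet> x)) \<le> A\<^sub>1"
    and A2: "\<And>\<xi>. r < norm \<xi> \<Longrightarrow> norm \<xi> \<le> \<rho> \<Longrightarrow>
      norm (LINT x|lebesgue_on \<Omega>. complex_of_real (\<sigma> x) * cis (\<xi> \<bullet> x)) \<le> A\<^sub>2"
    and r: "0 \<le> r" "r \<le> \<rho>"
  shows "(L2norm \<Omega> \<sigma>)\<^sup>2 \<le> (A\<^sub>1\<^sup>2 * r ^ 3 + A\<^sub>2\<^sup>2 * (\<rho> ^ 3 - r ^ 3)) / (6 * pi\<^sup>2) + M\<^sup>2 / (1 + \<rho>\<^sup>2)"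
proof -
  let ?M = "lebesgue_on \<Omega>"
  interpret finite_measure ?M
    using \<Omega> by (intro finite_measure_lebesgue_on lmeasurable_open)
  have [measurable]: "\<Omega> \<in> sets borel" using \<Omega>(1) by simp
  have \<sigma>m [measurable]: "\<sigma> \<in> borel_measurable ?M" using \<sigma> by (simp add: Linfty_def)
  have \<sigma>2: "integrable ?M (\<lambda>x. (\<sigma> x)\<^sup>2)" and gm: "g \<in> borel_measurable ?M"
    and g2: "integrable ?M (\<lambda>x. (norm (g x))\<^sup>2)"
    using wg by (auto simp: weak_grad_def L2_def)
  have gjm [measurable]: "(\<lambda>x. g x $ j) \<in> borel_measurable ?M" for j
    by (rule measurable_compose[OF gm borel_measurable_continuous_onI]) (intro continuous_intros)
  have gj2: "integrable ?M (\<lambda>x. (g x $ j)\<^sup>2)" for j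
  proof (rule Bochner_Integration.integrable_bound[OF g2])
    have "norm ((g x $ j)\<^sup>2) \<le> norm ((norm (g x))\<^sup>2)" for x
      using power_mono[OF component_le_norm_cart[of "g x" j], of 2] by simp
    then show "AE x in ?M. norm ((g x $ j)\<^sup>2) \<le> norm ((norm (g x))\<^sup>2)" by simp
  qed simp
  \<comment> \<open>On a finite measure space \<open>\<bar>u\<bar> \<le> 1 + u\<^sup>2\<close> makes
    square integrable functions integrable, as the Fourier estimates require.\<close>
  have int1: "integrable ?M h" if [measurable]: "h \<in> borel_measurable ?M" and "integrable ?M (\<lambda>x. (h x)\<^sup>2)" for h :: "real^3 \<Rightarrow> real"
  proof (rule Bochner_Integration.integrable_bound)
    show "integrable ?M (\<lambda>x. 1 + (h x)\<^sup>2)"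
      by (intro Bochner_Integration.integrable_add that(2)) simp
    have "\<bar>u\<bar> \<le> 1 + u\<^sup>2" for u :: real
      using sum_squares_bound[of 1 "\<bar>u\<bar>"] by simp
    then show "AE x in ?M. norm (h x) \<le> norm (1 + (h x)\<^sup>2)" by simp
  qed simp
  have i\<sigma>: "integrable ?M \<sigma>" by (rule int1[OF \<sigma>m \<sigma>2])
  have ig: "integrable ?M (\<lambda>x. g x $ j)" for j by (rule int1[OF gjm gj2])
  obtain B where B: "AE x in ?M. \<bar>\<sigma> x\<bar> \<le> B" using \<sigma> by (auto simp: Linfty_def)
  have S: "\<Omega> \<inter> space lebesgue \<in> sets lebesgue" using \<Omega>(1) by simp
  have B': "AE x in lborel. x \<in> \<Omega> \<longrightarrow> \<bar>\<sigma> x\<bar> \<le> B"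
    using B unfolding AE_restrict_space_iff[OF S] AE_completion_iff .
  obtain f0 where [measurable]: "f0 \<in> borel_measurable borel" and f0: "AE x in lborel. f0 x = indicator \<Omega> x * \<sigma> x"
    using borel_representative[OF \<Omega>(1) \<sigma>m] .
  \<comment> \<open>Clipping at \<open>\<bar>B\<bar>\<close> and multiplying by the indicator make
    the bound and the support condition hold at every point, not only almost everywhere.\<close>
  define f where "f x = indicator \<Omega> x * max (- \<bar>B\<bar>) (min \<bar>B\<bar> (f0 x))" for x
  have fm [measurable]: "f \<in> borel_measurable borel" unfolding f_def by measurable
  have ae: "AE x in lborel. f x = indicator \<Omega> x * \<sigma> x"
    using f0 B' by eventually_elim (auto simp: f_def indicator_def)
  have fB: "\<bar>f x\<bar> \<le> \<bar>B\<bar>" for x by (auto simp: f_def indicator_def)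
  obtain R where R: "\<And>x. x \<in> \<Omega> \<Longrightarrow> norm x \<le> R" using \<Omega>(2) unfolding bounded_iff by blast
  have fR: "f x = 0" if "R < norm x" for x using R[of x] that by (auto simp: f_def indicator_def)
  have "\<forall>j. \<exists>h. h \<in> borel_measurable borel \<and> (AE x in lborel. h x = indicator \<Omega> x * g x $ j)"
    using borel_representative[OF \<Omega>(1) gjm] by metis
  from choice[OF this] obtain h where hm [measurable]: "\<And>j. h j \<in> borel_measurable borel"
    and ha: "\<And>j. AE x in lborel. h j x = indicator \<Omega> x * g x $ j" by blast
  have [measurable]: "(\<lambda>x. \<xi> \<bullet> x) \<in> borel_measurable ?M" for \<xi> :: "real^3"
    by (intro lebesgue_on_borel_measurable) simp
  have F: "fourier f \<xi> = (LINT x|?M. complex_of_real (\<sigma> x) * cis (\<xi> \<bullet> x))" for \<xi>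
    unfolding fourier_def
    by (rule integral_representative[OF \<Omega>(1) ae, of "\<lambda>y x. complex_of_real y * cis (\<xi> \<bullet> x)", symmetric]) auto
  have G: "fourier (h j) \<xi> = (LINT x|?M. complex_of_real (g x $ j) * cis (\<xi> \<bullet> x))" for j \<xi>
    unfolding fourier_def
    by (rule integral_representative[OF \<Omega>(1) ha, of "\<lambda>y x. complex_of_real y * cis (\<xi> \<bullet> x)", symmetric]) auto
  have nf: "(LINT x|lborel. (f x)\<^sup>2) = (L2norm \<Omega> \<sigma>)\<^sup>2"
    using integral_representative[OF \<Omega>(1) ae, of "\<lambda>y x. y\<^sup>2"] by (simp add: L2norm_def integral_nonneg)
  have nh: "(LINT x|lborel. (h j x)\<^sup>2) = (LINT x|?M. (g x $ j)\<^sup>2)" for j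
    by (rule integral_representative[OF \<Omega>(1) ha, of "\<lambda>y x. y\<^sup>2", symmetric]) auto
  have ng: "(\<Sum>j\<in>UNIV. LINT x|lborel. (h j x)\<^sup>2) = (L2norm \<Omega> g)\<^sup>2"
  proof -
    have "(norm (g x))\<^sup>2 = (\<Sum>j\<in>UNIV. (g x $ j)\<^sup>2)" for x
      by (simp add: norm_vec_def L2_set_def sum_nonneg)
    then have "(L2norm \<Omega> g)\<^sup>2 = (LINT x|?M. (\<Sum>j\<in>UNIV. (g x $ j)\<^sup>2))"
      by (simp add: L2norm_def integral_nonneg sum_nonneg)
    also have "\<dots> = (\<Sum>j\<in>UNIV. LINT x|?M. (g x $ j)\<^sup>2)"
      by (rule Bochner_Integration.integral_sum) (rule gj2)
    finally show ?thesis by (simp add: nh)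
  qed
  show ?thesis
    unfolding nf[symmetric]
  proof (rule spectral_split[OF fm fB fR])
    show "integrable lborel (h j)" for j
      using ig[of j] integrable_representative[OF \<Omega>(1) ha[of j], of "\<lambda>y x. y"] by simp
    show "integrable lborel (\<lambda>x. (h j x)\<^sup>2)" for j
      using gj2[of j] integrable_representative[OF \<Omega>(1) ha[of j], of "\<lambda>y x. y\<^sup>2"] by simp
    show "norm (fourier (h j) \<xi>) = \<bar>\<xi> $ j\<bar> * norm (fourier f \<xi>)" for j \<xi>
      unfolding F G zero_trace_fourier[OF \<Omega> zt i\<sigma> ig] by (simp add: norm_mult)
    have "(H1norm \<Omega> \<sigma> g)\<^sup>2 \<le> M\<^sup>2" using H1 by (intro power_mono) (auto simp: H1norm_def)
    then show "(LINT x|lborel. (f x)\<^sup>2) + (\<Sum>j\<in>UNIV. LINT x|lborel. (h j x)\<^sup>2) \<le> M\<^sup>2"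
      unfolding nf ng by (simp add: H1norm_def)
  qed (use A1 A2 r in \<open>auto simp: F\<close>)
qed

text \<open>The gap is exactly \<open>(\<rho> - r)\<^sup>2 * (\<rho> + 2 * r) / 2\<close>. The
  right-hand side is chosen for its factor \<open>\<rho>\<^sup>2 - r\<^sup>2\<close>, which is
  explicit for the shell used in the theorem.\<close>

lemma cube_diff_le:
  fixes r \<rho> :: real
  assumes "0 \<le> r" "r \<le> \<rho>"
  shows "\<rho> ^ 3 - r ^ 3 \<le> 3 / 2 * \<rho> * (\<rho>\<^sup>2 - r\<^sup>2)"
proof -
  have "0 \<le> (\<rho> - r)\<^sup>2 * (\<rho> + 2 * r) / 2" using assms by simp
  also have "\<dots> = 3 / 2 * \<rho> * (\<rho>\<^sup>2 - r\<^sup>2) - (\<rho> ^ 3 - r ^ 3)"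
    by (simp add: power2_eq_square power3_eq_cube field_simps)
  finally show ?thesis by simp
qed

text \<open>Below the threshold \<open>k\<close> only real frequencies are used, and
  \<open>\<alpha>\<close> trades the amplification \<open>k powr (3 * \<alpha>)\<close> against the
  size of the tail. From the threshold on, a shell of complex frequencies is added, as far as its
  exponential cost stays within one of the two powers of \<open>\<epsilon>\<close>.\<close>

theorem theorem2p1:
  fixes \<Omega> :: "(real^3) set" and \<epsilon>\<^sub>0 \<mu>\<^sub>0 \<omega> k M\<^sub>1 \<alpha> \<epsilon> :: real
    and \<sigma> :: "real^3 \<Rightarrow> real"
  assumes dom: "open \<Omega>" "connected \<Omega>" "bounded \<Omega>" "\<Omega> \<noteq> {}" "C2_boundary \<Omega>"
    and pos: "\<epsilon>\<^sub>0 > 0" "\<mu>\<^sub>0 > 0" "\<omega> > 0"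
    and solv: "uniquely_solvable \<omega> \<epsilon>\<^sub>0 \<mu>\<^sub>0 \<Omega> \<sigma>"
    and kdef: "k = \<omega> * sqrt (\<epsilon>\<^sub>0 * \<mu>\<^sub>0)"
    and sig_inf: "Linfty \<Omega> \<sigma>"
    and sig_H1: "\<exists>g. weak_grad \<Omega> \<sigma> g \<and> H1norm \<Omega> \<sigma> g \<le> M\<^sub>1 \<and> zero_trace \<Omega> \<sigma> g"
    and k1: "k \<ge> 1"
    and alpha: "0 < \<alpha>" "\<alpha> \<le> 1"
    and epsnorm: "is_Lambda'_norm \<omega> \<epsilon>\<^sub>0 \<mu>\<^sub>0 \<Omega> \<sigma> \<epsilon>"
    and eps: "0 < \<epsilon>" "\<epsilon> < 1"
  shows "let \<E> = - ln \<epsilon>; chi = (if k \<le> \<E> then 1 else 0 :: real);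
             D = diameter \<Omega> in
         (L2norm \<Omega> \<sigma>)\<^sup>2 \<le>
           4 / (3 * pi\<^sup>2) * (Vol \<Omega>)\<^sup>2 *
             ((1 - chi) * (1 + k) ^ 4 * k powr (3 * \<alpha>) + chi * (1 + \<E>) ^ 4 * \<E> ^ 3) * \<epsilon>\<^sup>2
         + chi * (1 / (4 * pi\<^sup>2)) * (Vol2 \<Omega>)\<^sup>2 * (1 / D) * sqrt (1 + (2 * D)\<^sup>2)
             * (1 + \<E>) ^ 4 * \<E> * \<epsilon>
         + M\<^sub>1\<^sup>2 * ((1 - chi) * (1 / (1 + 2 * \<E> powr (2 * \<alpha>) + 2 * k powr (2 * \<alpha>)))
                  + chi * (1 / (1 + \<E>\<^sup>2 / D\<^sup>2 + 4 * k\<^sup>2)))"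
proof -
  obtain g where g: "weak_grad \<Omega> \<sigma> g" "H1norm \<Omega> \<sigma> g \<le> M\<^sub>1" "zero_trace \<Omega> \<sigma> g"
    using sig_H1 by blast
  have bound: "Lambda'_bound \<omega> \<epsilon>\<^sub>0 \<mu>\<^sub>0 \<Omega> \<sigma> \<epsilon>" using epsnorm by (simp add: is_Lambda'_norm_def)
  define E where "E = - ln \<epsilon>"
  define D where "D = diameter \<Omega>"
  have E0: "0 < E" using eps by (simp add: E_def)
  have expE: "exp E = 1 / \<epsilon>" using eps by (simp add: E_def exp_minus inverse_eq_divide)
  define T where "T \<xi> = norm (LINT x|lebesgue_on \<Omega>. complex_of_real (\<sigma> x) * cis (\<xi> \<bullet> x))" for \<xi>
  define A\<^sub>1 where "A\<^sub>1 = \<epsilon> * (k * (1 + k)) * Vol \<Omega>"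
  have low: "T \<xi> \<le> A\<^sub>1" if "norm \<xi> \<le> 2 * k" for \<xi>
    unfolding T_def A\<^sub>1_def
    by (rule fourier_bound_low[OF dom(1,3) pos solv kdef k1 sig_inf bound]) (use eps that in auto)
  note split = L2norm_split[OF dom(1,3) sig_inf g, folded T_def]
  \<comment> \<open>Used with \<open>q = k\<close> and with \<open>q = E\<close>: the squared
    polarisation factor becomes the fourth power of the statement in either case.\<close>
  have kk: "(k * (1 + k))\<^sup>2 \<le> (1 + q) ^ 4" if "k \<le> q" for q
  proof -
    have "k * (1 + k) \<le> (1 + q) * (1 + q)" using that k1 by (intro mult_mono) auto
    then have "(k * (1 + k))\<^sup>2 \<le> ((1 + q) * (1 + q))\<^sup>2" using k1 by (intro power_mono) auto
    then show ?thesis by (simp add: power2_eq_square power4_eq_xxxx mult_ac)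
  qed
  show ?thesis
  proof (cases "k \<le> E")
    case False
    \<comment> \<open>As \<open>k powr \<alpha> \<le> k\<close>, this radius stays within the range
      of \<open>low\<close>. Its cube gives the constant \<open>8 / 6 = 4 / 3\<close>, and its
      square leaves room for both powers in the denominator.\<close>
    define \<rho> where "\<rho> = 2 * k powr \<alpha>"
    have "k powr \<alpha> \<le> k powr 1" using k1 alpha by (intro powr_mono) auto
    then have \<rho>: "0 \<le> \<rho>" "\<rho> \<le> 2 * k" using k1 by (auto simp: \<rho>_def)
    have \<rho>2: "\<rho>\<^sup>2 = 4 * k powr (2 * \<alpha>)" and \<rho>3: "\<rho> ^ 3 = 8 * k powr (3 * \<alpha>)"
      using k1 powr_powr[of k \<alpha> 2] powr_powr[of k \<alpha> 3]
      by (simp_all add: \<rho>_def power_mult_distrib mult.commute)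
    \<comment> \<open>The inner radius equals the outer one, so the shell is empty and
      \<open>A\<^sub>1\<close> may stand for the second bound too.\<close>
    have "(L2norm \<Omega> \<sigma>)\<^sup>2 \<le> (A\<^sub>1\<^sup>2 * \<rho> ^ 3 + A\<^sub>1\<^sup>2 * (\<rho> ^ 3 - \<rho> ^ 3)) / (6 * pi\<^sup>2) + M\<^sub>1\<^sup>2 / (1 + \<rho>\<^sup>2)"
      by (rule split) (use low \<rho> in auto)
    also have "\<dots> = A\<^sub>1\<^sup>2 * \<rho> ^ 3 / (6 * pi\<^sup>2) + M\<^sub>1\<^sup>2 * (1 / (1 + \<rho>\<^sup>2))" by simp
    also have "\<dots> \<le> 4 / (3 * pi\<^sup>2) * (Vol \<Omega>)\<^sup>2 * ((1 + k) ^ 4 * k powr (3 * \<alpha>)) * \<epsilon>\<^sup>2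
       + M\<^sub>1\<^sup>2 * (1 / (1 + 2 * E powr (2 * \<alpha>) + 2 * k powr (2 * \<alpha>)))"
    proof (intro add_mono mult_left_mono)
      have "A\<^sub>1\<^sup>2 * \<rho> ^ 3 / (6 * pi\<^sup>2)
          = 4 / (3 * pi\<^sup>2) * (Vol \<Omega>)\<^sup>2 * ((k * (1 + k))\<^sup>2 * k powr (3 * \<alpha>)) * \<epsilon>\<^sup>2"
        unfolding A\<^sub>1_def \<rho>3 power_mult_distrib by (simp add: field_simps)
      also have "\<dots> \<le> 4 / (3 * pi\<^sup>2) * (Vol \<Omega>)\<^sup>2 * ((1 + k) ^ 4 * k powr (3 * \<alpha>)) * \<epsilon>\<^sup>2"
        by (intro mult_right_mono mult_left_mono kk) auto
      finally show "A\<^sub>1\<^sup>2 * \<rho> ^ 3 / (6 * pi\<^sup>2) \<le> \<dots>" .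
      \<comment> \<open>Half of \<open>4 * k powr (2 * \<alpha>)\<close> is traded for the power of
        \<open>E\<close>, which is below \<open>k\<close> in this case.\<close>
      have "E powr (2 * \<alpha>) \<le> k powr (2 * \<alpha>)" using False E0 alpha by (intro powr_mono2) auto
      then show "1 / (1 + \<rho>\<^sup>2) \<le> 1 / (1 + 2 * E powr (2 * \<alpha>) + 2 * k powr (2 * \<alpha>))"
        unfolding \<rho>2 by (intro divide_left_mono mult_pos_pos add_pos_nonneg) auto
    qed simp
    finally show ?thesis using False by (simp add: Let_def E_def[symmetric] D_def[symmetric] mult.assoc)
  next
    case True
    have D0: "0 < D"
    proof -
      obtain x r where x: "r > 0" "ball x r \<subseteq> \<Omega>"
        using dom(1,4) open_contains_ball by (metis all_not_in_conv)
      have "r \<le> D" unfolding D_def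
        using diameter_subset[OF x(2) dom(3)] x(1) by simp
      then show ?thesis using x by simp
    qed
    \<comment> \<open>Since \<open>t\<^sup>2 = (norm \<xi>)\<^sup>2 / 4 - k\<^sup>2\<close>, the
      condition \<open>norm \<xi> \<le> \<rho>\<close> amounts to
      \<open>t \<le> E / (2 * D)\<close>; moreover \<open>1 + \<rho>\<^sup>2\<close> is the
      denominator of the statement.\<close>
    define \<rho> where "\<rho> = sqrt (E\<^sup>2 / D\<^sup>2 + 4 * k\<^sup>2)"
    have \<rho>2: "\<rho>\<^sup>2 = E\<^sup>2 / D\<^sup>2 + 4 * k\<^sup>2" by (simp add: \<rho>_def)
    have r\<rho>: "2 * k \<le> \<rho>" unfolding \<rho>_def by (rule real_le_rsqrt) (simp add: power_mult_distrib)
    \<comment> \<open>The value of \<open>sinh (t * D) / t\<close> at the largest admissible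
      \<open>t = E / (2 * D)\<close>.\<close>
    define S where "S = D * (sinh (E / 2) / (E / 2))"
    define A\<^sub>2 where "A\<^sub>2 = \<epsilon> * (k * (1 + k)) * (Vol2 \<Omega> * S)"
    have V2: "0 \<le> Vol2 \<Omega>" by (rule Vol2_nonneg[OF dom(1,3)])
    have high: "T \<xi> \<le> A\<^sub>2" if \<xi>: "2 * k < norm \<xi>" "norm \<xi> \<le> \<rho>" for \<xi>
    proof -
      define t where "t = sqrt ((norm \<xi>)\<^sup>2 / 4 - k\<^sup>2)"
      have "(2 * k)\<^sup>2 < (norm \<xi>)\<^sup>2" using \<xi> k1 by (intro power_strict_mono) auto
      then have t0: "0 < t" by (simp add: t_def power_mult_distrib)
      have "(norm \<xi>)\<^sup>2 \<le> \<rho>\<^sup>2" using \<xi> by (intro power_mono) auto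
      then have "t \<le> sqrt ((E / (2 * D))\<^sup>2)"
        unfolding t_def \<rho>2 by (intro real_sqrt_le_mono) (simp add: power_divide power_mult_distrib)
      then have "t \<le> E / (2 * D)" using E0 D0 by (simp only: real_sqrt_abs) simp
      then have "t * D \<le> E / 2" using D0 by (simp add: field_simps)
      then have "sinh (t * D) / (t * D) \<le> sinh (E / 2) / (E / 2)"
        using t0 D0 by (intro sinh_over_self_mono) auto
      then have "sinh (t * D) / t \<le> S" using D0 t0 by (simp add: S_def field_simps)
      then have "\<epsilon> * (k * (1 + k)) * (Vol2 \<Omega> * (sinh (t * D) / t)) \<le> A\<^sub>2"
        unfolding A\<^sub>2_def using eps k1 V2 by (intro mult_left_mono) auto
      moreover have "T \<xi> \<le> \<epsilon> * (k * (1 + k)) * (Vol2 \<Omega> * (sinh (t * D) / t))"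
        unfolding T_def D_def
        by (rule fourier_bound_high[OF dom(1,3,4) pos solv kdef k1 sig_inf bound _ \<xi>(1) t_def]) (use eps in auto)
      ultimately show ?thesis by simp
    qed
    have "(L2norm \<Omega> \<sigma>)\<^sup>2 \<le> (A\<^sub>1\<^sup>2 * (2 * k) ^ 3 + A\<^sub>2\<^sup>2 * (\<rho> ^ 3 - (2 * k) ^ 3)) / (6 * pi\<^sup>2) + M\<^sub>1\<^sup>2 / (1 + \<rho>\<^sup>2)"
      by (rule split) (use low high r\<rho> k1 in auto)
    also have "\<dots> = A\<^sub>1\<^sup>2 * (2 * k) ^ 3 / (6 * pi\<^sup>2) + A\<^sub>2\<^sup>2 * (\<rho> ^ 3 - (2 * k) ^ 3) / (6 * pi\<^sup>2)
        + M\<^sub>1\<^sup>2 * (1 / (1 + E\<^sup>2 / D\<^sup>2 + 4 * k\<^sup>2))"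
      by (simp add: \<rho>2 add_divide_distrib add.assoc)
    also have "\<dots> \<le> 4 / (3 * pi\<^sup>2) * (Vol \<Omega>)\<^sup>2 * ((1 + E) ^ 4 * E ^ 3) * \<epsilon>\<^sup>2
       + (1 / (4 * pi\<^sup>2)) * (Vol2 \<Omega>)\<^sup>2 * (1 / D) * sqrt (1 + (2 * D)\<^sup>2) * (1 + E) ^ 4 * E * \<epsilon>
       + M\<^sub>1\<^sup>2 * (1 / (1 + E\<^sup>2 / D\<^sup>2 + 4 * k\<^sup>2))"
    proof (intro add_mono order_refl)
      \<comment> \<open>The constant \<open>4 / 3\<close> is \<open>8 / 6\<close>, from the cube of
        the radius \<open>2 * k\<close>.\<close>
      have "A\<^sub>1\<^sup>2 * (2 * k) ^ 3 / (6 * pi\<^sup>2)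
          = 4 / (3 * pi\<^sup>2) * (Vol \<Omega>)\<^sup>2 * ((k * (1 + k))\<^sup>2 * k ^ 3) * \<epsilon>\<^sup>2"
        unfolding A\<^sub>1_def power_mult_distrib by (simp add: field_simps)
      also have "\<dots> \<le> 4 / (3 * pi\<^sup>2) * (Vol \<Omega>)\<^sup>2 * ((1 + E) ^ 4 * E ^ 3) * \<epsilon>\<^sup>2"
        using k1 True E0 by (intro mult_right_mono mult_left_mono mult_mono kk power_mono) auto
      finally show "A\<^sub>1\<^sup>2 * (2 * k) ^ 3 / (6 * pi\<^sup>2) \<le> \<dots>" .
      \<comment> \<open>Bounding \<open>2 * sinh (E / 2)\<close> by the exponential costs
        \<open>exp E = 1 / \<epsilon>\<close> in the square, which leaves a single power of
        \<open>\<epsilon>\<close> in \<open>A\<^sub>2\<^sup>2\<close>.\<close>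
      have "2 * sinh (E / 2) \<le> exp (E / 2)" by (simp add: sinh_def)
      then have "(2 * sinh (E / 2))\<^sup>2 \<le> (exp (E / 2))\<^sup>2" using E0 by (intro power_mono) auto
      also have "\<dots> = 1 / \<epsilon>" by (simp add: expE exp_double[symmetric])
      finally have sh: "(2 * sinh (E / 2))\<^sup>2 \<le> 1 / \<epsilon>" .
      have "A\<^sub>2\<^sup>2 = \<epsilon>\<^sup>2 * (k * (1 + k))\<^sup>2 * ((Vol2 \<Omega>)\<^sup>2 * (D\<^sup>2 / E\<^sup>2)) * (2 * sinh (E / 2))\<^sup>2"
        by (simp add: A\<^sub>2_def S_def power_mult_distrib power_divide)
      also have "\<dots> \<le> \<epsilon>\<^sup>2 * (1 + E) ^ 4 * ((Vol2 \<Omega>)\<^sup>2 * (D\<^sup>2 / E\<^sup>2)) * (1 / \<epsilon>)"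
        using sh kk[OF True] E0 by (intro mult_mono mult_right_mono mult_left_mono) auto
      also have "\<dots> = \<epsilon> * (1 + E) ^ 4 * ((Vol2 \<Omega>)\<^sup>2 * (D\<^sup>2 / E\<^sup>2))"
        using eps by (simp add: power2_eq_square)
      finally have A2: "A\<^sub>2\<^sup>2 \<le> \<epsilon> * (1 + E) ^ 4 * ((Vol2 \<Omega>)\<^sup>2 * (D\<^sup>2 / E\<^sup>2))" .
      \<comment> \<open>Here \<open>k \<le> E\<close> enters: \<open>4 * k\<^sup>2\<close> is at
        most \<open>(E / D)\<^sup>2 * (2 * D)\<^sup>2\<close>, hence the factor
        \<open>sqrt (1 + (2 * D)\<^sup>2)\<close>.\<close>
      have "\<rho> \<le> sqrt ((E / D)\<^sup>2 * (1 + (2 * D)\<^sup>2))"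
        unfolding \<rho>_def using D0 True k1
        by (intro real_sqrt_le_mono) (simp add: field_simps power_mult_distrib power_mono)
      also have "\<dots> = E / D * sqrt (1 + (2 * D)\<^sup>2)" using E0 D0 by (simp add: real_sqrt_mult)
      finally have \<rho>le: "\<rho> \<le> E / D * sqrt (1 + (2 * D)\<^sup>2)" .
      \<comment> \<open>By the choice of \<open>\<rho>\<close>,
        \<open>\<rho>\<^sup>2 - (2 * k)\<^sup>2 = E\<^sup>2 / D\<^sup>2\<close>, which cancels the
        factor \<open>D\<^sup>2 / E\<^sup>2\<close> in the bound for
        \<open>A\<^sub>2\<^sup>2\<close> and leaves one power of \<open>E / D\<close>.\<close>
      have "\<rho> ^ 3 - (2 * k) ^ 3 \<le> 3 / 2 * \<rho> * (\<rho>\<^sup>2 - (2 * k)\<^sup>2)"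
        using k1 r\<rho> by (intro cube_diff_le) auto
      also have "\<dots> = 3 / 2 * (E\<^sup>2 / D\<^sup>2) * \<rho>" by (simp add: \<rho>2 power_mult_distrib)
      also have "\<dots> \<le> 3 / 2 * (E\<^sup>2 / D\<^sup>2) * (E / D * sqrt (1 + (2 * D)\<^sup>2))"
        by (intro mult_left_mono \<rho>le) simp
      finally have c: "\<rho> ^ 3 - (2 * k) ^ 3 \<le> 3 / 2 * (E\<^sup>2 / D\<^sup>2) * (E / D * sqrt (1 + (2 * D)\<^sup>2))" .
      have "0 \<le> \<rho> ^ 3 - (2 * k) ^ 3" using power_mono[OF r\<rho>, of 3] k1 by simp
      then have "A\<^sub>2\<^sup>2 * (\<rho> ^ 3 - (2 * k) ^ 3) \<le> (\<epsilon> * (1 + E) ^ 4 * ((Vol2 \<Omega>)\<^sup>2 * (D\<^sup>2 / E\<^sup>2)))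
          * (3 / 2 * (E\<^sup>2 / D\<^sup>2) * (E / D * sqrt (1 + (2 * D)\<^sup>2)))"
        using A2 c eps E0 by (intro mult_mono) auto
      also have "\<dots> = 3 / 2 * (\<epsilon> * (1 + E) ^ 4 * (Vol2 \<Omega>)\<^sup>2 * (E / D * sqrt (1 + (2 * D)\<^sup>2)))"
        using E0 D0 by simp
      finally have "A\<^sub>2\<^sup>2 * (\<rho> ^ 3 - (2 * k) ^ 3) / (6 * pi\<^sup>2)
         \<le> 3 / 2 * (\<epsilon> * (1 + E) ^ 4 * (Vol2 \<Omega>)\<^sup>2 * (E / D * sqrt (1 + (2 * D)\<^sup>2))) / (6 * pi\<^sup>2)"
        by (intro divide_right_mono) auto
      \<comment> \<open>The constant \<open>1 / 4\<close> is \<open>3 / 2\<close> from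
        \<open>cube_diff_le\<close> divided by 6.\<close>
      also have "\<dots> = (1 / (4 * pi\<^sup>2)) * (Vol2 \<Omega>)\<^sup>2 * (1 / D) * sqrt (1 + (2 * D)\<^sup>2) * (1 + E) ^ 4 * E * \<epsilon>"
        by (simp add: mult_ac)
      finally show "A\<^sub>2\<^sup>2 * (\<rho> ^ 3 - (2 * k) ^ 3) / (6 * pi\<^sup>2) \<le> \<dots>" .
    qed
    finally show ?thesis using True by (simp add: Let_def E_def[symmetric] D_def[symmetric] mult.assoc)
  qed
qed

end
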